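(* Let $\sigma\in\mathcal{D}^{1,6,10}$ be general. The projection $\mathbf{P}(\mathcal{V}_2)\to\mathbf{P}(V_{10})$ restricts to a birational morphism $X_{1.1}^\sigma\to X_1^\sigma$.
   Context: Work over $\mathbb{C}$; subscripts of vector spaces denote dimensions and $\mathbf{P}(E)$ is the projective space (bundle) of lines in $E$. Let $V_{10}$ be $10$-dimensional and $$\mathcal{D}^{1,6,10}=\{\sigma\in\wedge^3V_{10}^\vee\mid \exists\, V_1\subset V_6\subset V_{10}\text{ such that }\sigma(V_1,V_6,V_{10})=0\}.$$ "General" means belonging to a suitable dense Zariski-open subset; for general $\sigma\in\mathcal{D}^{1,6,10}$ the flag $V_1\subset V_6$ is unique and is fixed. The Peskine sixfold is $$X_1^\sigma=\{[U_1]\in\mathbf{P}(V_{10})\mid\operatorname{rank}(\sigma(U_1,V_{10},V_{10}))\le 6\},$$ where $\sigma(U_1,V_{10},V_{10})\in U_1^\vee\otimes\wedge^2(V_{10}/U_1)^\vee$. A point of $\mathbf{P}(V_{10}/V_6)\cong\mathbf{P}^3$ is a subspace $U_7$ with $V_6\subset U_7\subset V_{10}$. Let $\mathcal{V}_7$ be the rank $7$ bundle on $\mathbf{P}(V_{10}/V_6)$ with fiber $U_7$ over $[U_7]$. The projective bundle $\mathbf{P}(\mathcal{V}_7/V_1)\to\mathbf{P}(V_{10}/V_6)$ parametrizes pairs $[U_2\subset U_7]$ with $V_1\subset U_2\subset U_7$. Let $\mathcal{V}_2$ be the rank $2$ bundle on $\mathbf{P}(\mathcal{V}_7/V_1)$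 with fiber $U_2$; $\mathbf{P}(\mathcal{V}_2)$ parametrizes flags $[l\subset U_2\subset U_7]$ with $l$ one-dimensional, and the projection to $\mathbf{P}(V_{10})$ is $[l\subset U_2\subset U_7]\mapsto[l]$. The variety $X_{1.1}^\sigma$ is the closure in $\mathbf{P}(\mathcal{V}_2)$ of the inverse image of $X_1^\sigma\setminus\mathbf{P}(V_6)$ under this projection. *)

theory Defs
  imports "HOL-Analysis.Analysis"
begin

section \<open>Polynomial functions and the Zariski topology\<close>

text \<open>The algebra of complex-valued functions generated by a set of coordinate functions.\<close>

inductive_set polynomials :: "('a \<Rightarrow> complex) set \<Rightarrow> ('a \<Rightarrow> complex) set"
  for C :: "('a \<Rightarrow> complex) set" where
  coordinate: "c \<in> C \<Longrightarrow> c \<in> polynomials C"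
| const: "(\<lambda>_. a) \<in> polynomials C"
| add: "f \<in> polynomials C \<Longrightarrow> g \<in> polynomials C \<Longrightarrow> (\<lambda>x. f x + g x) \<in> polynomials C"
| mult: "f \<in> polynomials C \<Longrightarrow> g \<in> polynomials C \<Longrightarrow> (\<lambda>x. f x * g x) \<in> polynomials C"

definition zariski_topology :: "('a \<Rightarrow> complex) set \<Rightarrow> 'a topology" where
  "zariski_topology C = topology_generated_by {{x. f x \<noteq> 0} | f. f \<in> polynomials C}"

lemma topspace_zariski_topology [simp]: "topspace (zariski_topology C) = UNIV"
proof -
  have "{x. (\<lambda>_. 1 :: complex) x \<noteq> 0} \<subseteq> topspace (zariski_topology C)"
    unfolding zariski_topology_def topology_generated_by_topspace
    by (rule Union_upper, rule CollectI, intro exI[of _ "\<lambda>_. 1"]) (simp add: polynomials.const)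
  then show ?thesis by auto
qed

definition dense_open_in :: "'a topology \<Rightarrow> 'a set \<Rightarrow> bool" where
  "dense_open_in T U \<longleftrightarrow> openin T U \<and> T closure_of U = topspace T"

definition holds_for_general_in :: "'a topology \<Rightarrow> 'a set \<Rightarrow> ('a \<Rightarrow> bool) \<Rightarrow> bool" where
  "holds_for_general_in T D P \<longleftrightarrow>
     (\<exists>U. dense_open_in (subtopology T D) U \<and> (\<forall>x\<in>U. P x))"


section \<open>Subvarieties of multiprojective spaces and their morphisms\<close>

text \<open>
  A projective variety is given by its points, the set of (multi)homogeneous coordinate vectors
  representing each point, and, for each (multi)degree, the (multi)homogeneous polynomials of that
  degree.  Whether such a polynomial vanishes at a point, and the quotient of two of them of the
  same degree, do not depend on the choice of coordinate vector.
\<close>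

record ('p, 'c, 'd) projective =
  points :: "'p set"
  coords :: "'p \<Rightarrow> 'c set"
  forms :: "'d \<Rightarrow> ('c \<Rightarrow> complex) set"

definition nonvanishing :: "('p, 'c, 'd) projective \<Rightarrow> ('c \<Rightarrow> complex) \<Rightarrow> 'p set" where
  "nonvanishing M F = {p \<in> points M. \<forall>c\<in>coords M p. F c \<noteq> 0}"

definition proj_topology :: "('p, 'c, 'd) projective \<Rightarrow> 'p topology" where
  "proj_topology M = topology_generated_by {nonvanishing M F | F d. F \<in> forms M d}"

lemma topspace_proj_topology:
  assumes "(\<lambda>_. 1) \<in> forms M d"
  shows "topspace (proj_topology M) = points M"
proof
  show "topspace (proj_topology M) \<subseteq> points M"
    unfolding proj_topology_def topology_generated_by_topspace nonvanishing_def by blast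
  have "nonvanishing M (\<lambda>_. 1) \<subseteq> topspace (proj_topology M)"
    unfolding proj_topology_def topology_generated_by_topspace
    by (rule Union_upper) (use assms in blast)
  then show "points M \<subseteq> topspace (proj_topology M)"
    by (simp add: nonvanishing_def)
qed

definition var_topology :: "('p, 'c, 'd) projective \<Rightarrow> 'p set \<Rightarrow> 'p topology" where
  "var_topology M Y = subtopology (proj_topology M) Y"

text \<open>Regular functions on a locally closed subset: locally quotients of forms of equal degree.
  Values outside the subset are irrelevant.\<close>

definition regular_on :: "('p, 'c, 'd) projective \<Rightarrow> 'p set \<Rightarrow> ('p \<Rightarrow> complex) \<Rightarrow> bool" where
  "regular_on M Y \<phi> \<longleftrightarrow>
     (\<forall>p\<in>Y. \<exists>U d F G. openin (var_topology M Y) U \<and> p \<in> U \<and>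
        F \<in> forms M d \<and> G \<in> forms M d \<and>
        (\<forall>q\<in>U. \<forall>c\<in>coords M q. G c \<noteq> 0 \<and> \<phi> q = F c / G c))"

definition morphism ::
  "('p, 'c, 'd) projective \<Rightarrow> 'p set \<Rightarrow> ('q, 'e, 'f) projective \<Rightarrow> 'q set \<Rightarrow> ('p \<Rightarrow> 'q) \<Rightarrow> bool" where
  "morphism M Y N Z f \<longleftrightarrow>
     f ` Y \<subseteq> Z \<and>
     continuous_map (var_topology M Y) (var_topology N Z) f \<and>
     (\<forall>W \<phi>. openin (var_topology N Z) W \<and> regular_on N W \<phi> \<longrightarrow>
        regular_on M {p \<in> Y. f p \<in> W} (\<phi> \<circ> f))"

definition isomorphism ::
  "('p, 'c, 'd) projective \<Rightarrow> 'p set \<Rightarrow> ('q, 'e, 'f) projective \<Rightarrow> 'q set \<Rightarrow> ('p \<Rightarrow> 'q) \<Rightarrow> bool" where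
  "isomorphism M Y N Z f \<longleftrightarrow>
     morphism M Y N Z f \<and>
     (\<exists>g. morphism N Z M Y g \<and> (\<forall>p\<in>Y. g (f p) = p) \<and> (\<forall>q\<in>Z. f (g q) = q))"

definition birational_morphism ::
  "('p, 'c, 'd) projective \<Rightarrow> 'p set \<Rightarrow> ('q, 'e, 'f) projective \<Rightarrow> 'q set \<Rightarrow> ('p \<Rightarrow> 'q) \<Rightarrow> bool" where
  "birational_morphism M Y N Z f \<longleftrightarrow>
     morphism M Y N Z f \<and>
     (\<exists>U W. dense_open_in (var_topology M Y) U \<and> dense_open_in (var_topology N Z) W \<and>
        isomorphism M U N W f)"


section \<open>Trivectors and the divisor of degenerate ones\<close>

type_synonym V10 = "complex^10"
type_synonym form3 = "V10 \<Rightarrow> V10 \<Rightarrow> V10 \<Rightarrow> complex"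

definition subspace_of_dim :: "nat \<Rightarrow> V10 set \<Rightarrow> bool" where
  "subspace_of_dim k U \<longleftrightarrow> vec.subspace U \<and> vec.dim U = k"

text \<open>The third exterior power of the dual of \<open>V10\<close>, as alternating trilinear forms.\<close>

definition alternating3 :: "form3 set" where
  "alternating3 = {\<sigma>.
     (\<forall>v w. Vector_Spaces.linear (*s) (*) (\<lambda>u. \<sigma> u v w)) \<and>
     (\<forall>u w. Vector_Spaces.linear (*s) (*) (\<lambda>v. \<sigma> u v w)) \<and>
     (\<forall>u v. Vector_Spaces.linear (*s) (*) (\<lambda>w. \<sigma> u v w)) \<and>
     (\<forall>u v. \<sigma> u u v = 0 \<and> \<sigma> u v v = 0 \<and> \<sigma> u v u = 0)}"

text \<open>The evaluations at triples of vectors restrict to linear functions on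
  \<open>alternating3\<close> that span its dual.\<close>

definition form3_zariski :: "form3 topology" where
  "form3_zariski = zariski_topology {(\<lambda>\<sigma>. \<sigma> u v w) | u v w. True}"

definition adapted_flag :: "form3 \<Rightarrow> V10 set \<Rightarrow> V10 set \<Rightarrow> bool" where
  "adapted_flag \<sigma> V\<^sub>1 V\<^sub>6 \<longleftrightarrow>
     subspace_of_dim 1 V\<^sub>1 \<and> subspace_of_dim 6 V\<^sub>6 \<and> V\<^sub>1 \<subseteq> V\<^sub>6 \<and>
     (\<forall>u\<in>V\<^sub>1. \<forall>v\<in>V\<^sub>6. \<forall>w. \<sigma> u v w = 0)"

definition D_1_6_10 :: "form3 set" where
  "D_1_6_10 = {\<sigma> \<in> alternating3. \<exists>V\<^sub>1 V\<^sub>6. adapted_flag \<sigma> V\<^sub>1 V\<^sub>6}"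


section \<open>The Peskine variety\<close>

definition PV10 :: "(V10 set, V10, nat) projective" where
  "PV10 = \<lparr>
     points = {l. subspace_of_dim 1 l},
     coords = (\<lambda>l. l - {0}),
     forms = (\<lambda>d. {F \<in> polynomials {(\<lambda>x. x $ i) | i. True}.
                      \<forall>t x. F (t *s x) = t ^ d * F x})\<rparr>"

text \<open>The Gram matrix is that of the form on \<open>V10\<close>.  If \<open>\<omega> = \<sigma> u\<close>, then \<open>u\<close> lies in the radical,
  so the rank is also that of the form induced on the quotient by the line of \<open>u\<close>.\<close>

definition rank_2form :: "(V10 \<Rightarrow> V10 \<Rightarrow> complex) \<Rightarrow> nat" where
  "rank_2form \<omega> = rank (\<chi> i j. \<omega> (axis i 1) (axis j 1) :: complex^10^10)"

definition peskine :: "form3 \<Rightarrow> V10 set set" where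
  "peskine \<sigma> = {U\<^sub>1 \<in> points PV10. \<forall>u\<in>U\<^sub>1. rank_2form (\<sigma> u) \<le> 6}"

definition lines_in :: "V10 set \<Rightarrow> V10 set set" where
  "lines_in V = {l \<in> points PV10. l \<subseteq> V}"


section \<open>The tower of projective bundles\<close>

text \<open>The projective space of lines in the quotient of \<open>V10\<close> by \<open>V\<^sub>6\<close>.\<close>

definition P_V10_V6 :: "V10 set \<Rightarrow> V10 set set" where
  "P_V10_V6 V\<^sub>6 = {U\<^sub>7. subspace_of_dim 7 U\<^sub>7 \<and> V\<^sub>6 \<subseteq> U\<^sub>7}"

definition P_V7_V1 :: "V10 set \<Rightarrow> V10 set \<Rightarrow> (V10 set \<times> V10 set) set" where
  "P_V7_V1 V\<^sub>1 V\<^sub>6 = {(U\<^sub>2, U\<^sub>7). U\<^sub>7 \<in> P_V10_V6 V\<^sub>6 \<and> subspace_of_dim 2 U\<^sub>2 \<and> V\<^sub>1 \<subseteq> U\<^sub>2 \<and> U\<^sub>2 \<subseteq> U\<^sub>7}"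

text \<open>
  The bundle of lines \<open>l\<close> in \<open>U\<^sub>2\<close>.  As \<open>U\<^sub>2\<close> is a line in \<open>V10 / V\<^sub>1\<close> and \<open>U\<^sub>7\<close> a line in
  \<open>V10 / V\<^sub>6\<close>, it is a closed subvariety of \<open>P(V10) \<times> P(V10 / V\<^sub>1) \<times> P(V10 / V\<^sub>6)\<close>: each stage
  of the tower is the projectivization of a subbundle of a trivial bundle.
  The homogeneous coordinates of \<open>(l, U\<^sub>2, U\<^sub>7)\<close> are a generator of \<open>l\<close>
  and lifts to \<open>V10\<close> of generators of \<open>U\<^sub>2 / V\<^sub>1\<close> and \<open>U\<^sub>7 / V\<^sub>6\<close>; a polynomial on
  \<open>V10 / V\<^sub>i\<close> is a polynomial on \<open>V10\<close> invariant under translation by \<open>V\<^sub>i\<close>.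
\<close>

definition PV2 :: "V10 set \<Rightarrow> V10 set \<Rightarrow>
    (V10 set \<times> V10 set \<times> V10 set, V10 \<times> V10 \<times> V10, nat \<times> nat \<times> nat) projective" where
  "PV2 V\<^sub>1 V\<^sub>6 = \<lparr>
     points = {(l, U\<^sub>2, U\<^sub>7). (U\<^sub>2, U\<^sub>7) \<in> P_V7_V1 V\<^sub>1 V\<^sub>6 \<and> subspace_of_dim 1 l \<and> l \<subseteq> U\<^sub>2},
     coords = (\<lambda>(l, U\<^sub>2, U\<^sub>7). (l - {0}) \<times> (U\<^sub>2 - V\<^sub>1) \<times> (U\<^sub>7 - V\<^sub>6)),
     forms = (\<lambda>(d\<^sub>1, d\<^sub>2, d\<^sub>3).
       {F \<in> polynomials ({(\<lambda>(x, y, z). x $ i) | i. True} \<union> {(\<lambda>(x, y, z). y $ i) | i. True}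
                          \<union> {(\<lambda>(x, y, z). z $ i) | i. True}).
          \<forall>r s t x y z. \<forall>v\<in>V\<^sub>1. \<forall>w\<in>V\<^sub>6.
            F (r *s x, s *s y + v, t *s z + w) = r ^ d\<^sub>1 * s ^ d\<^sub>2 * t ^ d\<^sub>3 * F (x, y, z)})\<rparr>"

lemma topspace_PV10 [simp]: "topspace (proj_topology PV10) = points PV10"
  by (rule topspace_proj_topology[where d = 0])
     (simp add: PV10_def polynomials.const)

lemma topspace_PV2 [simp]: "topspace (proj_topology (PV2 V\<^sub>1 V\<^sub>6)) = points (PV2 V\<^sub>1 V\<^sub>6)"
  by (rule topspace_proj_topology[where d = "(0, 0, 0)"])
     (simp add: PV2_def polynomials.const)

definition pr_line :: "V10 set \<times> V10 set \<times> V10 set \<Rightarrow> V10 set" where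
  "pr_line = (\<lambda>(l, U\<^sub>2, U\<^sub>7). l)"

definition X_1_1 :: "form3 \<Rightarrow> V10 set \<Rightarrow> V10 set \<Rightarrow> (V10 set \<times> V10 set \<times> V10 set) set" where
  "X_1_1 \<sigma> V\<^sub>1 V\<^sub>6 = proj_topology (PV2 V\<^sub>1 V\<^sub>6) closure_of
     {p \<in> points (PV2 V\<^sub>1 V\<^sub>6). pr_line p \<in> peskine \<sigma> - lines_in V\<^sub>6}"

end

theory Submission
  imports Defs "HOL-Computational_Algebra.Fundamental_Theorem_Algebra"
begin

text \<open>
  Off \<open>P(V\<^sub>6)\<close> the projection has the inverse \<open>l \<mapsto> (l, l + V\<^sub>1, l + V\<^sub>6)\<close>, so birationality amounts to the
  density of \<open>X\<^sub>1 - P(V\<^sub>6)\<close> in \<open>X\<^sub>1\<close>.  This holds for every \<open>\<sigma>\<close>: the locus where a \<open>9 \<times> 9\<close> skew matrix has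
  rank at most \<open>6\<close> has codimension at most \<open>3\<close>, while \<open>V\<^sub>6\<close> has codimension \<open>4\<close>, so a point of the locus
  is never isolated in a four-dimensional slice \<open>A u\<close> transverse to \<open>V\<^sub>6\<close>.

  Suppose the origin were isolated.  By the Nullstellensatz, powers of the coordinates lie, locally, in
  the ideal of the minors of \<open>A\<close>; by a contraction argument this bounds the number of zeros near the
  origin of the minors of \<open>A + t C\<close> for every small \<open>t\<close>.  But \<open>C\<close> can be chosen such that for \<open>t \<noteq> 0\<close>
  the origin has rank exactly \<open>6\<close> and the three entries of the Schur complement cut out a smooth
  curve through it.
\<close>

text \<open>The codimension bound is normally a fact of dimension theory; here it is reduced to a
  statement about single points, which a count of zeros can refute. Size nine occurs because
  \<open>u\<close> lies in the radical of \<open>\<sigma> u\<close>, so that the form lives on a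
  complement of \<open>u\<close>; three is the number of entries above the diagonal of a skew 3 x 3
  Schur complement. The obstacle is that this Schur complement is useless at the given point: the
  rank there may be below 6, so that no 6 x 6 block is invertible, and even at rank 6 the three
  equations may have dependent differentials. The perturbation cures both defects at once, but a
  perturbed zero can be tied to the original point only by counting in a fixed neighbourhood. The
  count must therefore be uniform in the parameter, which is why it is obtained from norm estimates.
  Neighbourhoods are Zariski neighbourhoods, given by a polynomial \<open>F\<close> that does not
  vanish at the point. \<open>F\<close> is carried along down to the Nullstellensatz, where the
  products of \<open>F\<close> with the coordinates take the place of the coordinates.\<close>

lemma underdetermined_system:
  fixes a :: "'i \<Rightarrow> 'b \<Rightarrow> 'c::field"
  assumes "finite B" "finite J" "card B < card J"
  shows "\<exists>l. (\<exists>j\<in>J. l j \<noteq> 0) \<and> (\<forall>b\<in>B. (\<Sum>j\<in>J. l j * a j b) = 0)"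
  using assms
proof (induction B arbitrary: J a rule: finite_induct)
  case empty
  then obtain j where "j \<in> J" by fastforce
  then show ?case by (intro exI[of _ "\<lambda>_. 1"]) auto
next
  case (insert b B)
  show ?case
  proof (cases "\<forall>j\<in>J. a j b = 0")
    case True
    have "card B < card J" using insert by simp
    then obtain l where "\<exists>j\<in>J. l j \<noteq> 0" "\<forall>b\<in>B. (\<Sum>j\<in>J. l j * a j b) = 0"
      using insert.IH[of J a] insert.prems by blast
    then show ?thesis using True by (intro exI[of _ l]) auto
  next
    case False
    then obtain k where k: "k \<in> J" "a k b \<noteq> 0" by auto
    \<comment> \<open>Gaussian elimination: the equation \<open>b\<close> eliminates the unknown
      \<open>k\<close>, whose value is restored in \<open>l'\<close>.\<close>
    define a' where "a' j c = a j c - a j b / a k b * a k c" for j c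
    have "card B < card (J - {k})" using insert k by simp
    then obtain l where l: "\<exists>j\<in>J - {k}. l j \<noteq> 0" "\<forall>b\<in>B. (\<Sum>j\<in>J - {k}. l j * a' j b) = 0"
      using insert.IH[of "J - {k}" a'] insert.prems by blast
    define l' where "l' j = (if j = k then - (\<Sum>j\<in>J - {k}. l j * a j b) / a k b else l j)" for j
    have sum: "(\<Sum>j\<in>J. l' j * a j c) = (\<Sum>j\<in>J - {k}. l j * a' j c)" for c
    proof -
      have "(\<Sum>j\<in>J. l' j * a j c) = l' k * a k c + (\<Sum>j\<in>J - {k}. l' j * a j c)"
        using k insert.prems by (simp add: sum.remove)
      also have "(\<Sum>j\<in>J - {k}. l' j * a j c) = (\<Sum>j\<in>J - {k}. l j * a j c)"
        by (rule sum.cong) (auto simp: l'_def)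
      also have "l' k * a k c = - (\<Sum>j\<in>J - {k}. l j * (a j b / a k b * a k c))"
        by (auto simp: l'_def sum_distrib_right sum_distrib_left sum_divide_distrib mult_ac intro!: sum.cong)
      finally show ?thesis
        by (simp add: a'_def right_diff_distrib sum_subtractf)
    qed
    have "(\<Sum>j\<in>J. l' j * a j b) = 0"
      using k by (simp add: sum a'_def)
    with l have "\<forall>c\<in>insert b B. (\<Sum>j\<in>J. l' j * a j c) = 0"
      by (simp add: sum)
    moreover have "\<exists>j\<in>J. l' j \<noteq> 0" using l by (auto simp: l'_def)
    ultimately show ?thesis by blast
  qed
qed

section \<open>Polynomial functions\<close>

lemma polynomials_cong: "f \<in> polynomials C \<Longrightarrow> (\<And>x. g x = f x) \<Longrightarrow> g \<in> polynomials C"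
  by (metis ext)

lemma polynomials_uminus: "f \<in> polynomials C \<Longrightarrow> (\<lambda>x. - f x) \<in> polynomials C"
  using polynomials.mult[OF polynomials.const[of "-1"]] by (rule polynomials_cong) auto

lemma polynomials_diff:
  "f \<in> polynomials C \<Longrightarrow> g \<in> polynomials C \<Longrightarrow> (\<lambda>x. f x - g x) \<in> polynomials C"
  using polynomials.add[OF _ polynomials_uminus] by (rule polynomials_cong) auto

lemma polynomials_sum:
  "(\<And>i. i \<in> I \<Longrightarrow> f i \<in> polynomials C) \<Longrightarrow> (\<lambda>x. \<Sum>i\<in>I. f i x) \<in> polynomials C"
  by (induction I rule: infinite_finite_induct) (auto intro: polynomials.intros)

lemma polynomials_prod:
  "(\<And>i. i \<in> I \<Longrightarrow> f i \<in> polynomials C) \<Longrightarrow> (\<lambda>x. \<Prod>i\<in>I. f i x) \<in> polynomials C"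
  by (induction I rule: infinite_finite_induct) (auto intro: polynomials.intros)

lemma polynomials_power: "f \<in> polynomials C \<Longrightarrow> (\<lambda>x. f x ^ n) \<in> polynomials C"
  by (induction n) (auto intro: polynomials.intros)

lemma polynomials_poly: "f \<in> polynomials C \<Longrightarrow> (\<lambda>x. poly p (f x)) \<in> polynomials C"
  by (induction p) (auto intro: polynomials.intros)

lemma polynomials_compose:
  assumes "f \<in> polynomials C" "\<And>c. c \<in> C \<Longrightarrow> (\<lambda>x. c (h x)) \<in> polynomials D"
  shows "(\<lambda>x. f (h x)) \<in> polynomials D"
  using assms(1) by induction (auto intro: polynomials.intros assms(2))

lemma polynomials_det:
  assumes "\<And>i j. (\<lambda>x. A x $ i $ j) \<in> polynomials C"
  shows "(\<lambda>x. det (A x)) \<in> polynomials C"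
  unfolding det_def
  by (intro polynomials_sum polynomials.mult polynomials.const polynomials_prod assms)

lemmas polynomials_intros = polynomials.const polynomials.add polynomials.mult polynomials_uminus
  polynomials_diff polynomials_sum polynomials_prod polynomials_power polynomials_poly polynomials_det

section \<open>Polynomial functions as sums of monomials\<close>

definition vec_coords :: "(complex^'m \<Rightarrow> complex) set" where
  "vec_coords = {\<lambda>x. x $ i | i. True}"

lemma vec_coord_polynomials: "(\<lambda>x. x $ i) \<in> polynomials vec_coords"
  by (rule polynomials.coordinate) (auto simp: vec_coords_def)

definition monomial :: "('m::finite \<Rightarrow> nat) \<Rightarrow> complex^'m \<Rightarrow> complex" where
  "monomial a x = (\<Prod>i\<in>UNIV. x $ i ^ a i)"

lemma monomial_add: "monomial (\<lambda>i. a i + b i) x = monomial a x * monomial b x"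
  by (simp add: monomial_def power_add prod.distrib)

lemma monomial_0: "monomial (\<lambda>_. 0) x = 1"
  by (simp add: monomial_def)

lemma monomial_unit: "monomial (\<lambda>j. if j = i then n else 0) x = x $ i ^ n"
proof -
  have "x $ j ^ (if j = i then n else 0) = (if j = i then x $ i ^ n else 1)" for j by simp
  then show ?thesis unfolding monomial_def by (simp add: prod.delta)
qed

definition mono_sum :: "('m::finite \<Rightarrow> nat) set \<Rightarrow> (('m \<Rightarrow> nat) \<Rightarrow> complex) \<Rightarrow> complex^'m \<Rightarrow> complex" where
  "mono_sum S c x = (\<Sum>a\<in>S. c a * monomial a x)"

lemma mono_sum_add:
  assumes "finite S" "finite T"
  shows "mono_sum S c x + mono_sum T d x =
    mono_sum (S \<union> T) (\<lambda>a. (if a \<in> S then c a else 0) + (if a \<in> T then d a else 0)) x"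
proof -
  have "mono_sum S c x = (\<Sum>a\<in>S \<union> T. (if a \<in> S then c a else 0) * monomial a x)"
    unfolding mono_sum_def using assms by (intro sum.mono_neutral_cong_left) auto
  moreover have "mono_sum T d x = (\<Sum>a\<in>S \<union> T. (if a \<in> T then d a else 0) * monomial a x)"
    unfolding mono_sum_def using assms by (intro sum.mono_neutral_cong_left) auto
  ultimately show ?thesis
    by (simp add: mono_sum_def distrib_right sum.distrib)
qed

text \<open>Induction on the terms of the second factor: a single term translates all exponents
  injectively, so no terms need to be collected within a step.\<close>

lemma mono_sum_mult:
  assumes "finite S" "finite T"
  shows "\<exists>U e. finite U \<and> (\<forall>x. mono_sum S c x * mono_sum T d x = mono_sum U e x)"
  using assms(2)
proof (induction T rule: finite_induct)
  case empty
  show ?case by (intro exI[of _ "{}"]) (simp add: mono_sum_def)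
next
  case (insert b T)
  then obtain U e where U: "finite U" "\<And>x. mono_sum S c x * mono_sum T d x = mono_sum U e x"
    by blast
  define h where "h a = (\<lambda>i. a i + b i)" for a :: "'a \<Rightarrow> nat"
  have inj: "inj h"
    by (rule injI) (auto simp: h_def fun_eq_iff)
  have "mono_sum S c x * (d b * monomial b x) =
      mono_sum (h ` S) (\<lambda>a. c (inv h a) * d b) x" for x
  proof -
    have mono: "monomial (h a) x = monomial a x * monomial b x" for a
      by (simp add: h_def monomial_add)
    have eq: "mono_sum (h ` S) (\<lambda>a. c (inv h a) * d b) x = (\<Sum>a\<in>S. c a * d b * (monomial a x * monomial b x))"
      unfolding mono_sum_def by (subst sum.reindex[OF inj_on_subset[OF inj subset_UNIV]]) (simp add: inv_f_f[OF inj] mono)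
    show ?thesis
      unfolding eq by (simp add: mono_sum_def sum_distrib_left sum_distrib_right mult_ac)
  qed
  then have "mono_sum S c x * mono_sum (insert b T) d x =
      mono_sum (h ` S) (\<lambda>a. c (inv h a) * d b) x + mono_sum U e x" for x
    using insert by (simp add: mono_sum_def[of "insert b T"] distrib_left U
        flip: mono_sum_def[of T])
  then show ?case
    using U assms by (auto simp: mono_sum_add intro!: exI[of _ "h ` S \<union> U"])
qed

text \<open>Used twice: it gives the countable spanning family behind the Nullstellensatz, and it
  extends the vanishing of a functional from monomials to all polynomials.\<close>

lemma polynomials_mono_sum:
  assumes "f \<in> polynomials vec_coords"
  obtains S c where "finite S" "f = mono_sum S c"
proof -
  have "\<exists>S c. finite S \<and> f = mono_sum S c"
    using assms
  proof induction
    case (coordinate f)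
    then obtain i where f: "f = (\<lambda>x. x $ i)" by (auto simp: vec_coords_def)
    show ?case
      by (rule exI[of _ "{\<lambda>j. if j = i then 1 else 0}"], rule exI[of _ "\<lambda>_. 1"])
        (simp add: fun_eq_iff f mono_sum_def monomial_unit)
  next
    case (const a)
    show ?case
      by (rule exI[of _ "{\<lambda>_. 0}"], rule exI[of _ "\<lambda>_. a"])
        (simp add: fun_eq_iff mono_sum_def monomial_0)
  next
    case (add f g)
    then show ?case by (metis (no_types, lifting) ext finite_UnI mono_sum_add)
  next
    case (mult f g)
    then show ?case by (metis (no_types, lifting) ext mono_sum_mult)
  qed
  then show ?thesis using that by blast
qed

section \<open>The Nullstellensatz\<close>

text \<open>Ideals consist of functions rather than formal polynomials. The inductive form allows
  estimates to be proved by induction on membership, as in \<open>ideal_deform\<close>.\<close>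

inductive_set ideal_gen :: "('a \<Rightarrow> complex) set \<Rightarrow> ('a \<Rightarrow> complex) set \<Rightarrow> ('a \<Rightarrow> complex) set"
  for C G where
  zero: "(\<lambda>_. 0) \<in> ideal_gen C G"
| base: "g \<in> G \<Longrightarrow> g \<in> ideal_gen C G"
| add: "f \<in> ideal_gen C G \<Longrightarrow> g \<in> ideal_gen C G \<Longrightarrow> (\<lambda>x. f x + g x) \<in> ideal_gen C G"
| mult: "f \<in> polynomials C \<Longrightarrow> g \<in> ideal_gen C G \<Longrightarrow> (\<lambda>x. f x * g x) \<in> ideal_gen C G"

definition poly_ideal :: "('a \<Rightarrow> complex) set \<Rightarrow> ('a \<Rightarrow> complex) set \<Rightarrow> bool" where
  "poly_ideal C I \<longleftrightarrow> I \<subseteq> polynomials C \<and> (\<lambda>_. 0) \<in> I \<and>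
     (\<forall>f\<in>I. \<forall>g\<in>I. (\<lambda>x. f x + g x) \<in> I) \<and>
     (\<forall>f\<in>polynomials C. \<forall>g\<in>I. (\<lambda>x. f x * g x) \<in> I)"

lemma poly_ideal_gen: "G \<subseteq> polynomials C \<Longrightarrow> poly_ideal C (ideal_gen C G)"
  unfolding poly_ideal_def
proof (intro conjI ballI subsetI)
  fix f assume "G \<subseteq> polynomials C" "f \<in> ideal_gen C G"
  then show "f \<in> polynomials C"
    by (induction rule: ideal_gen.induct[OF \<open>f \<in> ideal_gen C G\<close>]) (auto intro: polynomials.intros)
qed (auto intro: ideal_gen.intros)

lemma poly_idealD:
  assumes "poly_ideal C I"
  shows poly_ideal_sub: "f \<in> I \<Longrightarrow> f \<in> polynomials C"
    and poly_ideal_0: "(\<lambda>_. 0) \<in> I"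
    and poly_ideal_add: "f \<in> I \<Longrightarrow> g \<in> I \<Longrightarrow> (\<lambda>x. f x + g x) \<in> I"
    and poly_ideal_mult: "h \<in> polynomials C \<Longrightarrow> g \<in> I \<Longrightarrow> (\<lambda>x. h x * g x) \<in> I"
  using assms by (auto simp: poly_ideal_def)

lemma poly_ideal_sum:
  assumes "poly_ideal C I" "\<And>j. j \<in> J \<Longrightarrow> f j \<in> I"
  shows "(\<lambda>x. \<Sum>j\<in>J. f j x) \<in> I"
  using assms(2)
  by (induction J rule: infinite_finite_induct)
    (auto intro: poly_ideal_0[OF assms(1)] poly_ideal_add[OF assms(1)])

lemma poly_ideal_chain_Union:
  assumes "Ch \<noteq> {}" "\<And>I. I \<in> Ch \<Longrightarrow> poly_ideal C I"
    "\<And>I J. I \<in> Ch \<Longrightarrow> J \<in> Ch \<Longrightarrow> I \<subseteq> J \<or> J \<subseteq> I"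
  shows "poly_ideal C (\<Union>Ch)"
  unfolding poly_ideal_def
proof (intro conjI ballI)
  show "\<Union>Ch \<subseteq> polynomials C" using poly_ideal_sub[OF assms(2)] by blast
  show "(\<lambda>_. 0) \<in> \<Union>Ch" using assms(1) poly_ideal_0[OF assms(2)] by blast
next
  fix f g assume "f \<in> \<Union>Ch" "g \<in> \<Union>Ch"
  then obtain I J where "I \<in> Ch" "f \<in> I" "J \<in> Ch" "g \<in> J" by blast
  then show "(\<lambda>x. f x + g x) \<in> \<Union>Ch"
    using assms(3)[of I J] poly_ideal_add[OF assms(2)[of I], of f g] poly_ideal_add[OF assms(2)[of J], of f g]
    by blast
next
  fix f g assume "f \<in> polynomials C" "g \<in> \<Union>Ch"
  then show "(\<lambda>x. f x * g x) \<in> \<Union>Ch"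
    using poly_ideal_mult[OF assms(2)] by blast
qed

text \<open>Such an \<open>M\<close> corresponds to a maximal ideal of the ring localized at
  \<open>f\<close>. Working with it directly replaces the additional variable of the Rabinowitsch
  trick.\<close>

locale maximal_avoiding_ideal =
  fixes C :: "('a \<Rightarrow> complex) set" and f :: "'a \<Rightarrow> complex" and M :: "('a \<Rightarrow> complex) set"
  assumes f: "f \<in> polynomials C"
    and ideal: "poly_ideal C M"
    and avoid: "\<And>n. (\<lambda>x. f x ^ n) \<notin> M"
    and maximal: "\<And>I. poly_ideal C I \<Longrightarrow> M \<subseteq> I \<Longrightarrow> (\<And>n. (\<lambda>x. f x ^ n) \<notin> I) \<Longrightarrow> I = M"
begin

lemma cong: "h \<in> M \<Longrightarrow> (\<And>x. g x = h x) \<Longrightarrow> g \<in> M"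
  by (metis ext)

text \<open>Maximality is applied to the ideal generated by \<open>M\<close> and \<open>p\<close>,
  which is \<open>I\<close> in the proof. The result says that \<open>p\<close> becomes a unit
  modulo \<open>M\<close> once \<open>f\<close> is inverted.\<close>

lemma power_in_extension:
  assumes p: "p \<in> polynomials C" "p \<notin> M"
  shows "\<exists>n. \<exists>g\<in>polynomials C. (\<lambda>x. f x ^ n - g x * p x) \<in> M"
proof (rule ccontr)
  assume neg: "\<not> ?thesis"
  define I where "I = {h \<in> polynomials C. \<exists>g\<in>polynomials C. (\<lambda>x. h x - g x * p x) \<in> M}"
  have "poly_ideal C I"
    unfolding poly_ideal_def
  proof (intro conjI ballI)
    show "I \<subseteq> polynomials C" by (auto simp: I_def)
    show "(\<lambda>_. 0) \<in> I"
      unfolding I_def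
      using poly_ideal_0[OF ideal] by (auto intro!: polynomials.const bexI[of _ "\<lambda>_. 0"])
  next
    fix h h' assume "h \<in> I" "h' \<in> I"
    then obtain g g' where g: "h \<in> polynomials C" "h' \<in> polynomials C" "g \<in> polynomials C" "g' \<in> polynomials C"
      "(\<lambda>x. h x - g x * p x) \<in> M" "(\<lambda>x. h' x - g' x * p x) \<in> M"
      by (auto simp: I_def)
    have "(\<lambda>x. (h x + h' x) - (g x + g' x) * p x) \<in> M"
      by (rule cong[OF poly_ideal_add[OF ideal g(5,6)]]) (simp add: algebra_simps)
    then show "(\<lambda>x. h x + h' x) \<in> I"
      unfolding I_def using g by (auto intro!: polynomials.add bexI[of _ "\<lambda>x. g x + g' x"])
  next
    fix q h assume "q \<in> polynomials C" "h \<in> I"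
    then obtain g where g: "h \<in> polynomials C" "g \<in> polynomials C" "(\<lambda>x. h x - g x * p x) \<in> M"
      by (auto simp: I_def)
    have "(\<lambda>x. q x * h x - (q x * g x) * p x) \<in> M"
      by (rule cong[OF poly_ideal_mult[OF ideal \<open>q \<in> _\<close> g(3)]]) (simp add: algebra_simps)
    then show "(\<lambda>x. q x * h x) \<in> I"
      unfolding I_def using g \<open>q \<in> _\<close> by (auto intro!: polynomials.mult bexI[of _ "\<lambda>x. q x * g x"])
  qed
  moreover have "M \<subseteq> I"
    unfolding I_def using poly_ideal_sub[OF ideal]
    by (auto intro!: bexI[of _ "\<lambda>_. 0"] polynomials.const)
  moreover have "(\<lambda>x. f x ^ n) \<notin> I" for n
    using neg by (auto simp: I_def)
  ultimately have "I = M" by (rule maximal)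
  moreover have "p \<in> I"
    unfolding I_def using p poly_ideal_0[OF ideal] by (auto intro!: bexI[of _ "\<lambda>_. 1"] polynomials.const)
  ultimately show False using p by simp
qed

lemma prime:
  assumes "p \<in> polynomials C" "q \<in> polynomials C" "(\<lambda>x. p x * q x) \<in> M"
  shows "p \<in> M \<or> q \<in> M"
proof (rule ccontr)
  assume "\<not> ?thesis"
  then obtain n g m h where n: "g \<in> polynomials C" "(\<lambda>x. f x ^ n - g x * p x) \<in> M"
    and m: "h \<in> polynomials C" "(\<lambda>x. f x ^ m - h x * q x) \<in> M"
    using power_in_extension assms by meson
  \<comment> \<open>The mixed terms cancel and leave the power \<open>m + n\<close> of
    \<open>f\<close>.\<close>
  have "(\<lambda>x. (f x ^ m * (f x ^ n - g x * p x) + (g x * p x) * (f x ^ m - h x * q x))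
      + (g x * h x) * (p x * q x)) \<in> M"
    by (intro poly_ideal_add[OF ideal] poly_ideal_mult[OF ideal] polynomials_intros n m assms f)
  then have "(\<lambda>x. f x ^ (m + n)) \<in> M"
    by (rule cong) (simp add: algebra_simps power_add)
  then show False using avoid by blast
qed

lemma const_notin:
  assumes "c \<noteq> 0"
  shows "(\<lambda>_. c) \<notin> M"
proof
  assume "(\<lambda>_. c) \<in> M"
  then have "(\<lambda>x. 1 / c * c) \<in> M"
    by (intro poly_ideal_mult[OF ideal] polynomials.const)
  then have "(\<lambda>x. f x ^ 0) \<in> M"
    by (rule cong) (simp add: assms)
  then show False using avoid by blast
qed

text \<open>Over the complex numbers \<open>p\<close> splits into linear factors, and since
  \<open>M\<close> is prime one of them, evaluated at \<open>z\<close>, lies in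
  \<open>M\<close>.\<close>

lemma root_of_poly:
  assumes z: "z \<in> polynomials C" and "p \<noteq> 0" "(\<lambda>x. poly p (z x)) \<in> M"
  shows "\<exists>c. (\<lambda>x. z x - c) \<in> M"
  using assms(2,3)
proof (induction "degree p" arbitrary: p)
  case 0
  then obtain c where "p = [:c:]" using degree_eq_zeroE by metis
  then show ?case using 0 const_notin[of c] by simp
next
  case (Suc n)
  have "\<not> constant (poly p)" using Suc by (simp add: constant_degree)
  then obtain r where "poly p r = 0" using fundamental_theorem_of_algebra by blast
  then obtain q where q: "p = [:-r, 1:] * q" by (metis dvdE poly_eq_0_iff_dvd)
  have "q \<noteq> 0" using q Suc by auto
  then have deg: "degree q = n" 
    using Suc.hyps(2) degree_mult_eq[of "[:-r, 1:]" q] \<open>q \<noteq> 0\<close> unfolding q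
    by (simp del: mult_pCons_left)
  have "(\<lambda>x. z x - r) \<in> M \<or> (\<lambda>x. poly q (z x)) \<in> M"
  proof (rule prime)
    show "(\<lambda>x. (z x - r) * poly q (z x)) \<in> M"
      by (rule cong[OF Suc.prems(2)]) (simp add: q algebra_simps)
  qed (intro polynomials_intros z)+
  then show ?case using Suc deg \<open>q \<noteq> 0\<close> by blast
qed

end

lemma infinite_fibre:
  assumes "countable (range f)" "uncountable (UNIV :: 'a set)"
  shows "\<exists>y. infinite {x::'a. f x = y}"
proof (rule ccontr)
  assume "\<not> ?thesis"
  then have "countable (\<Union>y\<in>range f. {x. f x = y})"
    using assms(1) by (intro countable_UN) (auto intro: countable_finite)
  moreover have "(\<Union>y\<in>range f. {x. f x = y}) = UNIV" by auto
  ultimately show False using assms by simp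
qed

text \<open>The polynomial ring has countable dimension whereas there are uncountably many \<open>c\<close>,
  so the inverses of the \<open>x $ i - c\<close> cannot be linearly independent.\<close>

lemma coordinate_constant_mod:
  fixes f :: "complex^'m \<Rightarrow> complex"
  assumes "maximal_avoiding_ideal vec_coords f M"
  shows "\<exists>c. (\<lambda>x. x $ i - c) \<in> M"
proof (rule ccontr)
  interpret maximal_avoiding_ideal vec_coords f M by fact
  assume neg: "\<not> ?thesis"
  have z: "(\<lambda>x. x $ i) \<in> polynomials vec_coords" by (rule vec_coord_polynomials)
  \<comment> \<open>By \<open>power_in_extension\<close> every \<open>x $ i - c\<close> divides a
    power of \<open>f\<close> modulo \<open>M\<close>; the cofactor, divided by that power, is the
    inverse in question. \<open>S\<close> is the support of the cofactor.\<close>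
  define P where "P c n S a \<longleftrightarrow> finite S \<and> mono_sum S a \<in> polynomials vec_coords \<and>
    (\<lambda>x. f x ^ n - mono_sum S a x * (x $ i - c)) \<in> M" for c n S a
  have "\<exists>n S a. P c n S a" for c
  proof -
    have "(\<lambda>x. x $ i - c) \<in> polynomials vec_coords" by (intro polynomials_intros z)
    then obtain n g where g: "g \<in> polynomials vec_coords" "(\<lambda>x. f x ^ n - g x * (x $ i - c)) \<in> M"
      using power_in_extension neg by blast
    obtain S a where "finite S" "g = mono_sum S a" using polynomials_mono_sum[OF g(1)] .
    then show ?thesis using g unfolding P_def by blast
  qed
  then obtain n S a where "\<And>c. P c (n c) (S c) (a c)" by metis
  then have nSa: "finite (S c)" "mono_sum (S c) (a c) \<in> polynomials vec_coords"
    "(\<lambda>x. f x ^ n c - mono_sum (S c) (a c) x * (x $ i - c)) \<in> M" for c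
    by (simp_all add: P_def)
  \<comment> \<open>Pigeonhole: there are only countably many pairs of an exponent and a finite
    support, so infinitely many \<open>c\<close> share both.\<close>
  have "countable (range (\<lambda>c. (n c, S c)))"
    by (rule countable_subset[of _ "UNIV \<times> {S. finite S}"])
      (auto simp: nSa intro!: countable_SIGMA countable_Collect_finite)
  then obtain n0 S0 where inf: "infinite {c. (n c, S c) = (n0, S0)}"
    using infinite_fibre[OF _ uncountable_UNIV_complex, of "\<lambda>c. (n c, S c)"] by auto
  obtain J where J: "finite J" "card J = Suc (card S0)" "J \<subseteq> {c. (n c, S c) = (n0, S0)}"
    using infinite_arbitrarily_large[OF inf] by metis
  then have "finite S0"
  proof -
    obtain c where "c \<in> J" using J by fastforce
    then have "S c = S0" using J by auto
    then show ?thesis using nSa(1)[of c] by simp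
  qed
  \<comment> \<open>\<open>J\<close> has one element more than the common support \<open>S0\<close>,
    so the cofactors belonging to \<open>J\<close> are linearly dependent.\<close>
  then obtain l where l: "\<exists>j\<in>J. l j \<noteq> 0" "\<forall>b\<in>S0. (\<Sum>j\<in>J. l j * a j b) = 0"
    using underdetermined_system[of S0 J a] J by auto
  have rel: "(\<Sum>c\<in>J. l c * mono_sum S0 (a c) x) = 0" for x
  proof -
    have "(\<Sum>c\<in>J. l c * mono_sum S0 (a c) x) = (\<Sum>b\<in>S0. (\<Sum>c\<in>J. l c * a c b) * monomial b x)"
      unfolding mono_sum_def sum_distrib_left sum_distrib_right
      by (subst sum.swap) (simp add: mult_ac)
    then show ?thesis using l by simp
  qed
  \<comment> \<open>The numerator of the sum of the fractions \<open>l c / (y - c)\<close>. At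
    \<open>c0\<close> only the summand of \<open>c0\<close> survives, so \<open>p\<close> is
    nonzero.\<close>
  define p where "p = (\<Sum>c\<in>J. smult (l c) (\<Prod>d\<in>J - {c}. [:-d, 1:]))"
  have poly_p: "poly p y = (\<Sum>c\<in>J. l c * (\<Prod>d\<in>J - {c}. y - d))" for y
    by (simp add: p_def poly_sum poly_prod)
  obtain c0 where c0: "c0 \<in> J" "l c0 \<noteq> 0" using l by blast
  have "poly p c0 = l c0 * (\<Prod>d\<in>J - {c0}. c0 - d)"
    unfolding poly_p using J c0
    by (subst sum.remove[of _ c0]) (auto intro!: sum.neutral)
  then have "p \<noteq> 0" using J c0 by auto
  \<comment> \<open>In this weighted sum of the congruences the cofactors cancel by
    \<open>rel\<close>, leaving a power of \<open>f\<close> times \<open>p\<close> at the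
    coordinate.\<close>
  have "(\<lambda>x. \<Sum>c\<in>J. (l c * (\<Prod>d\<in>J - {c}. x $ i - d)) * (f x ^ n0 - mono_sum S0 (a c) x * (x $ i - c))) \<in> M"
  proof (intro poly_ideal_sum[OF ideal] poly_ideal_mult[OF ideal] polynomials_intros z)
    fix c assume "c \<in> J"
    then have "n c = n0" "S c = S0" using J by auto
    then show "(\<lambda>x. f x ^ n0 - mono_sum S0 (a c) x * (x $ i - c)) \<in> M"
      using nSa(3)[of c] by simp
  qed
  then have "(\<lambda>x. f x ^ n0 * poly p (x $ i)) \<in> M"
  proof (rule cong)
    fix x
    have "(\<Sum>c\<in>J. l c * (\<Prod>d\<in>J - {c}. x $ i - d) * (mono_sum S0 (a c) x * (x $ i - c)))
        = (\<Sum>c\<in>J. (l c * mono_sum S0 (a c) x) * (\<Prod>d\<in>J. x $ i - d))"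
      using J by (intro sum.cong refl) (simp add: prod.remove mult_ac)
    then have "(\<Sum>c\<in>J. l c * (\<Prod>d\<in>J - {c}. x $ i - d) * (mono_sum S0 (a c) x * (x $ i - c))) = 0"
      by (simp add: rel flip: sum_distrib_right)
    then show "f x ^ n0 * poly p (x $ i) = (\<Sum>c\<in>J. (l c * (\<Prod>d\<in>J - {c}. x $ i - d)) * (f x ^ n0 - mono_sum S0 (a c) x * (x $ i - c)))"
      by (simp add: right_diff_distrib sum_subtractf poly_p sum_distrib_left mult_ac)
  qed
  then have "(\<lambda>x. poly p (x $ i)) \<in> M"
    using prime[OF polynomials_power[OF f] polynomials_poly[OF z]] avoid by blast
  then show False using root_of_poly[OF z \<open>p \<noteq> 0\<close>] neg by blast
qed

text \<open>Otherwise Zorn's lemma provides a maximal ideal \<open>M\<close> containing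
  \<open>G\<close> and avoiding the powers of \<open>f\<close>. Modulo \<open>M\<close> the
  coordinates are constants, so \<open>M\<close> consists of functions vanishing at a point
  \<open>c\<close>. Then \<open>f\<close> vanishes at \<open>c\<close> as well, and being congruent
  to its value there it lies in \<open>M\<close>.\<close>

theorem Nullstellensatz:
  fixes f :: "complex^'m \<Rightarrow> complex"
  assumes G: "G \<subseteq> polynomials vec_coords" and f: "f \<in> polynomials vec_coords"
    and zero: "\<And>x. (\<And>g. g \<in> G \<Longrightarrow> g x = 0) \<Longrightarrow> f x = 0"
  shows "\<exists>n. (\<lambda>x. f x ^ n) \<in> ideal_gen vec_coords G"
proof (rule ccontr)
  assume neg: "\<not> ?thesis"
  define \<A> where "\<A> = {I. poly_ideal vec_coords I \<and> G \<subseteq> I \<and> (\<forall>n. (\<lambda>x. f x ^ n) \<notin> I)}"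
  have "ideal_gen vec_coords G \<in> \<A>"
    using neg poly_ideal_gen[OF G] by (auto simp: \<A>_def intro: ideal_gen.base)
  then have "\<A> \<noteq> {}" by blast
  then have "\<exists>M\<in>\<A>. \<forall>X\<in>\<A>. M \<subseteq> X \<longrightarrow> X = M"
  proof (rule subset_Zorn_nonempty)
    fix Ch assume Ch: "Ch \<noteq> {}" "subset.chain \<A> Ch"
    have "poly_ideal vec_coords (\<Union>Ch)"
      using Ch by (intro poly_ideal_chain_Union) (auto simp: subset.chain_def \<A>_def)
    moreover have "G \<subseteq> \<Union>Ch" "\<forall>n. (\<lambda>x. f x ^ n) \<notin> \<Union>Ch"
      using Ch unfolding subset.chain_def \<A>_def by blast+
    ultimately show "\<Union>Ch \<in> \<A>" by (simp add: \<A>_def)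
  qed
  then obtain M where M: "M \<in> \<A>" "\<And>X. X \<in> \<A> \<Longrightarrow> M \<subseteq> X \<Longrightarrow> X = M" by blast
  interpret maximal_avoiding_ideal vec_coords f M
  proof
    show "I = M" if "poly_ideal vec_coords I" "M \<subseteq> I" "\<And>n. (\<lambda>x. f x ^ n) \<notin> I" for I
      using that M by (intro M(2)) (auto simp: \<A>_def)
  qed (use M f in \<open>auto simp: \<A>_def\<close>)
  have "\<exists>c. \<forall>i. (\<lambda>x. x $ i - c $ i) \<in> M"
  proof -
    have "\<forall>i. \<exists>c. (\<lambda>x. x $ i - c) \<in> M"
      using coordinate_constant_mod maximal_avoiding_ideal_axioms by blast
    then obtain c where "\<And>i. (\<lambda>x. x $ i - c i) \<in> M" by metis
    then show ?thesis by (intro exI[of _ "\<chi> i. c i"]) simp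
  qed
  then obtain c where c: "\<And>i. (\<lambda>x. x $ i - c $ i) \<in> M" by blast
  have eval: "(\<lambda>x. h x - h c) \<in> M" if "h \<in> polynomials vec_coords" for h
    using that
  proof induction
    case (coordinate h)
    then show ?case using c by (auto simp: vec_coords_def)
  next
    case (const a)
    then show ?case using poly_ideal_0[OF ideal] by simp
  next
    case (add g h)
    then show ?case by (intro cong[OF poly_ideal_add[OF ideal add(3,4)]]) simp
  next
    case (mult g h)
    have "(\<lambda>x. h x * (g x - g c) + g c * (h x - h c)) \<in> M"
      by (intro poly_ideal_add[OF ideal] poly_ideal_mult[OF ideal] mult polynomials.const)
    then show ?case by (rule cong) (simp add: algebra_simps)
  qed
  have van: "h c = 0" if "h \<in> M" for h
  proof (rule ccontr)
    assume "h c \<noteq> 0"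
    have "(\<lambda>x. h x + (-1) * (h x - h c)) \<in> M"
      using that poly_ideal_sub[OF ideal that]
      by (intro poly_ideal_add[OF ideal] poly_ideal_mult[OF ideal] eval polynomials.const)
    then have "(\<lambda>x. h c) \<in> M" by simp
    then show False using const_notin[OF \<open>h c \<noteq> 0\<close>] by blast
  qed
  have "f c = 0" using zero[of c] van M by (auto simp: \<A>_def)
  then have "(\<lambda>x. f x ^ 1) \<in> M" using eval[OF f] by simp
  then show False using avoid by blast
qed

section \<open>Deformations of isolated zeros\<close>

definition pair_coords :: "((complex^'m) \<times> complex \<Rightarrow> complex) set" where
  "pair_coords = {\<lambda>z. fst z $ i | i. True} \<union> {snd}"

lemma pair_coord_polynomials:
  "(\<lambda>z. fst z $ i) \<in> polynomials pair_coords" "snd \<in> polynomials pair_coords"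
  by (auto intro!: polynomials.coordinate simp: pair_coords_def)

lemma polynomials_pair:
  "f \<in> polynomials vec_coords \<Longrightarrow> (\<lambda>z. f (fst z)) \<in> polynomials pair_coords"
  by (rule polynomials_compose) (auto simp: vec_coords_def intro: pair_coord_polynomials)

lemma polynomials_at_parameter:
  "f \<in> polynomials pair_coords \<Longrightarrow> (\<lambda>u. f (u, t)) \<in> polynomials vec_coords"
  by (rule polynomials_compose[where h = "\<lambda>u. (u, t)"])
    (auto simp: pair_coords_def intro: vec_coord_polynomials polynomials.const)

lemma polynomials_split_parameter:
  assumes "g \<in> polynomials pair_coords"
  shows "\<exists>r\<in>polynomials pair_coords. \<forall>u t. g (u, t) = g (u, 0) + t * r (u, t)"
  using assms
proof induction
  case (coordinate c)
  then consider i where "c = (\<lambda>z. fst z $ i)" | "c = snd" by (auto simp: pair_coords_def)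
  then show ?case
  proof cases
    case 1
    then show ?thesis by (intro bexI[of _ "\<lambda>_. 0"]) (auto intro: polynomials.const)
  next
    case 2
    then show ?thesis by (intro bexI[of _ "\<lambda>_. 1"]) (auto intro: polynomials.const)
  qed
next
  case (const a)
  then show ?case by (intro bexI[of _ "\<lambda>_. 0"]) (auto intro: polynomials.const)
next
  case (add f g)
  then obtain r s where r: "r \<in> polynomials pair_coords" "\<And>u t. f (u, t) = f (u, 0) + t * r (u, t)"
    and s: "s \<in> polynomials pair_coords" "\<And>u t. g (u, t) = g (u, 0) + t * s (u, t)" by blast
  have *: "f (u, t) + g (u, t) = f (u, 0) + g (u, 0) + t * (r (u, t) + s (u, t))" for u t
    using r(2)[of u t] s(2)[of u t] by (simp add: algebra_simps)
  show ?case
  proof (rule bexI[of _ "\<lambda>z. r z + s z"])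
    show "\<forall>u t. f (u, t) + g (u, t) = f (u, 0) + g (u, 0) + t * (r (u, t) + s (u, t))"
      using * by blast
  qed (intro polynomials.add r s)
next
  case (mult f g)
  then obtain r s where r: "r \<in> polynomials pair_coords" "\<And>u t. f (u, t) = f (u, 0) + t * r (u, t)"
    and s: "s \<in> polynomials pair_coords" "\<And>u t. g (u, t) = g (u, 0) + t * s (u, t)" by blast
  have g0: "(\<lambda>z. g (fst z, 0)) \<in> polynomials pair_coords"
    using polynomials_pair[OF polynomials_at_parameter[OF mult(2)]] .
  show ?case
  proof (rule bexI[of _ "\<lambda>z. r z * g (fst z, 0) + f z * s z"])
    show "\<forall>u t. f (u, t) * g (u, t) = f (u, 0) * g (u, 0) +
        t * (r (u, t) * g (fst (u, t), 0) + f (u, t) * s (u, t))"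
    proof (intro allI)
      fix u t
      have "f (u, t) * g (u, t) = f (u, t) * g (u, 0) + t * (f (u, t) * s (u, t))"
        by (subst s(2)) (simp add: algebra_simps)
      also have "f (u, t) * g (u, 0) = f (u, 0) * g (u, 0) + t * (r (u, t) * g (u, 0))"
        by (subst r(2)) (simp add: algebra_simps)
      finally show "f (u, t) * g (u, t) = f (u, 0) * g (u, 0) +
        t * (r (u, t) * g (fst (u, t), 0) + f (u, t) * s (u, t))" by (simp add: algebra_simps)
    qed
  qed (intro polynomials_intros r s g0 mult)
qed

text \<open>At a common zero of the deformed generators, the undeformed generator
  \<open>g (u, 0)\<close> is itself a multiple of \<open>t\<close>, by splitting off the parameter.
  This property passes to all combinations.\<close>

lemma ideal_deform:
  assumes "f \<in> ideal_gen vec_coords {\<lambda>u. g (u, 0) | g. g \<in> \<G>}" "\<G> \<subseteq> polynomials pair_coords"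
  shows "\<exists>e\<in>polynomials pair_coords. \<forall>u t. (\<forall>g\<in>\<G>. g (u, t) = 0) \<longrightarrow> f u = t * e (u, t)"
  using assms(1)
proof induction
  case zero
  show ?case by (rule bexI[of _ "\<lambda>_. 0"]) (auto intro: polynomials.const)
next
  case (base f)
  then obtain g where g: "g \<in> \<G>" "f = (\<lambda>u. g (u, 0))" by blast
  then obtain r where r: "r \<in> polynomials pair_coords" "\<And>u t. g (u, t) = g (u, 0) + t * r (u, t)"
    using polynomials_split_parameter assms(2) by blast
  have "f u = t * - r (u, t)" if "\<forall>g\<in>\<G>. g (u, t) = 0" for u t
  proof -
    have "g (u, t) = 0" using that g by blast
    then show ?thesis using r(2)[of u t] g by (simp add: eq_neg_iff_add_eq_0)
  qed
  then show ?case by (intro bexI[of _ "\<lambda>z. - r z"]) (auto intro: polynomials_uminus r)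
next
  case (add f g)
  then obtain d e where "d \<in> polynomials pair_coords" "\<forall>u t. (\<forall>g\<in>\<G>. g (u, t) = 0) \<longrightarrow> f u = t * d (u, t)"
    "e \<in> polynomials pair_coords" "\<forall>u t. (\<forall>g\<in>\<G>. g (u, t) = 0) \<longrightarrow> g u = t * e (u, t)"
    by blast
  then show ?case
    by (intro bexI[of _ "\<lambda>z. d z + e z"]) (auto simp: distrib_left intro: polynomials.add)
next
  case (mult f g)
  then obtain e where "e \<in> polynomials pair_coords" "\<forall>u t. (\<forall>g\<in>\<G>. g (u, t) = 0) \<longrightarrow> g u = t * e (u, t)"
    by blast
  then show ?case
    by (intro bexI[of _ "\<lambda>z. f (fst z) * e z"])
      (auto intro!: polynomials.mult polynomials_pair mult(1))
qed

text \<open>A weight \<open>l\<close> on the finite set \<open>J\<close> of points is regarded as a functional on polynomials;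
  \<open>moment_bound J \<rho> l N\<close> bounds its norm with respect to the weighted \<open>\<ell>\<^sup>1\<close>-norm of the
  coefficients.\<close>

definition moment_bound :: "(complex^'m) set \<Rightarrow> real \<Rightarrow> (complex^'m \<Rightarrow> complex) \<Rightarrow> real \<Rightarrow> bool" where
  "moment_bound J \<rho> l N \<longleftrightarrow> (\<forall>a. norm (\<Sum>u\<in>J. l u * monomial a u) \<le> N * \<rho> ^ (\<Sum>i\<in>UNIV. a i))"

text \<open>\<open>H\<close> bounds the norm of the transpose of multiplication by \<open>h\<close>.
  Bounding operators rather than values at points makes the estimates compose and independent of the
  size of \<open>J\<close>.\<close>

definition multiplier_bound :: "(complex^'m) set \<Rightarrow> real \<Rightarrow> (complex^'m \<Rightarrow> complex) \<Rightarrow> real \<Rightarrow> bool" where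
  "multiplier_bound J \<rho> h H \<longleftrightarrow>
     (\<forall>l N. moment_bound J \<rho> l N \<longrightarrow> moment_bound J \<rho> (\<lambda>u. l u * h u) (H * N))"

lemma moment_boundD: "moment_bound J \<rho> l N \<Longrightarrow> norm (\<Sum>u\<in>J. l u * monomial a u) \<le> N * \<rho> ^ (\<Sum>i\<in>UNIV. a i)"
  by (simp add: moment_bound_def)

lemma moment_bound_nonneg: "moment_bound J \<rho> l N \<Longrightarrow> 0 \<le> N"
  using moment_boundD[of J \<rho> l N "\<lambda>_. 0"] by (simp add: order_trans[OF norm_ge_zero])

lemma moment_bound_mono: "moment_bound J \<rho> l N \<Longrightarrow> N \<le> N' \<Longrightarrow> 0 \<le> \<rho> \<Longrightarrow> moment_bound J \<rho> l N'"
  unfolding moment_bound_def by (meson mult_right_mono order_trans zero_le_power)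

lemma multiplier_bound_mono:
  "multiplier_bound J \<rho> h H \<Longrightarrow> H \<le> H' \<Longrightarrow> 0 \<le> \<rho> \<Longrightarrow> multiplier_bound J \<rho> h H'"
  unfolding multiplier_bound_def
  by (meson moment_bound_mono moment_bound_nonneg mult_right_mono)

lemma multiplier_bound_const: "multiplier_bound J \<rho> (\<lambda>_. c) (norm c)"
  unfolding multiplier_bound_def moment_bound_def
proof (intro allI impI)
  fix l N a
  assume *: "\<forall>a. norm (\<Sum>u\<in>J. l u * monomial a u) \<le> N * \<rho> ^ (\<Sum>i\<in>UNIV. a i)"
  have "(\<Sum>u\<in>J. l u * c * monomial a u) = c * (\<Sum>u\<in>J. l u * monomial a u)"
    by (simp add: sum_distrib_left mult_ac)
  then show "norm (\<Sum>u\<in>J. l u * c * monomial a u) \<le> norm c * N * \<rho> ^ (\<Sum>i\<in>UNIV. a i)"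
    using * by (simp add: norm_mult mult_left_mono mult.assoc)
qed

text \<open>Multiplication by a coordinate raises the degree of a monomial by one, which costs one
  factor \<open>\<rho>\<close>.\<close>

lemma multiplier_bound_coord: "multiplier_bound J \<rho> (\<lambda>u. u $ (i :: 'a::finite)) \<rho>"
  unfolding multiplier_bound_def moment_bound_def
proof (intro allI impI)
  fix l N and a :: "'a \<Rightarrow> nat"
  assume *: "\<forall>a. norm (\<Sum>u\<in>J. l u * monomial a u) \<le> N * \<rho> ^ (\<Sum>i\<in>UNIV. a i)"
  define b :: "'a \<Rightarrow> nat" where "b = (\<lambda>j. a j + (if j = i then 1 else 0))"
  have mono: "monomial b u = monomial a u * u $ i" for u
    using monomial_unit[of i 1 u] by (simp add: b_def monomial_add)
  have "(\<Sum>j\<in>UNIV. b j) = Suc (\<Sum>j\<in>UNIV. a j)"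
    by (simp add: b_def sum.distrib)
  then show "norm (\<Sum>u\<in>J. l u * u $ i * monomial a u) \<le> \<rho> * N * \<rho> ^ (\<Sum>i\<in>UNIV. a i)"
    using *[rule_format, of b] by (simp add: mono mult_ac)
qed

lemma multiplier_bound_add:
  assumes "multiplier_bound J \<rho> g G" "multiplier_bound J \<rho> h H"
  shows "multiplier_bound J \<rho> (\<lambda>u. g u + h u) (G + H)"
  unfolding multiplier_bound_def moment_bound_def[of J \<rho> "\<lambda>u. _ u * (_ u + _ u)"]
proof (intro allI impI)
  fix l N a assume "moment_bound J \<rho> l N"
  then have "norm (\<Sum>u\<in>J. l u * g u * monomial a u) \<le> G * N * \<rho> ^ (\<Sum>i\<in>UNIV. a i)"
    "norm (\<Sum>u\<in>J. l u * h u * monomial a u) \<le> H * N * \<rho> ^ (\<Sum>i\<in>UNIV. a i)"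
    using assms by (auto simp: multiplier_bound_def intro: moment_boundD)
  then have "norm ((\<Sum>u\<in>J. l u * g u * monomial a u) + (\<Sum>u\<in>J. l u * h u * monomial a u)) \<le>
      G * N * \<rho> ^ (\<Sum>i\<in>UNIV. a i) + H * N * \<rho> ^ (\<Sum>i\<in>UNIV. a i)"
    by (rule norm_triangle_mono)
  then show "norm (\<Sum>u\<in>J. l u * (g u + h u) * monomial a u) \<le> (G + H) * N * \<rho> ^ (\<Sum>i\<in>UNIV. a i)"
    by (simp add: algebra_simps sum.distrib)
qed

lemma multiplier_bound_mult:
  assumes "multiplier_bound J \<rho> g G" "multiplier_bound J \<rho> h H"
  shows "multiplier_bound J \<rho> (\<lambda>u. g u * h u) (G * H)"
  unfolding multiplier_bound_def
proof (intro allI impI)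
  fix l N assume "moment_bound J \<rho> l N"
  then have "moment_bound J \<rho> (\<lambda>u. l u * h u * g u) (G * (H * N))"
    using assms unfolding multiplier_bound_def by blast
  then show "moment_bound J \<rho> (\<lambda>u. l u * (g u * h u)) (G * H * N)"
    by (simp add: mult_ac)
qed

text \<open>The order of the quantifiers matters: \<open>H\<close> is fixed before \<open>J\<close>,
  \<open>\<rho>\<close> and \<open>t\<close>, so that the radius and the range of the parameter can
  be chosen afterwards.\<close>

lemma multiplier_bound_polynomial:
  assumes "f \<in> polynomials pair_coords"
  shows "\<exists>H\<ge>0. \<forall>J \<rho> t. 0 \<le> \<rho> \<and> \<rho> \<le> 1 \<and> norm t \<le> 1 \<longrightarrow> multiplier_bound J \<rho> (\<lambda>u. f (u, t)) H"
  using assms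
proof induction
  case (coordinate c)
  then consider i where "c = (\<lambda>z. fst z $ i)" | "c = snd" by (auto simp: pair_coords_def)
  then show ?case
  proof cases
    case 1
    then show ?thesis
      by (intro exI[of _ 1]) (auto intro: multiplier_bound_mono[OF multiplier_bound_coord])
  next
    case 2
    then show ?thesis
      by (intro exI[of _ 1]) (auto intro: multiplier_bound_mono[OF multiplier_bound_const])
  qed
next
  case (const a)
  show ?case by (intro exI[of _ "norm a"]) (auto intro: multiplier_bound_const)
next
  case (add f g)
  then obtain G H where "G \<ge> 0" "H \<ge> 0"
    "\<And>J \<rho> t. 0 \<le> \<rho> \<and> \<rho> \<le> 1 \<and> norm t \<le> 1 \<Longrightarrow> multiplier_bound J \<rho> (\<lambda>u. f (u, t)) G"
    "\<And>J \<rho> t. 0 \<le> \<rho> \<and> \<rho> \<le> 1 \<and> norm t \<le> 1 \<Longrightarrow> multiplier_bound J \<rho> (\<lambda>u. g (u, t)) H"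
    by metis
  then show ?case by (intro exI[of _ "G + H"]) (simp add: multiplier_bound_add)
next
  case (mult f g)
  then obtain G H where "G \<ge> 0" "H \<ge> 0"
    "\<And>J \<rho> t. 0 \<le> \<rho> \<and> \<rho> \<le> 1 \<and> norm t \<le> 1 \<Longrightarrow> multiplier_bound J \<rho> (\<lambda>u. f (u, t)) G"
    "\<And>J \<rho> t. 0 \<le> \<rho> \<and> \<rho> \<le> 1 \<and> norm t \<le> 1 \<Longrightarrow> multiplier_bound J \<rho> (\<lambda>u. g (u, t)) H"
    by metis
  then show ?case by (intro exI[of _ "G * H"]) (simp add: multiplier_bound_mult)
qed

text \<open>Without a constant term every monomial contributes at least one factor
  \<open>\<rho>\<close>; for products, \<open>\<rho> \<le> 1\<close> absorbs the quadratic term. On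
  a small polydisc such a multiplier is a contraction.\<close>

lemma multiplier_bound_vanishing:
  assumes "f \<in> polynomials vec_coords"
  shows "\<exists>H\<ge>0. \<forall>J \<rho>. 0 \<le> \<rho> \<and> \<rho> \<le> 1 \<longrightarrow> multiplier_bound J \<rho> (\<lambda>u. f u - f 0) (\<rho> * H)"
  using assms
proof induction
  case (coordinate c)
  then obtain i where c: "c = (\<lambda>x. x $ i)" by (auto simp: vec_coords_def)
  show ?case
    by (intro exI[of _ 1]) (auto simp: c intro: multiplier_bound_coord)
next
  case (const a)
  show ?case using multiplier_bound_const[of _ _ 0] by (intro exI[of _ 0]) auto
next
  case (add f g)
  then obtain G H where GH: "G \<ge> 0" "H \<ge> 0"
    "\<And>J \<rho>. 0 \<le> \<rho> \<and> \<rho> \<le> 1 \<Longrightarrow> multiplier_bound J \<rho> (\<lambda>u. f u - f 0) (\<rho> * G)"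
    "\<And>J \<rho>. 0 \<le> \<rho> \<and> \<rho> \<le> 1 \<Longrightarrow> multiplier_bound J \<rho> (\<lambda>u. g u - g 0) (\<rho> * H)" by blast
  show ?case
    using multiplier_bound_add[OF GH(3,4)] GH(1,2)
    by (intro exI[of _ "G + H"]) (auto simp: algebra_simps)
next
  case (mult f g)
  then obtain G H where GH: "G \<ge> 0" "H \<ge> 0"
    "\<And>J \<rho>. 0 \<le> \<rho> \<and> \<rho> \<le> 1 \<Longrightarrow> multiplier_bound J \<rho> (\<lambda>u. f u - f 0) (\<rho> * G)"
    "\<And>J \<rho>. 0 \<le> \<rho> \<and> \<rho> \<le> 1 \<Longrightarrow> multiplier_bound J \<rho> (\<lambda>u. g u - g 0) (\<rho> * H)" by blast
  have "multiplier_bound J \<rho> (\<lambda>u. f u * g u - f 0 * g 0) (\<rho> * (G * (H + norm (g 0)) + norm (f 0) * H))"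
    if \<rho>: "0 \<le> \<rho> \<and> \<rho> \<le> 1" for J \<rho>
  proof -
    have "multiplier_bound J \<rho> (\<lambda>u. (f u - f 0) * ((g u - g 0) + g 0) + f 0 * (g u - g 0))
        (\<rho> * G * (\<rho> * H + norm (g 0)) + norm (f 0) * (\<rho> * H))"
      by (intro multiplier_bound_add multiplier_bound_mult multiplier_bound_const GH \<rho>)
    moreover have "\<rho> * G * (\<rho> * H + norm (g 0)) + norm (f 0) * (\<rho> * H) \<le>
        \<rho> * (G * (H + norm (g 0)) + norm (f 0) * H)"
    proof -
      have "\<rho> * H \<le> H" using \<rho> GH by (simp add: mult_left_le_one_le)
      then have "\<rho> * G * (\<rho> * H + norm (g 0)) \<le> \<rho> * G * (H + norm (g 0))"
        using \<rho> GH by (intro mult_left_mono) auto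
      then show ?thesis by (simp add: algebra_simps)
    qed
    ultimately show ?thesis
      using multiplier_bound_mono \<rho> by (fastforce simp: algebra_simps)
  qed
  then show ?case
    using GH by (intro exI[of _ "G * (H + norm (g 0)) + norm (f 0) * H"]) auto
qed

text \<open>Interpolation: a product of coordinate differences is a polynomial that vanishes on
  \<open>J\<close> except at \<open>u0\<close>, and the functional kills it since it kills all
  monomials.\<close>

lemma moments_separate_points:
  assumes "finite J" "u0 \<in> J" "\<And>a. (\<Sum>u\<in>J. l u * monomial a u) = 0"
  shows "l u0 = 0"
proof -
  have "\<forall>v. v \<noteq> u0 \<longrightarrow> (\<exists>i. u0 $ i \<noteq> v $ i)" by (metis vec_eq_iff)
  then obtain i where i: "\<And>v. v \<noteq> u0 \<Longrightarrow> u0 $ i v \<noteq> v $ i v" by metis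
  define f where "f u = (\<Prod>v\<in>J - {u0}. u $ i v - v $ i v)" for u
  have "f \<in> polynomials vec_coords"
    unfolding f_def by (intro polynomials_intros vec_coord_polynomials)
  then obtain S c where S: "f = mono_sum S c" using polynomials_mono_sum by blast
  have "(\<Sum>u\<in>J. l u * f u) = (\<Sum>a\<in>S. c a * (\<Sum>u\<in>J. l u * monomial a u))"
    unfolding S mono_sum_def sum_distrib_left by (subst sum.swap) (simp add: mult_ac)
  then have "(\<Sum>u\<in>J. l u * f u) = 0" using assms(3) by simp
  moreover have "(\<Sum>u\<in>J. l u * f u) = l u0 * f u0"
  proof -
    have "f u = 0" if "u \<in> J - {u0}" for u
      unfolding f_def using assms(1) that by (intro prod_zero) auto
    then show ?thesis using assms by (simp add: sum.remove)
  qed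
  moreover have "f u0 \<noteq> 0" unfolding f_def using assms(1) i by auto
  ultimately show ?thesis by simp
qed

lemma finite_exponents: "finite {a :: 'm::finite \<Rightarrow> nat. \<forall>i. a i < K}"
  using finite_PiE[of "UNIV :: 'm set" "\<lambda>_. {..<K}"]
  by (simp add: PiE_UNIV_domain Pi_def)

text \<open>With more points than monomials of exponents below \<open>K\<close>, some nonzero weight annihilates those
  monomials. Multiples of \<open>u $ k ^ K\<close> are handled by the relations, which shrink the bound.\<close>

lemma card_points_bound:
  fixes J :: "(complex^'m) set" and \<phi> :: "complex^'m \<Rightarrow> complex"
  assumes J: "finite J" "\<And>u i. u \<in> J \<Longrightarrow> norm (u $ i) \<le> \<rho>" and \<rho>: "0 < \<rho>"
    and rel: "\<And>u k. u \<in> J \<Longrightarrow> (u $ k) ^ K = (u $ k) ^ K * \<phi> u + t * e k u"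
    and \<phi>: "multiplier_bound J \<rho> \<phi> (1/2)" and e: "\<And>k. multiplier_bound J \<rho> (e k) H"
    and t: "norm t * H \<le> \<rho> ^ K / 4"
  shows "card J \<le> card {a :: 'm \<Rightarrow> nat. \<forall>i. a i < K}"
proof (rule ccontr)
  assume "\<not> ?thesis"
  then obtain l where l: "\<exists>u\<in>J. l u \<noteq> 0"
    "\<And>a. \<forall>i. a i < K \<Longrightarrow> (\<Sum>u\<in>J. l u * monomial a u) = 0"
    using underdetermined_system[OF finite_exponents J(1), of K "\<lambda>u a. monomial a u"] by auto
  have "moment_bound J \<rho> l (\<Sum>u\<in>J. norm (l u))"
    unfolding moment_bound_def
  proof
    fix a :: "'m \<Rightarrow> nat"
    have "norm (monomial a u) \<le> \<rho> ^ (\<Sum>i\<in>UNIV. a i)" if "u \<in> J" for u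
      unfolding monomial_def prod_norm[symmetric] power_sum norm_power
      using J(2)[OF that] by (intro prod_mono) (auto intro: power_mono)
    then have "norm (\<Sum>u\<in>J. l u * monomial a u) \<le> (\<Sum>u\<in>J. norm (l u) * \<rho> ^ (\<Sum>i\<in>UNIV. a i))"
      by (intro sum_norm_le) (auto simp: norm_mult intro: mult_left_mono)
    then show "norm (\<Sum>u\<in>J. l u * monomial a u) \<le> (\<Sum>u\<in>J. norm (l u)) * \<rho> ^ (\<Sum>i\<in>UNIV. a i)"
      by (simp add: sum_distrib_right)
  qed
  \<comment> \<open>The factor 3/4 is 1/2 from the multiplier \<open>\<phi>\<close> plus 1/4 from
    the term with \<open>t\<close>.\<close>
  moreover have step: "moment_bound J \<rho> l (3/4 * N)" if N: "moment_bound J \<rho> l N" for N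
    unfolding moment_bound_def
  proof
    fix a :: "'m \<Rightarrow> nat"
    have N0: "0 \<le> N" using moment_bound_nonneg N by blast
    show "norm (\<Sum>u\<in>J. l u * monomial a u) \<le> 3/4 * N * \<rho> ^ (\<Sum>i\<in>UNIV. a i)"
    proof (cases "\<forall>i. a i < K")
      case True
      then show ?thesis using l(2) N0 \<rho> by simp
    next
      case False
      then obtain k where k: "a k \<ge> K" by (auto simp: not_less)
      \<comment> \<open>Take \<open>K\<close> away from the exponent of the coordinate
        \<open>k\<close>, so that \<open>rel\<close> can be applied to the removed power.\<close>
      define b where "b = (\<lambda>j. if j = k then a j - K else a j)"
      have a: "a = (\<lambda>j. b j + (if j = k then K else 0))" using k by (auto simp: b_def)
      have mono: "monomial a u = monomial b u * (u $ k) ^ K" for u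
        by (subst a) (simp add: monomial_add monomial_unit)
      have sum_a: "(\<Sum>i\<in>UNIV. a i) = (\<Sum>i\<in>UNIV. b i) + K"
        by (subst a) (simp add: sum.distrib)
      have "(\<Sum>u\<in>J. l u * monomial a u) =
          (\<Sum>u\<in>J. l u * \<phi> u * monomial a u + t * (l u * e k u * monomial b u))"
      proof (rule sum.cong[OF refl])
        fix u assume "u \<in> J"
        have "l u * monomial a u = l u * monomial b u * ((u $ k) ^ K * \<phi> u + t * e k u)"
          by (simp add: mono flip: rel[OF \<open>u \<in> J\<close>])
        then show "l u * monomial a u = l u * \<phi> u * monomial a u + t * (l u * e k u * monomial b u)"
          by (simp add: mono algebra_simps)
      qed
      also have "norm \<dots> \<le> norm (\<Sum>u\<in>J. l u * \<phi> u * monomial a u) +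
          norm t * norm (\<Sum>u\<in>J. l u * e k u * monomial b u)"
        unfolding sum.distrib sum_distrib_left[symmetric] norm_mult[symmetric] by (rule norm_triangle_ineq)
      also have "\<dots> \<le> 1/2 * N * \<rho> ^ (\<Sum>i\<in>UNIV. a i) + norm t * (H * N * \<rho> ^ (\<Sum>i\<in>UNIV. b i))"
      proof (intro add_mono mult_left_mono moment_boundD)
        show "moment_bound J \<rho> (\<lambda>u. l u * \<phi> u) (1 / 2 * N)" "moment_bound J \<rho> (\<lambda>u. l u * e k u) (H * N)"
          using \<phi> e N unfolding multiplier_bound_def by blast+
      qed auto
      also have "norm t * (H * N * \<rho> ^ (\<Sum>i\<in>UNIV. b i)) = (norm t * H) * (N * \<rho> ^ (\<Sum>i\<in>UNIV. b i))"
        by simp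
      \<comment> \<open>Passing from \<open>a\<close> to \<open>b\<close> loses a factor
        \<open>\<rho> ^ K\<close>; the smallness of \<open>t\<close> restores it.\<close>
      also have "\<dots> \<le> (\<rho> ^ K / 4) * (N * \<rho> ^ (\<Sum>i\<in>UNIV. b i))"
        using t N0 \<rho> by (intro mult_right_mono) auto
      also have "\<dots> = 1/4 * N * \<rho> ^ (\<Sum>i\<in>UNIV. a i)"
        by (simp add: sum_a power_add)
      finally show ?thesis by simp
    qed
  qed
  ultimately have pow: "moment_bound J \<rho> l ((3/4) ^ n * (\<Sum>u\<in>J. norm (l u)))" for n
    by (induction n) (auto simp: mult.assoc dest: step)
  \<comment> \<open>Iterating the contraction drives the norm of the functional to zero, so it kills
    every monomial and not only those of small exponents.\<close>
  have "(\<Sum>u\<in>J. l u * monomial a u) = 0" for a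
  proof -
    have "(\<lambda>n. (3/4) ^ n * (\<Sum>u\<in>J. norm (l u)) * \<rho> ^ (\<Sum>i\<in>UNIV. a i)) \<longlonglongrightarrow> 0 * (\<Sum>u\<in>J. norm (l u)) * \<rho> ^ (\<Sum>i\<in>UNIV. a i)"
      by (intro tendsto_mult tendsto_const LIMSEQ_power_zero) auto
    then have "norm (\<Sum>u\<in>J. l u * monomial a u) \<le> 0 * (\<Sum>u\<in>J. norm (l u)) * \<rho> ^ (\<Sum>i\<in>UNIV. a i)"
      by (rule LIMSEQ_le_const) (use moment_boundD[OF pow] in blast)
    then show ?thesis by simp
  qed
  then show False using moments_separate_points[OF J(1)] l(1) by blast
qed

text \<open>Only where \<open>F\<close> is nonzero is the origin the sole possible zero at
  \<open>t = 0\<close>; hence it is the products \<open>F u * u $ k\<close> that vanish on all zeros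
  and to which the Nullstellensatz applies. The powers obtained feed
  \<open>card_points_bound\<close>, whose bound depends neither on \<open>t\<close> nor on the
  chosen zeros.\<close>

theorem finite_zeros_deformation:
  fixes \<G> :: "((complex^'m) \<times> complex \<Rightarrow> complex) set"
  assumes \<G>: "\<G> \<subseteq> polynomials pair_coords"
    and F: "F \<in> polynomials vec_coords" "F 0 \<noteq> 0"
    and isolated: "\<And>u. (\<And>g. g \<in> \<G> \<Longrightarrow> g (u, 0) = 0) \<Longrightarrow> F u \<noteq> 0 \<Longrightarrow> u = 0"
  shows "\<exists>\<rho>>0. \<exists>\<delta>>0. \<forall>t. norm t < \<delta> \<longrightarrow> finite {u. norm u < \<rho> \<and> (\<forall>g\<in>\<G>. g (u, t) = 0)}"
proof -
  define G0 where "G0 = {\<lambda>u. g (u, 0) | g. g \<in> \<G>}"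
  have G0: "G0 \<subseteq> polynomials vec_coords"
    using \<G> by (auto simp: G0_def intro: polynomials_at_parameter)
  have "\<forall>k. \<exists>n. (\<lambda>u. (F u * u $ k) ^ n) \<in> ideal_gen vec_coords G0"
  proof
    fix k
    show "\<exists>n. (\<lambda>u. (F u * u $ k) ^ n) \<in> ideal_gen vec_coords G0"
    proof (rule Nullstellensatz[OF G0])
      show "(\<lambda>u. F u * u $ k) \<in> polynomials vec_coords"
        by (intro polynomials_intros F vec_coord_polynomials)
      show "F u * u $ k = 0" if "\<And>g. g \<in> G0 \<Longrightarrow> g u = 0" for u
      proof -
        have "g (u, 0) = 0" if "g \<in> \<G>" for g
          using \<open>\<And>g. g \<in> G0 \<Longrightarrow> g u = 0\<close> that unfolding G0_def by blast
        then have "F u \<noteq> 0 \<Longrightarrow> u = 0" using isolated by blast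
        then show ?thesis by (cases "F u = 0") auto
      qed
    qed
  qed
  from choice[OF this] obtain n where "\<forall>k. (\<lambda>u. (F u * u $ k) ^ n k) \<in> ideal_gen vec_coords G0" ..
  then have n: "(\<lambda>u. (F u * u $ k) ^ n k) \<in> ideal_gen vec_coords G0" for k by blast
  \<comment> \<open>A common exponent for all coordinates.\<close>
  define K where "K = (\<Sum>k\<in>UNIV. n k)"
  have nK: "n k \<le> K" for k unfolding K_def by (rule member_le_sum) auto
  have "\<forall>k. \<exists>e\<in>polynomials pair_coords. \<forall>u t. (\<forall>g\<in>\<G>. g (u, t) = 0) \<longrightarrow> (F u * u $ k) ^ K = t * e (u, t)"
  proof
    fix k
    have "(\<lambda>u. (F u * u $ k) ^ (K - n k) * (F u * u $ k) ^ n k) \<in> ideal_gen vec_coords G0"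
      by (intro ideal_gen.mult n polynomials_intros F vec_coord_polynomials)
    moreover have "(\<lambda>u. (F u * u $ k) ^ (K - n k) * (F u * u $ k) ^ n k) = (\<lambda>u. (F u * u $ k) ^ K)"
      using nK[of k] by (simp flip: power_add)
    ultimately show "\<exists>e\<in>polynomials pair_coords. \<forall>u t. (\<forall>g\<in>\<G>. g (u, t) = 0) \<longrightarrow> (F u * u $ k) ^ K = t * e (u, t)"
      using ideal_deform[OF _ \<G>] by (simp add: G0_def)
  qed
  from choice[OF this[unfolded Bex_def]] obtain e where
    "\<forall>k. e k \<in> polynomials pair_coords \<and> (\<forall>u t. (\<forall>g\<in>\<G>. g (u, t) = 0) \<longrightarrow> (F u * u $ k) ^ K = t * e k (u, t))" ..
  then have e: "e k \<in> polynomials pair_coords"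
    "(\<forall>g\<in>\<G>. g (u, t) = 0) \<Longrightarrow> (F u * u $ k) ^ K = t * e k (u, t)" for k u t by blast+
  \<comment> \<open>\<open>F u\<close> cannot be inverted among polynomials. Normalized by its value
    at the origin, its power is \<open>1 - \<phi> u\<close> with \<open>\<phi>\<close> small near
    the origin, and \<open>\<phi>\<close> moves to the right-hand side of the relation.\<close>
  define \<phi> where "\<phi> u = 1 - F u ^ K / F 0 ^ K" for u
  have \<phi>: "\<phi> \<in> polynomials vec_coords"
    unfolding \<phi>_def divide_inverse by (intro polynomials_intros F)
  have \<phi>0: "\<phi> 0 = 0" using F by (simp add: \<phi>_def)
  obtain L where L: "L \<ge> 0" "\<And>J \<rho>. 0 \<le> \<rho> \<and> \<rho> \<le> 1 \<Longrightarrow> multiplier_bound J \<rho> \<phi> (\<rho> * L)"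
    using multiplier_bound_vanishing[OF \<phi>] by (auto simp: \<phi>0)
  define e' where "e' k z = e k z / F 0 ^ K" for k z
  have e': "e' k \<in> polynomials pair_coords" for k
    unfolding e'_def divide_inverse by (intro polynomials_intros e)
  have "\<forall>k. \<exists>H\<ge>0. \<forall>J \<rho> t. 0 \<le> \<rho> \<and> \<rho> \<le> 1 \<and> norm t \<le> 1 \<longrightarrow> multiplier_bound J \<rho> (\<lambda>u. e' k (u, t)) H"
    using multiplier_bound_polynomial[OF e'] by blast
  from choice[OF this] obtain h where "\<forall>k. h k \<ge> 0 \<and> (\<forall>J \<rho> t. 0 \<le> \<rho> \<and> \<rho> \<le> 1 \<and> norm t \<le> 1 \<longrightarrow>
    multiplier_bound J \<rho> (\<lambda>u. e' k (u, t)) (h k))" ..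
  then have h: "h k \<ge> 0"
    "0 \<le> \<rho> \<and> \<rho> \<le> 1 \<and> norm t \<le> 1 \<Longrightarrow> multiplier_bound J \<rho> (\<lambda>u. e' k (u, t)) (h k)" for k J \<rho> t by blast+
  define H where "H = (\<Sum>k\<in>UNIV. h k)"
  have hH: "h k \<le> H" for k unfolding H_def by (rule member_le_sum) (auto simp: h)
  have H0: "H \<ge> 0" unfolding H_def by (simp add: h sum_nonneg)
  \<comment> \<open>Chosen to make the norm of \<open>\<phi>\<close> at most 1/2; the summand 1
    allows for \<open>L = 0\<close> and keeps \<open>\<rho>\<close> below 1.\<close>
  define \<rho> where "\<rho> = 1 / (2 * (L + 1))"
  have \<rho>: "0 < \<rho>" "\<rho> \<le> 1" "\<rho> * L \<le> 1 / 2"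
    using L by (auto simp: \<rho>_def field_simps)
  \<comment> \<open>The bound 1 is the range in which \<open>h\<close> is valid; the other one gives
    the smallness of \<open>norm t * H\<close> required for the contraction.\<close>
  define \<delta> where "\<delta> = min 1 (\<rho> ^ K / (4 * (H + 1)))"
  have "\<delta> > 0" using \<rho> H0 by (simp add: \<delta>_def)
  moreover have "finite {u. norm u < \<rho> \<and> (\<forall>g\<in>\<G>. g (u, t) = 0)}" if t: "norm t < \<delta>" for t
  proof (rule ccontr)
    assume inf: "infinite {u. norm u < \<rho> \<and> (\<forall>g\<in>\<G>. g (u, t) = 0)}"
    then obtain J where J: "finite J" "card J = Suc (card {a :: 'm \<Rightarrow> nat. \<forall>i. a i < K})"
      "J \<subseteq> {u. norm u < \<rho> \<and> (\<forall>g\<in>\<G>. g (u, t) = 0)}"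
      using infinite_arbitrarily_large[OF inf, of "Suc (card {a :: 'm \<Rightarrow> nat. \<forall>i. a i < K})"] by blast
    have "card J \<le> card {a :: 'm \<Rightarrow> nat. \<forall>i. a i < K}"
    proof (rule card_points_bound[where \<phi> = \<phi> and \<rho> = \<rho> and t = t and e = "\<lambda>k u. e' k (u, t)" and H = H])
      show "norm (u $ i) \<le> \<rho>" if "u \<in> J" for u i
        using that J Finite_Cartesian_Product.norm_nth_le[of u i] by fastforce
      show "u $ k ^ K = u $ k ^ K * \<phi> u + t * e' k (u, t)" if "u \<in> J" for u k
      proof -
        have "(F u * u $ k) ^ K = t * e k (u, t)" using e(2) that J by blast
        then show ?thesis using F by (simp add: \<phi>_def e'_def field_simps power_mult_distrib)
      qed
      show "multiplier_bound J \<rho> \<phi> (1 / 2)"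
        using \<rho> by (intro multiplier_bound_mono[OF L(2)]) auto
      show "multiplier_bound J \<rho> (\<lambda>u. e' k (u, t)) H" for k
        using \<rho> t by (intro multiplier_bound_mono[OF h(2) hH]) (auto simp: \<delta>_def)
      have "norm t * H \<le> (\<rho> ^ K / (4 * (H + 1))) * (H + 1)"
        using t H0 \<rho> by (intro mult_mono) (auto simp: \<delta>_def)
      also have "\<dots> = \<rho> ^ K / 4"
      proof -
        have "\<rho> ^ K / (4 * c) * c = \<rho> ^ K / 4" if "c \<noteq> 0" for c
          using that by simp
        moreover have "H + 1 \<noteq> 0" using H0 by simp
        ultimately show ?thesis by blast
      qed
      finally show "norm t * H \<le> \<rho> ^ K / 4" .
    qed (use J \<rho> in auto)
    then show False using J by simp
  qed
  ultimately show ?thesis using \<rho> by blast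
qed

section \<open>Rank\<close>

lemma row_eq: "row i A = A $ i"
  by (simp add: row_def vec_lambda_eta)

lemma rows_eq: "rows A = range (\<lambda>i. A $ i)"
  by (auto simp: rows_def row_eq)

lemma det_nonzero_if_rows_span:
  fixes A :: "'a::field^'n^'n"
  assumes "vec.span (rows A) = UNIV"
  shows "det A \<noteq> 0"
  using assms matrix_left_invertible_span_rows_gen[of A] invertible_left_inverse[of A] invertible_det_nz[of A]
  by simp

lemma card_basis:
  fixes E :: "('a::field^'n) set"
  assumes "vec.independent E" "vec.span E = UNIV"
  shows "card E = CARD('n)"
  using assms by (metis vec.dim_eq_card vec.span_UNIV vec_dim_card)

lemma row_combination_in_span:
  "(\<Sum>i\<in>S. c i *s A $ r i) \<in> vec.span (rows A)"
  by (intro vec.span_sum vec.span_scale vec.span_base) (simp add: rows_eq)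

text \<open>Minors are encoded as full-size determinants in which the rows outside \<open>I\<close>
  are arbitrary. This needs no submatrix types and no choice of columns: independent rows are
  completed to a basis by a suitable \<open>c\<close>. As conditions on the entries of
  \<open>A\<close> these determinants are polynomial.\<close>

lemma rank_le_iff_minors:
  fixes A :: "'a::field^'n^'n"
  shows "rank A \<le> r \<longleftrightarrow> (\<forall>I c. card I = Suc r \<longrightarrow> det (\<chi> i. if i \<in> I then A $ i else c i) = 0)"
proof (intro iffI allI impI)
  fix I :: "'n set" and c :: "'n \<Rightarrow> 'a^'n" assume "rank A \<le> r" and I: "card I = Suc r"
  define B where "B = (\<chi> i. if i \<in> I then A $ i else c i)"
  show "det (\<chi> i. if i \<in> I then A $ i else c i) = 0"
  proof (rule ccontr)
    assume "\<not> ?thesis"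
    then have det: "det B \<noteq> 0" by (simp add: B_def)
    have inj: "inj (\<lambda>i. B $ i)"
    proof (rule injI, rule ccontr)
      fix i j assume "B $ i = B $ j" "i \<noteq> j"
      then have "det B = 0" using det_identical_rows[of i j B] by (simp add: row_eq)
      then show False using det by blast
    qed
    have indep: "vec.independent (rows B)" using det det_dependent_rows by blast
    have sub: "(\<lambda>i. B $ i) ` I \<subseteq> rows A" by (auto simp: rows_eq B_def)
    have "vec.independent ((\<lambda>i. B $ i) ` I)"
      using indep by (rule vec.independent_mono) (auto simp: rows_eq)
    then have "card ((\<lambda>i. B $ i) ` I) \<le> rank A"
      unfolding row_rank_def_gen using sub vec.independent_card_le_dim by blast
    moreover have "card ((\<lambda>i. B $ i) ` I) = Suc r"
      using I by (simp add: card_image inj_on_subset[OF inj])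
    ultimately show False using \<open>rank A \<le> r\<close> by simp
  qed
next
  assume minors: "\<forall>I c. card I = Suc r \<longrightarrow> det (\<chi> i. if i \<in> I then A $ i else c i) = 0"
  show "rank A \<le> r"
  proof (rule ccontr)
    assume "\<not> rank A \<le> r"
    obtain S where S: "S \<subseteq> rows A" "vec.independent S" "card S = rank A"
      using vec.basis_exists[of "rows A"] by (metis row_rank_def_gen)
    have "Suc r \<le> card S" using S \<open>\<not> rank A \<le> r\<close> by simp
    then obtain T where T: "T \<subseteq> S" "card T = Suc r" "finite T"
      using obtain_subset_with_card_n by blast
    have indT: "vec.independent T" using S T vec.independent_mono by blast
    obtain I where I: "I \<subseteq> UNIV" "inj_on (\<lambda>i. A $ i) I" "(\<lambda>i. A $ i) ` I = T"
      using T S subset_image_inj[of T "\<lambda>i. A $ i" UNIV] by (auto simp: rows_eq)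
    have cardI: "card I = Suc r" using I T card_image by fastforce
    \<comment> \<open>The basis vectors outside \<open>T\<close> fill the rows outside
      \<open>I\<close>.\<close>
    define E where "E = vec.extend_basis T"
    have E: "T \<subseteq> E" "vec.independent E" "vec.span E = UNIV"
      using indT by (simp_all add: E_def vec.extend_basis_superset vec.independent_extend_basis)
    have finE: "finite E" using E(2) vec.finiteI_independent by blast
    have "card E = CARD('n)"
      using E card_basis by blast
    then have "card (- I) = card (E - T)"
      using E T cardI finE by (simp add: card_Diff_subset Compl_eq_Diff_UNIV)
    then obtain c where c: "bij_betw c (- I) (E - T)"
      using finE finite_same_card_bij[of "- I" "E - T"] by auto
    define B where "B = (\<chi> i. if i \<in> I then A $ i else c i)"
    have "E \<subseteq> rows B"
    proof
      fix e assume "e \<in> E"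
      then have "e \<in> (\<lambda>i. A $ i) ` I \<or> e \<in> c ` (- I)"
        using I c by (auto simp: bij_betw_def)
      then show "e \<in> rows B" by (auto simp: rows_eq B_def)
    qed
    then have "vec.span (rows B) = UNIV"
      using E vec.span_mono by blast
    then have "det B \<noteq> 0" by (rule det_nonzero_if_rows_span)
    then show False using minors cardI by (auto simp: B_def)
  qed
qed

lemma rank_mult_le_left:
  fixes A :: "'a::field^'n^'m" and B :: "'a^'k^'n"
  shows "rank (A ** B) \<le> rank A"
proof -
  have "(A ** B) $ i = A $ i v* B" for i
    by (simp add: matrix_matrix_mult_def vector_matrix_mult_def vec_eq_iff mult.commute)
  then have "rows (A ** B) = (\<lambda>v. v v* B) ` rows A"
    by (auto simp: rows_eq)
  moreover have "Vector_Spaces.linear (*s) (*s) (\<lambda>v. v v* B)"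
    unfolding transpose_matrix_vector[symmetric] by (rule matrix_vector_mul_linear_gen)
  ultimately show ?thesis
    unfolding row_rank_def_gen using vec.dim_image_le by metis
qed

lemma rank_mult_le_right:
  fixes A :: "'a::field^'n^'m" and B :: "'a^'k^'n"
  shows "rank (A ** B) \<le> rank B"
proof -
  have "(A ** B) $ i = (\<Sum>k\<in>UNIV. A $ i $ k *s B $ k)" for i
    by (simp add: matrix_matrix_mult_def vec_eq_iff sum_component)
  then have "rows (A ** B) \<subseteq> vec.span (rows B)"
    unfolding rows_eq[of "A ** B"] by (auto intro: row_combination_in_span)
  then show ?thesis
    unfolding row_rank_def_gen by (metis vec.dim_mono)
qed

text \<open>\<open>rank\<close> is the dimension of the row span. For a skew matrix the columns are
  the negated rows, so the image lies in that span and the inequality needs no comparison of row and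
  column rank.\<close>

lemma dim_kernel_skew:
  fixes M :: "'a::field^'n^'n"
  assumes skew: "\<And>i j. M $ i $ j = - M $ j $ i"
  shows "CARD('n) \<le> rank M + vec.dim {v. M *v v = 0}"
proof -
  define K where "K = {v. M *v v = 0}"
  obtain B where B: "B \<subseteq> K" "vec.independent B" "K \<subseteq> vec.span B" "card B = vec.dim K"
    using vec.basis_exists by blast
  define E where "E = vec.extend_basis B"
  have E: "B \<subseteq> E" "vec.independent E" "vec.span E = UNIV"
    using B by (simp_all add: E_def vec.extend_basis_superset vec.independent_extend_basis)
  have finE: "finite E" using E(2) vec.finiteI_independent by blast
  have cardE: "card E = CARD('n)"
    using E card_basis by blast
  have lin: "Vector_Spaces.linear (*s) (*s) ((*v) M)" by simp
  have range: "M *v v \<in> vec.span (rows M)" for v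
  proof -
    have "column i M = - (M $ i)" for i
      by (subst vec_eq_iff) (auto simp: column_def intro: skew)
    then have "M *v v = (\<Sum>i\<in>UNIV. - v $ i *s M $ i)"
      by (simp add: matrix_mult_sum)
    then show ?thesis
      by (simp only: row_combination_in_span)
  qed
  \<comment> \<open>A common vector is represented by \<open>B\<close> and also by
    \<open>E - B\<close>, so all its coefficients vanish. Thus \<open>M\<close> is injective on a
    complement of its kernel.\<close>
  have "K \<inter> vec.span (E - B) \<subseteq> {0}"
  proof
    fix v assume v: "v \<in> K \<inter> vec.span (E - B)"
    then have v: "v \<in> vec.span B" "v \<in> vec.span (E - B)" using B by auto
    have rep: "vec.representation E v = vec.representation B v"
      "vec.representation E v = vec.representation (E - B) v"
      using v E by (auto intro: vec.representation_extend)
    have "vec.representation E v b = 0" for b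
      using vec.representation_ne_zero[of B v b] vec.representation_ne_zero[of "E - B" v b] rep by (metis DiffD2)
    then show "v \<in> {0}"
      using vec.sum_nonzero_representation_eq[OF E(2), of v] E by simp
  qed
  then have inj: "inj_on ((*v) M) (vec.span (E - B))"
    by (subst vec.linear_inj_on_iff_eq_0[OF lin vec.subspace_span]) (auto simp: K_def)
  have "vec.independent ((*v) M ` (E - B))"
    using vec.independent_mono[OF E(2), of "E - B"] inj
    by (intro vec.linear_independent_injective_image[OF lin]) auto
  moreover have "(*v) M ` (E - B) \<subseteq> vec.span (rows M)" using range by auto
  ultimately have "card ((*v) M ` (E - B)) \<le> vec.dim (vec.span (rows M))"
    using vec.independent_card_le_dim by blast
  then have "card ((*v) M ` (E - B)) \<le> rank M"
    by (simp add: row_rank_def_gen)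
  moreover have "card ((*v) M ` (E - B)) = card (E - B)"
    using inj by (intro card_image inj_on_subset[OF inj]) (auto intro: vec.span_base)
  moreover have "card (E - B) = CARD('n) - vec.dim K"
    using E B finE cardE by (simp add: card_Diff_subset finite_subset)
  ultimately show ?thesis by (simp add: K_def)
qed

lemma sum_sum_type:
  fixes f :: "'a::finite + 'b::finite \<Rightarrow> 'c::comm_monoid_add"
  shows "(\<Sum>i\<in>UNIV. f i) = (\<Sum>i\<in>UNIV. f (Inl i)) + (\<Sum>i\<in>UNIV. f (Inr i))"
  using sum.Plus[of UNIV UNIV f] by simp

text \<open>The columns of \<open>X\<close> express the Schur complement of the block \<open>'p\<close>; being skew of size three,
  it vanishes as soon as three of its entries do.\<close>

lemma rank_le_if_Schur_zero:
  fixes M :: "complex^('p::finite + 3)^('p + 3)"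
  assumes skew: "\<And>i j. M $ i $ j = - M $ j $ i"
    and X: "\<And>r k. M $ Inl r $ Inr k + (\<Sum>p\<in>UNIV. M $ Inl r $ Inl p * X k p) = 0"
    and s: "\<And>k. M $ Inr (k + 1) $ Inr (k + 2) + (\<Sum>p\<in>UNIV. M $ Inr (k + 1) $ Inl p * X (k + 2) p) = 0"
  shows "rank M \<le> CARD('p)"
proof -
  define s where "s i j = M $ Inr i $ Inr j + (\<Sum>p\<in>UNIV. M $ Inr i $ Inl p * X j p)" for i j
  \<comment> \<open>Inserting the equations for \<open>X\<close> once more turns the correction into
    the skew form of the first block, evaluated on two columns of \<open>X\<close>. In this shape
    the skewness of \<open>s\<close> is visible.\<close>
  have s_alt: "s i j = M $ Inr i $ Inr j + (\<Sum>p\<in>UNIV. \<Sum>q\<in>UNIV. M $ Inl p $ Inl q * X i q * X j p)" for i j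
  proof -
    have "M $ Inr i $ Inl p = (\<Sum>q\<in>UNIV. M $ Inl p $ Inl q * X i q)" for p
      using X[of p i] skew[of "Inr i" "Inl p"] by (simp add: add_eq_0_iff)
    then show ?thesis by (simp add: s_def sum_distrib_right)
  qed
  have s_skew: "s i j = - s j i" for i j
  proof -
    have "(\<Sum>p\<in>UNIV. \<Sum>q\<in>UNIV. M $ Inl p $ Inl q * X i q * X j p) =
        - (\<Sum>p\<in>UNIV. \<Sum>q\<in>UNIV. M $ Inl p $ Inl q * X j q * X i p)"
      by (subst sum.swap, simp add: sum_negf[symmetric])
        (intro sum.cong refl, metis (no_types, lifting) mult.assoc mult.commute mult_minus_left skew)
    then show ?thesis using skew[of "Inr i" "Inr j"] by (simp add: s_alt)
  qed
  have "s (k + 1) (k + 2) = 0" for k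
    using s[of k] by (simp add: s_def)
  \<comment> \<open>Arithmetic in the type \<open>3\<close> is cyclic, so
    \<open>(k + 1, k + 2)\<close> runs through (2, 3), (3, 1) and (1, 2).\<close>
  moreover have "(1::3) + 1 = 2" "(1::3) + 2 = 3" "(2::3) + 1 = 3" "(2::3) + 2 = 1" "(3::3) + 1 = 1" "(3::3) + 2 = 2"
    by simp_all
  ultimately have "s 2 3 = 0" "s 3 1 = 0" "s 1 2 = 0"
    by metis+
  moreover have "s i i = 0" for i using s_skew[of i i] by simp
  ultimately have s0: "s i j = 0" for i j
    using exhaust_3[of i] exhaust_3[of j] s_skew[of 3 2] s_skew[of 1 3] s_skew[of 2 1] by auto
  \<comment> \<open>With vanishing Schur complement, the last three rows are combinations of the
    rows of the first block.\<close>
  have row: "M $ Inr j = (\<Sum>p\<in>UNIV. - X j p *s M $ Inl p)" for j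
  proof (subst vec_eq_iff, intro allI)
    fix a
    have "M $ Inr j $ a = - M $ a $ Inr j" by (rule skew)
    also have "\<dots> = (\<Sum>p\<in>UNIV. M $ a $ Inl p * X j p)"
      using X s0[of _ j] by (cases a) (auto simp: s_def add_eq_0_iff2)
    also have "\<dots> = (\<Sum>p\<in>UNIV. - X j p * M $ Inl p $ a)"
      by (intro sum.cong refl) (subst skew[of a], simp)
    finally show "M $ Inr j $ a = (\<Sum>p\<in>UNIV. - X j p *s M $ Inl p) $ a"
      by (simp add: sum_component)
  qed
  have "M $ i \<in> vec.span (range (\<lambda>p. M $ Inl p))" for i
  proof (cases i)
    case (Inl p)
    then show ?thesis by (simp add: vec.span_base)
  next
    case (Inr j)
    then show ?thesis
      unfolding Inr row by (intro vec.span_sum vec.span_scale vec.span_base) simp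
  qed
  then have "rows M \<subseteq> vec.span (range (\<lambda>p. M $ Inl p))"
    by (auto simp: rows_eq)
  then have "rank M \<le> card (range (\<lambda>p. M $ Inl p))"
    unfolding row_rank_def_gen by (intro vec.dim_le_card) auto
  also have "\<dots> \<le> CARD('p)" by (rule card_image_le) simp
  finally show ?thesis .
qed

text \<open>Substitute \<open>s = 1 / t\<close>: up to a power of \<open>t\<close> the determinant
  is a polynomial in \<open>s\<close> with value \<open>det N\<close> at zero. It has finitely many
  roots, and their inverses stay away from zero.\<close>

lemma det_pencil_nonzero:
  fixes M N :: "complex^'n^'n"
  assumes "det N \<noteq> 0"
  shows "\<exists>\<delta>>0. \<forall>t. t \<noteq> 0 \<and> norm t < \<delta> \<longrightarrow> det (\<chi> i j. M $ i $ j + t * N $ i $ j) \<noteq> 0"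
proof -
  have poly: "\<exists>p. f = poly p" if "f \<in> polynomials {\<lambda>s. s}" for f :: "complex \<Rightarrow> complex"
    using that
  proof induction
    case (coordinate c)
    then show ?case by (intro exI[of _ "[:0, 1:]"]) auto
  next
    case (const a)
    show ?case by (intro exI[of _ "[:a:]"]) auto
  next
    case (add f g)
    then obtain p q where "f = poly p" "g = poly q" by blast
    then show ?case by (intro exI[of _ "p + q"]) auto
  next
    case (mult f g)
    then obtain p q where "f = poly p" "g = poly q" by blast
    then show ?case by (intro exI[of _ "p * q"]) auto
  qed
  have "(\<lambda>s. det (\<chi> i j. s * M $ i $ j + N $ i $ j)) \<in> polynomials {\<lambda>s. s}"
    by (rule polynomials_det, simp, intro polynomials_intros polynomials.coordinate, simp)
  from poly[OF this] obtain p where "(\<lambda>s. det (\<chi> i j. s * M $ i $ j + N $ i $ j)) = poly p" ..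
  from fun_cong[OF this] have p: "det (\<chi> i j. s * M $ i $ j + N $ i $ j) = poly p s" for s .
  have "poly p 0 \<noteq> 0" using assms by (simp flip: p)
  then have "p \<noteq> 0" by auto
  then have "finite ((\<lambda>s. 1 / s) ` {s. poly p s = 0})" using poly_roots_finite by auto
  then obtain \<delta> where \<delta>: "\<delta> > 0" "\<And>x. x \<in> (\<lambda>s. 1 / s) ` {s. poly p s = 0} \<Longrightarrow> x \<noteq> 0 \<Longrightarrow> \<delta> \<le> dist 0 x"
    using finite_set_avoid[of _ 0] by metis
  have "det (\<chi> i j. M $ i $ j + t * N $ i $ j) \<noteq> 0" if t: "t \<noteq> 0" "norm t < \<delta>" for t
  proof -
    have "poly p (1 / t) \<noteq> 0"
    proof
      assume "poly p (1 / t) = 0"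
      then have "t \<in> (\<lambda>s. 1 / s) ` {s. poly p s = 0}"
        by (auto simp: image_iff intro!: exI[of _ "1 / t"])
      then show False using \<delta>(2)[of t] t by simp
    qed
    have "(\<chi> i j. M $ i $ j + t * N $ i $ j) = (\<chi> i. t *s (\<chi> j. (1 / t) * M $ i $ j + N $ i $ j))"
      using t by (simp add: vec_eq_iff field_simps)
    then have "det (\<chi> i j. M $ i $ j + t * N $ i $ j) = (\<Prod>i\<in>(UNIV::'n set). t) * poly p (1 / t)"
      unfolding p[symmetric] by (simp only: det_rows_mul)
    then show ?thesis using \<open>poly p (1 / t) \<noteq> 0\<close> t by simp
  qed
  then show ?thesis using \<delta>(1) by blast
qed

section \<open>Derivatives and continuity of polynomial functions\<close>

lemma polynomials_has_derivative:
  fixes f :: "complex^'m \<Rightarrow> complex"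
  assumes "f \<in> polynomials vec_coords"
  shows "\<exists>D. (f has_derivative D) (at x)"
  using assms
proof induction
  case (coordinate c)
  then obtain i where "c = (\<lambda>x. x $ i)" by (auto simp: vec_coords_def)
  then show ?case
    using bounded_linear_imp_has_derivative[OF bounded_linear_vec_nth[of i]] by blast
next
  case (const a)
  show ?case by (blast intro: has_derivative_const)
next
  case (add f g)
  then show ?case by (blast intro: has_derivative_add)
next
  case (mult f g)
  then show ?case by (blast intro: has_derivative_mult)
qed

lemma polynomials_continuous:
  fixes f :: "complex^'m \<Rightarrow> complex"
  assumes "f \<in> polynomials vec_coords"
  shows "continuous_on S f"
  using assms
  by induction (auto simp: vec_coords_def intro!: continuous_intros)

lemma has_derivative_vec:
  fixes f :: "'a::real_normed_vector \<Rightarrow> complex^'n"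
  assumes "\<And>k. ((\<lambda>u. f u $ k) has_derivative (\<lambda>h. f' h $ k)) (at x)"
  shows "(f has_derivative f') (at x)"
proof -
  have "((\<lambda>u. f u \<bullet> b) has_derivative (\<lambda>h. f' h \<bullet> b)) (at x within UNIV)" if b: "b \<in> Basis" for b
  proof -
    obtain k c where "b = axis k c" using b unfolding Basis_vec_def by blast
    then show ?thesis using has_derivative_inner_left[OF assms[of k], of c] by (simp add: inner_axis)
  qed
  then show ?thesis using has_derivative_componentwise_within[of f f' x UNIV] by simp
qed

lemma has_derivative_mult_vanishing:
  fixes f g :: "'a::real_normed_vector \<Rightarrow> complex"
  assumes "(f has_derivative D) (at x)" "(g has_derivative E) (at x)" "f x = 0" "g x = 0"
  shows "((\<lambda>u. f u * g u) has_derivative (\<lambda>_. 0)) (at x)"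
  using has_derivative_mult[OF assms(1,2)] assms(3,4) by simp

section \<open>Families of skew matrices\<close>

text \<open>Up to sign, the matrix of the cross product with \<open>v\<close>, in cyclic
  indices.\<close>

definition skew3 :: "(3 \<Rightarrow> complex) \<Rightarrow> 3 \<Rightarrow> 3 \<Rightarrow> complex" where
  "skew3 v i j = (if j = i + 1 then v (i + 2) else if i = j + 1 then - v (j + 2) else 0)"

lemma norm_axis_complex: "norm (axis i (s :: complex) :: complex^'n) = norm s"
  by (simp add: norm_eq_sqrt_inner inner_axis_axis)

lemma skew3_skew: "skew3 v i j = - skew3 v j i"
  using exhaust_3[of i] exhaust_3[of j] by (auto simp: skew3_def)

lemma skew3_entry: "skew3 v (k + 1) (k + 2) = v k"
proof -
  have "v 4 = v 1" "v 5 = v 2" "v 6 = v 3" by (rule arg_cong[of _ _ v], simp)+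
  then show ?thesis using exhaust_3[of k] by (auto simp: skew3_def)
qed

definition symplectic :: "complex^('q::finite + 'q)^('q + 'q)" where
  "symplectic = (\<chi> i j. case (i, j) of
     (Inl a, Inr b) \<Rightarrow> if a = b then 1 else 0 | (Inr a, Inl b) \<Rightarrow> if a = b then - 1 else 0 | _ \<Rightarrow> 0)"

lemma symplectic_skew: "symplectic $ i $ j = - symplectic $ j $ i"
  by (auto simp: symplectic_def split: sum.split)

lemma det_symplectic: "det (symplectic :: complex^('q::finite + 'q)^('q + 'q)) \<noteq> 0"
proof -
  have "x = 0" if x: "symplectic *v x = 0" for x :: "complex^('q + 'q)"
  proof (subst vec_eq_iff, intro allI)
    fix i
    have "(symplectic *v x) $ Inl a = x $ Inr a" "(symplectic *v x) $ Inr a = - x $ Inl a" for a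
      by (simp_all add: matrix_vector_mult_def symplectic_def sum_sum_type if_distrib[of "\<lambda>c. c * _"]
          sum.delta cong: if_cong)
    then have "x $ Inr a = 0" "x $ Inl a = 0" for a using x by simp_all
    then show "x $ i = 0 $ i" by (cases i) simp_all
  qed
  then show ?thesis
    using matrix_left_invertible_ker[of "symplectic :: complex^('q + 'q)^('q + 'q)"] invertible_left_inverse invertible_det_nz
    by metis
qed

text \<open>The family \<open>A0 + \<Sum> u $ m * A1 m\<close> is perturbed by \<open>t\<close> times a family which is symplectic on the first
  block and generic on the second; then for \<open>t \<noteq> 0\<close> the rank condition at the origin becomes
  transverse.\<close>

locale skew_family =
  fixes A0 :: "complex^(('q::finite + 'q) + 3)^(('q + 'q) + 3)"
    and A1 :: "3 + 1 \<Rightarrow> complex^(('q + 'q) + 3)^(('q + 'q) + 3)"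
  assumes A0_skew: "A0 $ i $ j = - A0 $ j $ i"
    and A1_skew: "A1 m $ i $ j = - A1 m $ j $ i"
    and A0_kernel: "A0 $ i $ Inr k = 0"
begin

definition A :: "complex^(3 + 1) \<Rightarrow> complex^(('q + 'q) + 3)^(('q + 'q) + 3)" where
  "A u = (\<chi> i j. A0 $ i $ j + (\<Sum>m\<in>UNIV. u $ m * A1 m $ i $ j))"

text \<open>The first block is constant in \<open>u\<close>, so that it can repair the block at the
  origin. The second is linear, and the directions \<open>Inl k\<close> are placed such that the
  \<open>k\<close>th Schur entry gains the linear term \<open>t * u $ Inl k\<close>. The remaining
  direction \<open>Inr 1\<close> is left free for the curve.\<close>

definition C :: "complex^(3 + 1) \<Rightarrow> complex^(('q + 'q) + 3)^(('q + 'q) + 3)" where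
  "C u = (\<chi> i j. case (i, j) of (Inl p, Inl q) \<Rightarrow> symplectic $ p $ q
     | (Inr a, Inr b) \<Rightarrow> skew3 (\<lambda>k. u $ Inl k) a b | _ \<Rightarrow> 0)"

definition M :: "complex \<Rightarrow> complex^(3 + 1) \<Rightarrow> complex^(('q + 'q) + 3)^(('q + 'q) + 3)" where
  "M t u = (\<chi> i j. A u $ i $ j + t * C u $ i $ j)"

lemma M_skew: "M t u $ i $ j = - M t u $ j $ i"
proof -
  have "A u $ i $ j = - A u $ j $ i"
    using A0_skew[of i j] A1_skew[of _ i j] by (simp add: A_def sum_negf)
  moreover have "C u $ i $ j = - C u $ j $ i"
    by (cases i; cases j) (auto simp: C_def intro: symplectic_skew skew3_skew)
  ultimately show ?thesis by (simp add: M_def)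
qed

lemma M_zero: "M 0 u = A u"
  by (simp add: M_def vec_eq_iff)

lemma M_pair_polynomials: "(\<lambda>z. M (snd z) (fst z) $ i $ j) \<in> polynomials pair_coords"
proof -
  have "(\<lambda>z. skew3 (\<lambda>k. fst z $ Inl k) a b) \<in> polynomials pair_coords" for a b :: 3
    unfolding skew3_def
    by (cases "b = a + 1"; cases "a = b + 1")
      (simp_all add: pair_coord_polynomials polynomials.const polynomials_uminus)
  then have "(\<lambda>z. C (fst z) $ i $ j) \<in> polynomials pair_coords"
    by (cases i; cases j) (simp_all add: C_def polynomials.const)
  then show ?thesis
    unfolding M_def A_def by simp (intro polynomials_intros pair_coord_polynomials)
qed

lemma M_polynomials: "(\<lambda>u. M t u $ i $ j) \<in> polynomials vec_coords"
  using polynomials_at_parameter[OF M_pair_polynomials, of t i j] by simp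

section \<open>The Schur complement of the first block\<close>

definition P :: "complex \<Rightarrow> complex^(3 + 1) \<Rightarrow> complex^('q + 'q)^('q + 'q)" where
  "P t u = (\<chi> r q. M t u $ Inl r $ Inl q)"

text \<open>The numerators in Cramer's rule; they make \<open>X\<close> a quotient of polynomials,
  hence continuous and differentiable where \<open>det (P t u)\<close> is nonzero.\<close>

definition X_num :: "complex \<Rightarrow> complex^(3 + 1) \<Rightarrow> 3 \<Rightarrow> 'q + 'q \<Rightarrow> complex" where
  "X_num t u k p = det (\<chi> r q. if q = p then - M t u $ Inl r $ Inr k else M t u $ Inl r $ Inl q)"

definition X :: "complex \<Rightarrow> complex^(3 + 1) \<Rightarrow> 3 \<Rightarrow> 'q + 'q \<Rightarrow> complex" where
  "X t u k p = X_num t u k p / det (P t u)"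

lemma det_P_polynomials: "(\<lambda>u. det (P t u)) \<in> polynomials vec_coords"
  unfolding P_def by (rule polynomials_det) (simp add: M_polynomials)

lemma X_num_polynomials: "(\<lambda>u. X_num t u k p) \<in> polynomials vec_coords"
  unfolding X_num_def
proof (rule polynomials_det)
  fix i j
  show "(\<lambda>u. (\<chi> r q. if q = p then - M t u $ Inl r $ Inr k else M t u $ Inl r $ Inl q) $ i $ j)
      \<in> polynomials vec_coords"
    by (cases "j = p") (simp_all add: M_polynomials polynomials_uminus)
qed

lemma X_solves:
  assumes "det (P t u) \<noteq> 0"
  shows "M t u $ Inl r $ Inr k + (\<Sum>p\<in>UNIV. M t u $ Inl r $ Inl p * X t u k p) = 0"
proof -
  have "P t u *v (\<chi> p. X t u k p) = (\<chi> r. - M t u $ Inl r $ Inr k)"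
    unfolding cramer[OF assms] X_def X_num_def by (simp add: P_def cong: if_cong)
  then have "(P t u *v (\<chi> p. X t u k p)) $ r = - M t u $ Inl r $ Inr k"
    by simp
  then show ?thesis by (simp add: matrix_vector_mult_def P_def)
qed

text \<open>The three Schur entries, completed by a multiple of the fourth coordinate to a map
  between spaces of equal dimension. The factor \<open>t\<close> in the last component makes the
  derivative at the origin a pencil with the identity.\<close>

definition f :: "complex \<Rightarrow> complex^(3 + 1) \<Rightarrow> complex^(3 + 1)" where
  "f t u = (\<chi> m. case m of
     Inl k \<Rightarrow> M t u $ Inr (k + 1) $ Inr (k + 2) + (\<Sum>p\<in>UNIV. M t u $ Inr (k + 1) $ Inl p * X t u (k + 2) p)
   | Inr _ \<Rightarrow> t * u $ m)"

lemma rank_le_if_f_zero: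
  assumes "det (P t u) \<noteq> 0" "\<And>k. f t u $ Inl k = 0"
  shows "rank (M t u) \<le> CARD('q + 'q)"
  using assms(2) by (intro rank_le_if_Schur_zero[OF M_skew X_solves[OF assms(1)]]) (simp add: f_def)

definition D0 :: "complex^(3 + 1)^(3 + 1)" where
  "D0 = (\<chi> m m'. case m of Inl k \<Rightarrow> A1 m' $ Inr (k + 1) $ Inr (k + 2) | Inr _ \<Rightarrow> 0)"

definition D :: "complex \<Rightarrow> complex^(3 + 1)^(3 + 1)" where
  "D t = (\<chi> m m'. D0 $ m $ m' + t * mat 1 $ m $ m')"

lemma D_mult: "(D t *v u) $ m = (\<Sum>m'\<in>UNIV. D0 $ m $ m' * u $ m') + t * u $ m"
  by (simp add: D_def matrix_vector_mult_def distrib_right sum.distrib mat_def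
      if_distrib[of "\<lambda>c. _ * c"] if_distrib[of "\<lambda>c. c * _"] sum.delta cong: if_cong)

lemma f_eq:
  "f t u $ m = (D t *v u) $ m +
     (case m of Inl k \<Rightarrow> (\<Sum>p\<in>UNIV. M t u $ Inr (k + 1) $ Inl p * X t u (k + 2) p) | Inr _ \<Rightarrow> 0)"
proof (cases m)
  case (Inl k)
  have "M t u $ Inr (k + 1) $ Inr (k + 2) = (D t *v u) $ m"
    unfolding D_mult by (simp add: Inl M_def A_def C_def D0_def A0_kernel skew3_entry mult.commute)
  then show ?thesis by (simp add: f_def Inl)
next
  case (Inr x)
  then show ?thesis by (simp add: f_def D_mult D0_def)
qed

text \<open>By \<open>A0_kernel\<close> the off-diagonal blocks vanish at the origin for every
  \<open>t\<close>, and with them \<open>X\<close>. The products in the Schur entries thus vanish to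
  second order, and only the linear part remains.\<close>

lemma f_has_derivative:
  assumes P: "det (P t 0) \<noteq> 0"
  shows "(f t has_derivative (*v) (D t)) (at 0)"
proof (rule has_derivative_vec)
  fix m
  have lin: "((\<lambda>u. (D t *v u) $ m) has_derivative (\<lambda>u. (D t *v u) $ m)) (at 0)"
    by (intro bounded_linear_imp_has_derivative bounded_linear_compose[OF bounded_linear_vec_nth]
        matrix_vector_mul_bounded_linear)
  have prod: "((\<lambda>u. M t u $ Inr i $ Inl p * X t u j p) has_derivative (\<lambda>_. 0)) (at 0)" for i j p
  proof -
    obtain E where E: "((\<lambda>u. M t u $ Inr i $ Inl p) has_derivative E) (at 0)"
      using polynomials_has_derivative[OF M_polynomials] by blast
    obtain F where F: "((\<lambda>u. X_num t u j p) has_derivative F) (at 0)"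
      using polynomials_has_derivative[OF X_num_polynomials] by blast
    obtain G where G: "((\<lambda>u. det (P t u)) has_derivative G) (at 0)"
      using polynomials_has_derivative[OF det_P_polynomials] by blast
    have kernel: "M t 0 $ i $ Inr k = 0" if "\<forall>a. i \<noteq> Inr a" for i k
      using that by (cases i) (simp_all add: M_def A_def C_def A0_kernel)
    have "M t 0 $ Inr i $ Inl p = 0"
      using M_skew[of t 0 "Inr i" "Inl p"] kernel[of "Inl p" i] by simp
    moreover have "X_num t 0 j p = 0"
    proof -
      have "column p (\<chi> r q. if q = p then - M t 0 $ Inl r $ Inr j else M t 0 $ Inl r $ Inl q) = 0"
        by (simp add: column_def vec_eq_iff kernel)
      then show ?thesis unfolding X_num_def by (rule det_zero_column(2))
    qed
    ultimately show ?thesis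
      using has_derivative_mult_vanishing[OF E has_derivative_divide[OF F G P]] by (simp add: X_def)
  qed
  show "((\<lambda>u. f t u $ m) has_derivative (\<lambda>h. (D t *v h) $ m)) (at 0)"
  proof (cases m)
    case (Inl k)
    have "((\<lambda>u. (D t *v u) $ m + (\<Sum>p\<in>UNIV. M t u $ Inr (k + 1) $ Inl p * X t u (k + 2) p))
        has_derivative (\<lambda>h. (D t *v h) $ m + (\<Sum>p\<in>(UNIV :: ('q + 'q) set). 0))) (at 0)"
      by (intro has_derivative_add lin has_derivative_sum prod)
    then show ?thesis by (simp add: f_eq Inl)
  next
    case (Inr x)
    then show ?thesis using lin by (simp add: f_eq)
  qed
qed

text \<open>An open mapping theorem, which uses the derivative at one point only, takes the place of
  the implicit function theorem: the image of every small ball contains a ball, in particular a disc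
  on the last axis, over which the three Schur entries vanish.\<close>

lemma infinite_rank_le:
  assumes P: "det (P t 0) \<noteq> 0" and D: "det (D t) \<noteq> 0" and "\<rho> > 0"
  shows "infinite {u. norm u < \<rho> \<and> rank (M t u) \<le> CARD('q + 'q)}"
proof
  assume fin: "finite {u. norm u < \<rho> \<and> rank (M t u) \<le> CARD('q + 'q)}"
  define S where "S = {u. det (P t u) \<noteq> 0}"
  have "open S"
    unfolding S_def using polynomials_continuous[OF det_P_polynomials]
    by (intro open_Collect_neq) (auto intro: continuous_intros)
  note cont = polynomials_continuous[OF M_polynomials] polynomials_continuous[OF X_num_polynomials]
    polynomials_continuous[OF det_P_polynomials]
  have "continuous_on S (f t)"
    unfolding f_def X_def
  proof (rule continuous_on_vec_lambda)
    fix m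
    show "continuous_on S (\<lambda>u. case m of
        Inl k \<Rightarrow> M t u $ Inr (k + 1) $ Inr (k + 2) +
          (\<Sum>p\<in>UNIV. M t u $ Inr (k + 1) $ Inl p * (X_num t u (k + 2) p / det (P t u)))
      | Inr _ \<Rightarrow> t * u $ m)"
      by (cases m) (auto simp: S_def intro!: continuous_on_add continuous_on_sum continuous_on_mult
          continuous_on_divide continuous_on_const continuous_on_id continuous_on_component cont)
  qed
  obtain D' where D': "D t ** D' = mat 1"
    using D invertible_det_nz[of "D t"] by (auto simp: invertible_def)
  have f0: "f t 0 = 0"
  proof (subst vec_eq_iff, intro allI)
    fix m
    have "M t 0 $ Inr i $ Inl p = 0" for i p
      using A0_skew[of "Inr i" "Inl p"] by (simp add: M_def A_def C_def A0_kernel)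
    then show "f t 0 $ m = 0 $ m" by (simp add: f_eq matrix_vector_mult_def split: sum.split)
  qed
  have "f t 0 \<in> interior (f t ` (ball 0 \<rho> \<inter> S))"
  proof (rule sussmann_open_mapping[OF \<open>open S\<close> \<open>continuous_on S (f t)\<close> _ f_has_derivative[OF P]])
    show "bounded_linear ((*v) D')" by simp
    show "(*v) (D t) \<circ> (*v) D' = id"
      by (simp add: fun_eq_iff matrix_vector_mul_assoc D')
    show "0 \<in> interior (ball 0 \<rho> \<inter> S)"
      using \<open>open S\<close> P \<open>\<rho> > 0\<close> by (simp add: interior_open S_def open_Int)
  qed (use P in \<open>auto simp: S_def\<close>)
  then obtain \<epsilon> where \<epsilon>: "\<epsilon> > 0" "ball 0 \<epsilon> \<subseteq> f t ` (ball 0 \<rho> \<inter> S)"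
    by (auto simp: f0 mem_interior)
  \<comment> \<open>Distinct points of the disc have distinct preimages, so this disc would be
    finite together with the rank locus.\<close>
  have "(\<lambda>s. axis (Inr 1) s) ` ball 0 \<epsilon> \<subseteq> f t ` {u. norm u < \<rho> \<and> rank (M t u) \<le> CARD('q + 'q)}"
  proof
    fix y :: "complex^(3 + 1)" assume "y \<in> (\<lambda>s. axis (Inr 1) s) ` ball 0 \<epsilon>"
    then obtain s where s: "y = axis (Inr 1) s" "norm s < \<epsilon>" by auto
    then have "y \<in> ball 0 \<epsilon>" by (simp add: norm_axis_complex)
    then obtain u where u: "u \<in> ball 0 \<rho>" "u \<in> S" "y = f t u" using \<epsilon> by blast
    have "rank (M t u) \<le> CARD('q + 'q)"
    proof (rule rank_le_if_f_zero)
      show "det (P t u) \<noteq> 0" using u by (simp add: S_def)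
      show "f t u $ Inl k = 0" for k
        using u(3) s by (simp add: axis_def flip: u(3))
    qed
    then show "y \<in> f t ` {u. norm u < \<rho> \<and> rank (M t u) \<le> CARD('q + 'q)}"
      using u by auto
  qed
  then have "finite ((\<lambda>s. axis (Inr 1) s :: complex^(3 + 1)) ` ball 0 \<epsilon>)"
    using fin finite_surj by blast
  then have "finite (ball 0 \<epsilon> :: complex set)"
    by (rule finite_imageD) (auto simp: inj_on_def axis_eq_axis)
  then show False using \<epsilon>(1) uncountable_ball[of \<epsilon> "0::complex"] countable_finite by blast
qed

text \<open>If the conclusion failed, \<open>finite_zeros_deformation\<close> for the minors and
  \<open>infinite_rank_le\<close> would contradict each other at one small nonzero
  \<open>t\<close>.\<close>

theorem nonisolated_rank_le:
  assumes F: "F \<in> polynomials vec_coords" "F 0 \<noteq> 0"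
  shows "\<exists>u. u \<noteq> 0 \<and> F u \<noteq> 0 \<and> rank (A u) \<le> CARD('q + 'q)"
proof (rule ccontr)
  assume neg: "\<not> ?thesis"
  define r where "r = CARD('q + 'q)"
  define h where "h I c z = det (\<chi> i. if i \<in> I then M (snd z) (fst z) $ i else c i)" for I c z
  define \<G> where "\<G> = {h I c | I c. card I = Suc r}"
  have \<G>: "\<G> \<subseteq> polynomials pair_coords"
    unfolding \<G>_def
  proof clarify
    fix I :: "(('q + 'q) + 3) set" and c :: "('q + 'q) + 3 \<Rightarrow> complex^(('q + 'q) + 3)"
    show "h I c \<in> polynomials pair_coords"
      unfolding h_def[abs_def]
    proof (rule polynomials_det)
      fix i j
      show "(\<lambda>z. (\<chi> i. if i \<in> I then M (snd z) (fst z) $ i else c i) $ i $ j) \<in> polynomials pair_coords"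
        by (cases "i \<in> I") (simp_all add: M_pair_polynomials polynomials.const)
    qed
  qed
  have zeros: "(\<forall>g\<in>\<G>. g (u, t) = 0) \<longleftrightarrow> rank (M t u) \<le> r" for u t
  proof -
    have "(\<forall>g\<in>\<G>. g (u, t) = 0) \<longleftrightarrow> (\<forall>I c. card I = Suc r \<longrightarrow> h I c (u, t) = 0)"
      unfolding \<G>_def by blast
    then show ?thesis by (simp add: h_def rank_le_iff_minors cong: if_cong)
  qed
  have "u = 0" if "\<And>g. g \<in> \<G> \<Longrightarrow> g (u, 0) = 0" "F u \<noteq> 0" for u
    using zeros[of u 0] that neg by (auto simp: M_zero r_def)
  then obtain \<rho> \<delta> where \<rho>: "\<rho> > 0" and \<delta>: "\<delta> > 0"
    "\<And>t. norm t < \<delta> \<Longrightarrow> finite {u. norm u < \<rho> \<and> rank (M t u) \<le> r}"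
    using finite_zeros_deformation[OF \<G> F] unfolding zeros by blast
  obtain \<delta>1 where \<delta>1: "\<delta>1 > 0" "\<And>t. t \<noteq> 0 \<Longrightarrow> norm t < \<delta>1 \<Longrightarrow> det (\<chi> i j. P 0 0 $ i $ j + t * symplectic $ i $ j) \<noteq> 0"
    using det_pencil_nonzero[OF det_symplectic, of "P 0 0"] by blast
  obtain \<delta>2 where \<delta>2: "\<delta>2 > 0" "\<And>t. t \<noteq> 0 \<Longrightarrow> norm t < \<delta>2 \<Longrightarrow> det (D t) \<noteq> 0"
    using det_pencil_nonzero[of "mat 1 :: complex^(3 + 1)^(3 + 1)" D0, folded D_def] by auto
  \<comment> \<open>Below three thresholds: finitely many zeros, an invertible first block at the
    origin, an invertible derivative.\<close>
  define t :: complex where "t = of_real (min \<delta> (min \<delta>1 \<delta>2) / 2)"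
  have norm_t: "norm t = min \<delta> (min \<delta>1 \<delta>2) / 2"
    unfolding t_def norm_of_real using \<delta> \<delta>1 \<delta>2 by simp
  then have t: "t \<noteq> 0" "norm t < \<delta>" "norm t < \<delta>1" "norm t < \<delta>2"
    using \<delta> \<delta>1 \<delta>2 by (auto simp flip: zero_less_norm_iff)
  have "P t 0 = (\<chi> i j. P 0 0 $ i $ j + t * symplectic $ i $ j)"
    by (simp add: P_def M_def A_def C_def vec_eq_iff)
  then have "det (P t 0) \<noteq> 0" using \<delta>1 t by simp
  then have "infinite {u. norm u < \<rho> \<and> rank (M t u) \<le> r}"
    unfolding r_def using \<delta>2(2) t \<rho> by (intro infinite_rank_le) auto
  then show False using \<delta> t by blast
qed

end

section \<open>Trivectors\<close>

lemma linear_functionalD: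
  fixes f :: "complex^'n \<Rightarrow> complex"
  assumes "Vector_Spaces.linear (*s) (*) f"
  shows linear_functional_add: "f (x + y) = f x + f y"
    and linear_functional_scale: "f (c *s x) = c * f x"
    and linear_functional_zero: "f 0 = 0"
    and linear_functional_sum: "f (\<Sum>i\<in>I. g i) = (\<Sum>i\<in>I. f (g i))"
proof -
  show add: "f (x + y) = f x + f y" and scale: "f (c *s x) = c * f x" for x y c
    using assms by (auto simp: Vector_Spaces.linear_iff)
  show zero: "f 0 = 0" using scale[of 0 0] by simp
  show "f (\<Sum>i\<in>I. g i) = (\<Sum>i\<in>I. f (g i))"
    by (induction I rule: infinite_finite_induct) (auto simp: add zero)
qed

locale trivector =
  fixes \<sigma> :: form3
  assumes alternating: "\<sigma> \<in> alternating3"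
begin

lemma linear1: "Vector_Spaces.linear (*s) (*) (\<lambda>u. \<sigma> u v w)"
  and linear2: "Vector_Spaces.linear (*s) (*) (\<lambda>v. \<sigma> u v w)"
  and linear3: "Vector_Spaces.linear (*s) (*) (\<lambda>w. \<sigma> u v w)"
  and alt12: "\<sigma> u u v = 0" and alt23: "\<sigma> u v v = 0" and alt13: "\<sigma> u v u = 0"
  using alternating by (auto simp: alternating3_def)

lemma add1: "\<sigma> (u + u') v w = \<sigma> u v w + \<sigma> u' v w"
  and add2: "\<sigma> u (v + v') w = \<sigma> u v w + \<sigma> u v' w"
  and add3: "\<sigma> u v (w + w') = \<sigma> u v w + \<sigma> u v w'"
  and scale1: "\<sigma> (c *s u) v w = c * \<sigma> u v w"
  and scale2: "\<sigma> u (c *s v) w = c * \<sigma> u v w"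
  and scale3: "\<sigma> u v (c *s w) = c * \<sigma> u v w"
  and sum1: "\<sigma> (\<Sum>i\<in>I. g i) v w = (\<Sum>i\<in>I. \<sigma> (g i) v w)"
  and sum2: "\<sigma> u (\<Sum>i\<in>I. g i) w = (\<Sum>i\<in>I. \<sigma> u (g i) w)"
  and sum3: "\<sigma> u v (\<Sum>i\<in>I. g i) = (\<Sum>i\<in>I. \<sigma> u v (g i))"
    and zero3: "\<sigma> u v 0 = 0"
  using linear_functionalD[OF linear1] linear_functionalD[OF linear2] linear_functionalD[OF linear3] by auto

lemma skew: "\<sigma> u v w = - \<sigma> u w v"
  using alt23[of u "v + w"] unfolding add2 add3 by (simp add: alt23 eq_neg_iff_add_eq_0 add.commute)

definition gram :: "V10 \<Rightarrow> complex^10^10" where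
  "gram x = (\<chi> i j. \<sigma> x (axis i 1) (axis j 1))"

lemma rank_2form_gram: "rank_2form (\<sigma> x) = rank (gram x)"
  by (simp add: rank_2form_def gram_def)

lemma vec_axis_sum: "(v :: V10) = (\<Sum>i\<in>UNIV. v $ i *s axis i 1)"
  by (simp add: basis_expansion)

lemma gram_mult: "(gram x *v v) $ i = \<sigma> x (axis i 1) v"
  by (subst (2) vec_axis_sum[of v]) (simp add: gram_def matrix_vector_mult_def sum3 scale3 mult.commute)

lemma gram_kernel: "gram x *v v = 0 \<longleftrightarrow> (\<forall>w. \<sigma> x w v = 0)"
proof
  assume *: "gram x *v v = 0"
  show "\<forall>w. \<sigma> x w v = 0"
  proof
    fix w
    have "\<sigma> x w v = (\<Sum>i\<in>UNIV. w $ i * (gram x *v v) $ i)"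
      by (subst vec_axis_sum[of w]) (simp add: sum2 scale2 gram_mult)
    then show "\<sigma> x w v = 0" using * by simp
  qed
qed (simp add: vec_eq_iff gram_mult)

lemma gram_skew: "gram x $ i $ j = - gram x $ j $ i"
  by (simp add: gram_def) (rule skew)

lemma gram_polynomials: "(\<lambda>x. gram x $ i $ j) \<in> polynomials vec_coords"
proof -
  have "gram x $ i $ j = (\<Sum>k\<in>UNIV. x $ k * \<sigma> (axis k 1) (axis i 1) (axis j 1))" for x
    by (subst (1) vec_axis_sum[of x]) (simp add: gram_def sum1 scale1)
  then show ?thesis
    by (simp only:) (intro polynomials_intros vec_coord_polynomials)
qed

lemma gram_scale: "gram (t *s x) = (\<chi> i. t *s gram x $ i)"
  by (simp add: gram_def vec_eq_iff scale1)

text \<open>\<open>y\<close> lies in the radical of \<open>\<sigma> y\<close>, so multiples of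
  \<open>y\<close> drop out and the full Gram matrix is obtained by congruence from that of the
  family \<open>b\<close>. This passes from size nine back to size ten.\<close>

lemma rank_gram_le:
  fixes b :: "'n::finite \<Rightarrow> V10"
  assumes "\<And>w. \<exists>a c. w = (\<Sum>k\<in>UNIV. a k *s b k) + c *s y"
  shows "rank (gram y) \<le> rank (\<chi> k l. \<sigma> y (b k) (b l))"
proof -
  have "\<forall>i::10. \<exists>a c. axis i 1 = (\<Sum>k\<in>UNIV. a k *s b k) + c *s y"
    using assms by blast
  then obtain a c where ac: "\<And>i::10. axis i 1 = (\<Sum>k\<in>UNIV. a i k *s b k) + c i *s y"
    by metis
  define X :: "complex^'n^10" where "X = (\<chi> i k. a i k)"
  have "\<sigma> y (axis i 1) (axis j 1) = (\<Sum>l\<in>UNIV. (\<Sum>k\<in>UNIV. a i k * \<sigma> y (b k) (b l)) * a j l)" for i j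
  proof -
    have "\<sigma> y (axis i 1) (axis j 1) = (\<Sum>k\<in>UNIV. \<Sum>l\<in>UNIV. a i k * (a j l * \<sigma> y (b k) (b l)))"
      unfolding ac by (simp add: add2 add3 sum2 sum3 scale2 scale3 alt12 alt13 sum_distrib_left)
        (subst sum.swap, simp add: mult_ac)
    also have "\<dots> = (\<Sum>l\<in>UNIV. \<Sum>k\<in>UNIV. a i k * (a j l * \<sigma> y (b k) (b l)))"
      by (rule sum.swap)
    finally show ?thesis
      by (simp add: sum_distrib_left sum_distrib_right mult_ac)
  qed
  then have "gram y = X ** (\<chi> k l. \<sigma> y (b k) (b l)) ** transpose X"
    by (simp add: gram_def X_def matrix_matrix_mult_def transpose_def vec_eq_iff)
  then show ?thesis
    using rank_mult_le_left[of "X ** (\<chi> k l. \<sigma> y (b k) (b l))" "transpose X"]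
      rank_mult_le_right[of X "\<chi> k l. \<sigma> y (b k) (b l)"] by simp
qed

end

lemma card_3_inj:
  assumes "3 \<le> card S"
  obtains k :: "3 \<Rightarrow> 'a" where "inj k" "range k \<subseteq> S"
proof -
  obtain T where T: "T \<subseteq> S" "card T = 3" "finite T"
    using obtain_subset_with_card_n[OF assms] by blast
  then obtain k :: "3 \<Rightarrow> 'a" where "bij_betw k UNIV T"
    using finite_same_card_bij[of "UNIV :: 3 set" T] by auto
  then show ?thesis using that T by (auto simp: bij_betw_def)
qed

lemma representation_basis:
  fixes E :: "V10 set"
  assumes E: "vec.independent E" "vec.span E = UNIV"
  shows representation_linear: "vec.representation E (x + y) e = vec.representation E x e + vec.representation E y e"
      "vec.representation E (c *s x) e = c * vec.representation E x e"
      "vec.representation E (\<Sum>i\<in>I. g i) e = (\<Sum>i\<in>I. vec.representation E (g i) e)"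
    and representation_outside: "B \<subseteq> E \<Longrightarrow> v \<in> vec.span B \<Longrightarrow> e \<notin> B \<Longrightarrow> vec.representation E v e = 0"
proof -
  have lin: "Vector_Spaces.linear (*s) (*) (\<lambda>v. vec.representation E v e)"
    using E by (intro vec.linear_representation) auto
  then show "vec.representation E (x + y) e = vec.representation E x e + vec.representation E y e"
      "vec.representation E (c *s x) e = c * vec.representation E x e"
      "vec.representation E (\<Sum>i\<in>I. g i) e = (\<Sum>i\<in>I. vec.representation E (g i) e)"
    by (fact linear_functional_add linear_functional_scale linear_functional_sum)+
  assume "B \<subseteq> E" "v \<in> vec.span B" "e \<notin> B"
  then have "vec.representation E v e = vec.representation B v e"
    using E by (metis vec.representation_extend)
  then show "vec.representation E v e = 0"
    using vec.representation_ne_zero[of B v e] \<open>e \<notin> B\<close> by metis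
qed

context trivector
begin

text \<open>The degeneracy locus has codimension at most three, whereas \<open>V\<close> has codimension four. The
  four parameters are the directions \<open>\<tau> m\<close> transverse to \<open>V\<close>, and the forms are restricted to the
  hyperplane \<open>\<xi> = 0\<close>, a complement of every point of the slice.\<close>

theorem rank_le_6_outside_subspace:
  assumes V: "subspace_of_dim 6 V" and x0: "x0 \<in> V" "x0 \<noteq> 0" and rk: "rank_2form (\<sigma> x0) \<le> 6"
    and F: "F \<in> polynomials vec_coords" "F x0 \<noteq> 0"
  shows "\<exists>y. y \<notin> V \<and> F y \<noteq> 0 \<and> rank_2form (\<sigma> y) \<le> 6"
proof -
  have V': "vec.subspace V" "vec.dim V = 6" using V by (auto simp: subspace_of_dim_def)
  \<comment> \<open>\<open>x0\<close> is made a basis vector so that its coordinate function can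
    serve as \<open>\<xi>\<close>.\<close>
  obtain B where B: "{x0} \<subseteq> B" "B \<subseteq> V" "vec.independent B" "V \<subseteq> vec.span B"
    using vec.maximal_independent_subset_extend[of "{x0}" V] x0 by auto
  have cardB: "card B = 6" using B V' by (metis vec.basis_card_eq_dim)
  define E where "E = vec.extend_basis B"
  have E: "B \<subseteq> E" "vec.independent E" "vec.span E = UNIV"
    using B by (simp_all add: E_def vec.extend_basis_superset vec.independent_extend_basis)
  have finE: "finite E" using E(2) vec.finiteI_independent by blast
  have cardE: "card E = 10" using card_basis[OF E(2,3)] by simp
  have "card (E - B) = CARD(3 + 1)"
    using cardE cardB E finE by (simp add: card_Diff_subset finite_subset)
  then obtain \<tau> :: "3 + 1 \<Rightarrow> V10" where \<tau>: "bij_betw \<tau> UNIV (E - B)"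
    using finite_same_card_bij[of "UNIV :: (3 + 1) set" "E - B"] finE by auto
  have \<tau>E: "\<tau> m \<in> E" "\<tau> m \<notin> B" for m using \<tau> by (auto simp: bij_betw_def)
  have \<tau>_inj: "\<tau> m = \<tau> m' \<longleftrightarrow> m = m'" for m m' using \<tau> by (auto simp: bij_betw_def inj_on_def)
  define \<xi> where "\<xi> v = vec.representation E v x0" for v
  have \<xi>_lin: "\<xi> (v + w) = \<xi> v + \<xi> w" "\<xi> (c *s v) = c * \<xi> v" "\<xi> (\<Sum>i\<in>I. g i) = (\<Sum>i\<in>I. \<xi> (g i))"
    for v w c I and g :: "'z \<Rightarrow> V10"
    by (simp_all add: \<xi>_def representation_linear[OF E(2,3)])
  have x0E: "x0 \<in> B" "x0 \<in> E" using B E by auto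
  have \<xi>: "\<xi> x0 = 1" "\<xi> (\<tau> m) = 0" for m
    using \<tau>E[of m] x0E by (auto simp: \<xi>_def vec.representation_basis[OF E(2)])
  \<comment> \<open>The slice through \<open>x0\<close> meets \<open>V\<close> only at
    \<open>u = 0\<close>, and \<open>\<xi>\<close> is constantly 1 on it.\<close>
  define y where "y u = x0 + (\<Sum>m\<in>UNIV. u $ m *s \<tau> m)" for u
  have \<xi>y: "\<xi> (y u) = 1" for u by (simp add: y_def \<xi>_lin \<xi>)
  have yV: "u = 0" if "y u \<in> V" for u
  proof (subst vec_eq_iff, intro allI)
    fix m
    have "vec.representation E (y u) (\<tau> m) = 0"
      using that B E \<tau>E by (intro representation_outside[of E B]) auto
    moreover have "vec.representation E (y u) (\<tau> m) = u $ m"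
      using \<tau>E[of m] x0E
      by (auto simp: y_def representation_linear[OF E(2,3)] vec.representation_basis[OF E(2)] \<tau>E \<tau>_inj
          if_distrib[of "\<lambda>c. _ * c"] sum.delta cong: if_cong)
    ultimately show "u $ m = 0 $ m" by simp
  qed

  define K where "K = {v. gram x0 *v v = 0}"
  \<comment> \<open>This is 10 - 6. One dimension is taken by \<open>x0\<close>; the other three
    supply the block of size 3.\<close>
  have "4 \<le> vec.dim K"
    using dim_kernel_skew[OF gram_skew, of x0] rk by (simp add: K_def rank_2form_gram)
  have subK: "vec.subspace K"
    by (auto simp: K_def gram_kernel vec.subspace_def add3 scale3 zero3)
  have x0K: "x0 \<in> K" by (simp add: K_def gram_kernel alt13)
  obtain L where L: "{x0} \<subseteq> L" "L \<subseteq> K" "vec.independent L" "K \<subseteq> vec.span L"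
    using vec.maximal_independent_subset_extend[of "{x0}" K] x0K x0 by auto
  have "card L = vec.dim K" using L by (metis vec.basis_card_eq_dim)
  moreover have "finite L" using L vec.finiteI_independent by blast
  ultimately have "3 \<le> card (L - {x0})" using \<open>4 \<le> vec.dim K\<close> L by simp
  then obtain k :: "3 \<Rightarrow> V10" where k: "inj k" "range k \<subseteq> L - {x0}" by (rule card_3_inj)
  define H where "H = vec.extend_basis L"
  have H: "L \<subseteq> H" "vec.independent H" "vec.span H = UNIV"
    using L by (simp_all add: H_def vec.extend_basis_superset vec.independent_extend_basis)
  have finH: "finite H" using H(2) vec.finiteI_independent by blast
  have cardH: "card H = 10" using card_basis[OF H(2,3)] by simp
  have "card (range k) = 3" using k(1) by (simp add: card_image)
  then have "card (H - {x0} - range k) = CARD(3 + 3)"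
    using cardH finH k H L by (subst card_Diff_subset) auto
  then obtain j :: "3 + 3 \<Rightarrow> V10" where j: "bij_betw j UNIV (H - {x0} - range k)"
    using finite_same_card_bij[of "UNIV :: (3 + 3) set" "H - {x0} - range k"] finH by auto
  \<comment> \<open>The kernel vectors \<open>k\<close> come last, as \<open>A0_kernel\<close>
    demands.\<close>
  define b where "b = case_sum j k"
  have b: "bij_betw b UNIV (H - {x0})"
    unfolding bij_betw_def
  proof
    have "j p \<noteq> k q" for p q
      using bij_betwE[OF j] by auto
    then show "inj b"
      using bij_betw_imp_inj_on[OF j] k(1)
      by (auto simp: inj_def b_def split: sum.splits) metis+
    have "range b = range j \<union> range k"
      by (subst UNIV_sum) (simp add: b_def image_Un image_image)
    then show "range b = H - {x0}"
      using j k(2) H(1) L(1) by (auto simp: bij_betw_def)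
  qed
  \<comment> \<open>Moved into the hyperplane \<open>\<xi> = 0\<close> along \<open>x0\<close>. As
    \<open>x0\<close> is in the radical at the origin of the slice, kernel vectors remain kernel
    vectors.\<close>
  define b' where "b' i = b i - \<xi> (b i) *s x0" for i
  have \<xi>b': "\<xi> (b' i) = 0" for i
    using \<xi>_lin(1)[of "b i" "- \<xi> (b i) *s x0"] \<xi>_lin(2)[of "- \<xi> (b i)" x0] by (simp add: b'_def \<xi>)
  have span0: "\<exists>a c. w = (\<Sum>i\<in>UNIV. a i *s b' i) + c *s x0" for w
  proof -
    have "w \<in> vec.span H" using H by simp
    then obtain d where "w = (\<Sum>h\<in>H. d h *s h)"
      using vec.span_finite[OF finH] by auto
    also have "\<dots> = (\<Sum>h\<in>H - {x0}. d h *s h) + d x0 *s x0"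
      using finH H L by (subst sum.remove[of H x0]) (auto simp: add.commute)
    also have "(\<Sum>h\<in>H - {x0}. d h *s h) = (\<Sum>i\<in>UNIV. d (b i) *s b i)"
      using sum.reindex_bij_betw[OF b, of "\<lambda>h. d h *s h"] by simp
    also have "\<dots> = (\<Sum>i\<in>UNIV. d (b i) *s b' i + (d (b i) * \<xi> (b i)) *s x0)"
      by (simp add: b'_def vec.scale_right_diff_distrib)
    also have "\<dots> = (\<Sum>i\<in>UNIV. d (b i) *s b' i) + (\<Sum>i\<in>UNIV. d (b i) * \<xi> (b i)) *s x0"
      by (simp add: sum.distrib vec.scale_sum_left)
    finally have "w = (\<Sum>i\<in>UNIV. d (b i) *s b' i) + ((\<Sum>i\<in>UNIV. d (b i) * \<xi> (b i)) + d x0) *s x0"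
      by (simp add: vec.scale_left_distrib add.assoc)
    then show ?thesis by (intro exI)
  qed
  \<comment> \<open>Subtracting \<open>\<xi> w *s y u\<close> puts the vector into the hyperplane;
    applying \<open>\<xi>\<close> to its expansion then shows that the coefficient of
    \<open>x0\<close> is zero.\<close>
  have span: "\<exists>a c. w = (\<Sum>i\<in>UNIV. a i *s b' i) + c *s y u" for w u
  proof -
    obtain a c where ac: "w - \<xi> w *s y u = (\<Sum>i\<in>UNIV. a i *s b' i) + c *s x0"
      using span0 by blast
    have "\<xi> (w - \<xi> w *s y u) = c"
      unfolding ac by (simp add: \<xi>_lin \<xi>b' \<xi>)
    moreover have "\<xi> (w - \<xi> w *s y u) = 0"
      using \<xi>_lin(1)[of w "- \<xi> w *s y u"] \<xi>_lin(2)[of "- \<xi> w" "y u"] by (simp add: \<xi>y)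
    ultimately have "w = (\<Sum>i\<in>UNIV. a i *s b' i) + \<xi> w *s y u"
      using ac by (simp add: algebra_simps)
    then show ?thesis by blast
  qed
  have kernel: "\<sigma> x0 v (b' (Inr i)) = 0" for v i
  proof -
    have "b (Inr i) \<in> K" using k L by (auto simp: b_def)
    then have "b' (Inr i) \<in> K"
      unfolding b'_def by (intro vec.subspace_diff[OF subK] vec.subspace_scale[OF subK] x0K)
    then show ?thesis by (simp add: K_def gram_kernel)
  qed
  \<comment> \<open>Here \<open>'q\<close> is \<open>3\<close>, so the rank bound of the locale is
    6.\<close>
  interpret skew_family "\<chi> i j. \<sigma> x0 (b' i) (b' j)" "\<lambda>m. \<chi> i j. \<sigma> (\<tau> m) (b' i) (b' j)"
    by standard (auto simp: kernel intro: skew)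
  have A: "A u = (\<chi> i j. \<sigma> (y u) (b' i) (b' j))" for u
    by (simp add: A_def y_def add1 sum1 scale1 vec_eq_iff)
  have "(\<lambda>u. F (y u)) \<in> polynomials vec_coords"
  proof (rule polynomials_compose[OF F(1)])
    fix c :: "V10 \<Rightarrow> complex" assume "c \<in> vec_coords"
    then obtain i where "c = (\<lambda>x. x $ i)" by (auto simp: vec_coords_def)
    then show "(\<lambda>u. c (y u)) \<in> polynomials vec_coords"
      unfolding y_def by (simp add: sum_component) (intro polynomials_intros vec_coord_polynomials)
  qed
  moreover have "F (y 0) \<noteq> 0" using F by (simp add: y_def)
  ultimately obtain u where u: "u \<noteq> 0" "F (y u) \<noteq> 0" "rank (A u) \<le> CARD(3 + 3)"
    using nonisolated_rank_le[of "\<lambda>u. F (y u)"] by blast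
  have "rank_2form (\<sigma> (y u)) \<le> 6"
    using rank_gram_le[OF span, of u] u by (simp add: rank_2form_gram A)
  then show ?thesis using u yV by blast
qed

end

section \<open>Morphisms given by polynomials in the coordinates\<close>

lemma openin_nonvanishing: "F \<in> forms M d \<Longrightarrow> openin (proj_topology M) (nonvanishing M F)"
  unfolding proj_topology_def by (rule topology_generated_by_Basis) blast

text \<open>Products of forms are forms, so finite intersections of the generating open sets are
  again of this kind and the subbasis is a basis.\<close>

lemma nonvanishing_basis:
  assumes prod: "\<And>d e F G. F \<in> forms M d \<Longrightarrow> G \<in> forms M e \<Longrightarrow> \<exists>k. (\<lambda>c. F c * G c) \<in> forms M k"
    and "openin (proj_topology M) W" "p \<in> W"
  shows "\<exists>d F. F \<in> forms M d \<and> p \<in> nonvanishing M F \<and> nonvanishing M F \<subseteq> W"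
proof -
  have "generate_topology_on {nonvanishing M F | F d. F \<in> forms M d} W"
    using assms(2) unfolding proj_topology_def by (rule openin_topology_generated_by)
  then show ?thesis
    using \<open>p \<in> W\<close>
  proof (induction arbitrary: p)
    case Empty
    then show ?case by simp
  next
    case (Int a b)
    obtain d F where F: "F \<in> forms M d" "p \<in> nonvanishing M F" "nonvanishing M F \<subseteq> a"
      using Int.IH(1)[of p] Int.prems by blast
    obtain e G where G: "G \<in> forms M e" "p \<in> nonvanishing M G" "nonvanishing M G \<subseteq> b"
      using Int.IH(2)[of p] Int.prems by blast
    obtain k where "(\<lambda>c. F c * G c) \<in> forms M k" using prod F(1) G(1) by blast
    moreover have "nonvanishing M (\<lambda>c. F c * G c) = nonvanishing M F \<inter> nonvanishing M G"
      by (auto simp: nonvanishing_def)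
    ultimately show ?case using F G by blast
  next
    case (UN K)
    then show ?case by blast
  next
    case (Basis s)
    then show ?case by blast
  qed
qed

text \<open>If forms pull back to forms along \<open>h\<close>, continuity and regularity both
  follow by substitution. The vectors \<open>h c\<close> need not exhaust the coordinate vectors of
  the image point; \<open>welldef\<close> carries nonvanishing over to the others.\<close>

lemma morphism_by_coords:
  assumes top: "topspace (proj_topology M) = points M"
    and Y: "Y \<subseteq> points M" and Z: "Z \<subseteq> points N" and img: "f ` Y \<subseteq> Z"
    and coords: "\<And>p c. p \<in> Y \<Longrightarrow> c \<in> coords M p \<Longrightarrow> h c \<in> coords N (f p)"
    and nonempty: "\<And>p. p \<in> Y \<Longrightarrow> coords M p \<noteq> {}"
    and pull: "\<And>d F. F \<in> forms N d \<Longrightarrow> (\<lambda>c. F (h c)) \<in> forms M (e d)"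
    and total: "\<And>q. q \<in> Z \<Longrightarrow> \<exists>d F. F \<in> forms N d \<and> q \<in> nonvanishing N F"
    and welldef: "\<And>d F q c c'. F \<in> forms N d \<Longrightarrow> q \<in> points N \<Longrightarrow> c \<in> coords N q \<Longrightarrow>
       c' \<in> coords N q \<Longrightarrow> F c \<noteq> 0 \<Longrightarrow> F c' \<noteq> 0"
  shows "morphism M Y N Z f"
proof -
  have topY: "topspace (var_topology M Y) = Y"
    using top Y by (auto simp: var_topology_def)
  have preimage: "f -` nonvanishing N F \<inter> Y = nonvanishing M (\<lambda>c. F (h c)) \<inter> Y"
    if F: "F \<in> forms N d" for F d
  proof (intro set_eqI iffI; elim IntE; intro IntI)
    fix p assume p: "p \<in> f -` nonvanishing N F" "p \<in> Y"
    then show "p \<in> nonvanishing M (\<lambda>c. F (h c))"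
      using Y coords by (auto simp: nonvanishing_def)
  next
    fix p assume p: "p \<in> nonvanishing M (\<lambda>c. F (h c))" "p \<in> Y"
    obtain c where c: "c \<in> coords M p" using nonempty p by blast
    then have "F (h c) \<noteq> 0" using p by (auto simp: nonvanishing_def)
    moreover have "f p \<in> points N" using p img Z by blast
    ultimately show "p \<in> f -` nonvanishing N F"
      using welldef[OF F _ coords[OF p(2) c]] by (auto simp: nonvanishing_def)
  qed auto
  have cont: "continuous_map (var_topology M Y) (proj_topology N) f"
    unfolding proj_topology_def[of N]
  proof (rule continuous_on_generated_topo)
    fix U assume "U \<in> {nonvanishing N F | F d. F \<in> forms N d}"
    then obtain F d where F: "U = nonvanishing N F" "F \<in> forms N d" by blast
    then have "f -` U \<inter> topspace (var_topology M Y) = nonvanishing M (\<lambda>c. F (h c)) \<inter> Y"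
      using preimage[of F d] by (simp add: topY)
    then show "openin (var_topology M Y) (f -` U \<inter> topspace (var_topology M Y))"
      using openin_nonvanishing[OF pull[OF F(2)]] by (auto simp: var_topology_def openin_subtopology)
  next
    show "f ` topspace (var_topology M Y) \<subseteq> \<Union>{nonvanishing N F | F d. F \<in> forms N d}"
      using img total unfolding topY by blast
  qed
  then have cont': "continuous_map (var_topology M Y) (var_topology N Z) f"
    unfolding var_topology_def[of N] continuous_map_in_subtopology
    using img topY by auto
  have "regular_on M {p \<in> Y. f p \<in> W} (\<phi> \<circ> f)" if W: "openin (var_topology N Z) W" "regular_on N W \<phi>" for W \<phi>
    unfolding regular_on_def
  proof
    fix p assume p: "p \<in> {p \<in> Y. f p \<in> W}"
    then have "f p \<in> W" by simp
    from bspec[OF W(2)[unfolded regular_on_def] this] obtain U d F G where U: "openin (var_topology N W) U" "f p \<in> U" "F \<in> forms N d" "G \<in> forms N d"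
      "\<forall>q\<in>U. \<forall>c\<in>coords N q. G c \<noteq> 0 \<and> \<phi> q = F c / G c"
      by (elim exE conjE) (rule that, assumption+)
    obtain O1 where O1: "openin (proj_topology N) O1" "U = O1 \<inter> W"
      using U(1) by (auto simp: var_topology_def openin_subtopology)
    have "openin (var_topology M Y) {x \<in> Y. f x \<in> O1}"
      using openin_continuous_map_preimage[OF cont O1(1)] by (simp add: topY)
    then obtain O2 where O2: "openin (proj_topology M) O2" "{x \<in> Y. f x \<in> O1} = O2 \<inter> Y"
      by (auto simp: var_topology_def openin_subtopology)
    define U' where "U' = O2 \<inter> {p \<in> Y. f p \<in> W}"
    have U': "U' = {x \<in> Y. f x \<in> U}" using O1 O2 by (auto simp: U'_def)
    show "\<exists>U d F G. openin (var_topology M {p \<in> Y. f p \<in> W}) U \<and> p \<in> U \<and> F \<in> forms M d \<and> G \<in> forms M d \<and>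
        (\<forall>q\<in>U. \<forall>c\<in>coords M q. G c \<noteq> 0 \<and> (\<phi> \<circ> f) q = F c / G c)"
    proof (intro exI conjI ballI)
      show "openin (var_topology M {p \<in> Y. f p \<in> W}) U'"
        using O2(1) by (auto simp: var_topology_def openin_subtopology U'_def)
      show "p \<in> U'" using p U(2) by (simp add: U')
      show "(\<lambda>c. F (h c)) \<in> forms M (e d)" "(\<lambda>c. G (h c)) \<in> forms M (e d)" using pull U by auto
      fix q c assume "q \<in> U'" "c \<in> coords M q"
      then show "G (h c) \<noteq> 0" "(\<phi> \<circ> f) q = F (h c) / G (h c)"
        using U(5) coords[of q c] by (auto simp: U')
    qed
  qed
  then show ?thesis
    unfolding morphism_def using img cont' by blast
qed

section \<open>Subspaces and coordinates\<close>

lemma subspace_insert_eq: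
  assumes "subspace_of_dim k A" "subspace_of_dim (Suc k) B" "A \<subseteq> B" "y \<in> B" "y \<notin> A"
  shows "B = vec.span (insert y A)"
proof -
  have A: "vec.subspace A" "vec.dim A = k" and B: "vec.subspace B" "vec.dim B = Suc k"
    using assms by (auto simp: subspace_of_dim_def)
  have "vec.span A = A" using A by (simp add: vec.span_eq_iff)
  then have "y \<notin> vec.span A" using assms(5) by metis
  then have "vec.dim (insert y A) = Suc k" using A by (simp add: vec.dim_insert)
  then have "vec.dim (vec.span (insert y A)) = vec.dim B" using B by simp
  moreover have "vec.span (insert y A) \<subseteq> B"
    using assms B by (intro vec.span_minimal) auto
  ultimately have "vec.span (insert y A) = B"
    by (intro vec.subspace_dim_equal[OF vec.subspace_span B(1)]) auto
  then show ?thesis by simp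
qed

lemma subspace_insert_span:
  assumes "subspace_of_dim k A" "y \<notin> A"
  shows "subspace_of_dim (Suc k) (vec.span (insert y A))"
proof -
  have A: "vec.subspace A" "vec.dim A = k" using assms by (auto simp: subspace_of_dim_def)
  have "vec.span A = A" using A by (simp add: vec.span_eq_iff)
  then have "y \<notin> vec.span A" using assms(2) by metis
  then show ?thesis using A by (simp add: subspace_of_dim_def vec.dim_insert)
qed

text \<open>Two generators of the line \<open>B / A\<close> are proportional modulo
  \<open>A\<close>. With \<open>A = {0}\<close> this also covers lines in \<open>V10\<close>
  itself.\<close>

lemma quotient_line_coord:
  assumes "subspace_of_dim k A" "subspace_of_dim (Suc k) B" "A \<subseteq> B" "y \<in> B - A" "y' \<in> B - A"
  obtains s v where "y' = s *s y + v" "v \<in> A" "s \<noteq> 0"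
proof -
  have span: "vec.span A = A" using assms by (simp add: subspace_of_dim_def vec.span_eq_iff)
  have "y' \<in> vec.span (insert y A)"
    using subspace_insert_eq[OF assms(1-3)] assms(4,5) by blast
  then obtain s where "y' - s *s y \<in> vec.span A"
    by (auto simp: vec.span_breakdown_eq)
  then have s: "y' - s *s y \<in> A" by (simp only: span)
  moreover have "s \<noteq> 0" using s assms(5) by auto
  ultimately show ?thesis using that[of s "y' - s *s y"] by simp
qed

lemma subspace_zero_dim: "subspace_of_dim 0 {0}"
  by (simp add: subspace_of_dim_def)

lemma subspace_of_dim_zero: "subspace_of_dim k A \<Longrightarrow> 0 \<in> A"
  by (simp add: subspace_of_dim_def vec.subspace_0)

lemma line_eq_span:
  assumes "subspace_of_dim 1 l" "x \<in> l" "x \<noteq> 0"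
  shows "l = vec.span {x}"
  using subspace_insert_eq[OF subspace_zero_dim, of l x] assms subspace_of_dim_zero[of 1 l]
  by (simp add: vec.span_insert_0 insert_commute)

lemma line_nonzero:
  assumes "subspace_of_dim 1 l"
  obtains x where "x \<in> l" "x \<noteq> 0"
proof -
  have "\<not> l \<subseteq> {0}"
    using assms vec.dim_eq_0[of l] by (auto simp: subspace_of_dim_def)
  then show ?thesis using that by blast
qed

section \<open>Forms and closed subsets of the projective space\<close>

lemma points_PV10: "l \<in> points PV10 \<longleftrightarrow> subspace_of_dim 1 l"
  and coords_PV10: "coords PV10 l = l - {0}"
  and forms_PV10: "F \<in> forms PV10 d \<longleftrightarrow> F \<in> polynomials vec_coords \<and> (\<forall>t x. F (t *s x) = t ^ d * F x)"
  by (simp_all add: PV10_def vec_coords_def)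

lemma welldef_PV10:
  assumes "F \<in> forms PV10 d" "l \<in> points PV10" "x \<in> l" "x' \<in> l" "x' \<noteq> 0" "F x \<noteq> 0" "x \<noteq> 0"
  shows "F x' \<noteq> 0"
proof -
  obtain s v where "x' = s *s x + v" "v \<in> {0}" "s \<noteq> 0"
    using assms quotient_line_coord[OF subspace_zero_dim, of l x x'] subspace_of_dim_zero[of 1 l]
    by (auto simp: points_PV10)
  then show ?thesis using assms by (simp add: forms_PV10)
qed

lemma in_nonvanishing_PV10:
  assumes "F \<in> forms PV10 d" "l \<in> points PV10" "x \<in> l" "x \<noteq> 0" "F x \<noteq> 0"
  shows "l \<in> nonvanishing PV10 F"
proof -
  have "F c \<noteq> 0" if "c \<in> coords PV10 l" for c
    using that welldef_PV10[OF assms(1-3)] assms(4,5) by (simp add: coords_PV10)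
  then show ?thesis using assms(2) by (simp add: nonvanishing_def)
qed

lemma closedin_PV10I:
  assumes "S \<subseteq> points PV10"
    and "\<And>l. l \<in> points PV10 \<Longrightarrow> l \<notin> S \<Longrightarrow>
      \<exists>F d x. F \<in> forms PV10 d \<and> x \<in> l \<and> x \<noteq> 0 \<and> F x \<noteq> 0 \<and> (\<forall>l'\<in>S. \<forall>y\<in>l'. F y = 0)"
  shows "closedin (proj_topology PV10) S"
  unfolding closedin_def
proof
  show "S \<subseteq> topspace (proj_topology PV10)" using assms(1) by simp
  show "openin (proj_topology PV10) (topspace (proj_topology PV10) - S)"
  proof (subst openin_subopen, intro ballI)
    fix l assume l: "l \<in> topspace (proj_topology PV10) - S"
    then obtain F d x where F: "F \<in> forms PV10 d" "x \<in> l" "x \<noteq> 0" "F x \<noteq> 0" "\<forall>l'\<in>S. \<forall>y\<in>l'. F y = 0"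
      using assms(2)[of l] by auto
    have "l' \<notin> S" if "l' \<in> nonvanishing PV10 F" for l'
    proof
      assume "l' \<in> S"
      then obtain y where "y \<in> l'" "y \<noteq> 0" using assms(1) line_nonzero[of l'] points_PV10 by (metis subsetD)
      then show False using that F(5) \<open>l' \<in> S\<close> by (auto simp: nonvanishing_def coords_PV10)
    qed
    then have "nonvanishing PV10 F \<subseteq> topspace (proj_topology PV10) - S"
      by (auto simp: nonvanishing_def)
    then show "\<exists>T. openin (proj_topology PV10) T \<and> l \<in> T \<and> T \<subseteq> topspace (proj_topology PV10) - S"
      using in_nonvanishing_PV10[OF F(1) _ F(2,3,4)] openin_nonvanishing[OF F(1)] l by auto
  qed
qed

text \<open>A vector \<open>x\<close> of the line outside \<open>V\<close> extends a basis of
  \<open>V\<close>; its coordinate function is a linear form that vanishes on \<open>V\<close> but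
  not at \<open>x\<close>.\<close>

lemma closedin_lines_in:
  assumes "vec.subspace V"
  shows "closedin (proj_topology PV10) (lines_in V)"
proof (rule closedin_PV10I)
  fix l assume l: "l \<in> points PV10" "l \<notin> lines_in V"
  then obtain x where x: "x \<in> l" "x \<notin> V" by (auto simp: lines_in_def)
  obtain B where B: "B \<subseteq> V" "vec.independent B" "V \<subseteq> vec.span B"
    by (rule vec.maximal_independent_subset)
  have spanB: "vec.span B = V" using B assms by (intro subset_antisym vec.span_minimal)
  have indep: "vec.independent (insert x B)" using B x spanB by (intro vec.independent_insertI) auto
  define E where "E = vec.extend_basis (insert x B)"
  have E: "insert x B \<subseteq> E" "vec.independent E" "vec.span E = UNIV"
    unfolding E_def using vec.extend_basis_superset[OF indep] vec.independent_extend_basis[OF indep]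
      vec.span_extend_basis[OF indep] by blast+
  define F where "F v = vec.representation E v x" for v
  have "x \<notin> B" using x B by auto
  have "F v = (\<Sum>i\<in>UNIV. v $ i * F (axis i 1))" for v
  proof -
    have "F v = vec.representation E (\<Sum>i\<in>UNIV. v $ i *s axis i 1) x"
      by (simp add: F_def basis_expansion)
    then show ?thesis unfolding F_def by (simp only: representation_linear[OF E(2,3)])
  qed
  then have "F = (\<lambda>v. \<Sum>i\<in>UNIV. v $ i * F (axis i 1))" by (rule ext)
  moreover have "(\<lambda>v. \<Sum>i\<in>UNIV. v $ i * F (axis i 1)) \<in> polynomials vec_coords"
    by (intro polynomials_intros vec_coord_polynomials)
  ultimately have "F \<in> polynomials vec_coords" by metis
  then have "F \<in> forms PV10 1"
    by (simp add: forms_PV10 F_def representation_linear[OF E(2,3)])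
  moreover have "F x = 1" using E by (simp add: F_def vec.representation_basis)
  moreover have "F v = 0" if "v \<in> V" for v
    unfolding F_def using E spanB that \<open>x \<notin> B\<close> by (intro representation_outside[of E B]) auto
  moreover have "x \<noteq> 0" using x assms vec.subspace_0 by blast
  ultimately show "\<exists>F d x. F \<in> forms PV10 d \<and> x \<in> l \<and> x \<noteq> 0 \<and> F x \<noteq> 0 \<and> (\<forall>l'\<in>lines_in V. \<forall>y\<in>l'. F y = 0)"
    using x by (intro exI[of _ F] exI[of _ 1] exI[of _ x]) (auto simp: lines_in_def)
qed (auto simp: lines_in_def)

section \<open>Closedness of the Peskine variety and density of its part outside a subspace\<close>

context trivector
begin

text \<open>The separating form is a minor; exactly the seven rows in \<open>I\<close> scale with
  the vector, so it is homogeneous of degree 7.\<close>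

lemma closedin_peskine: "closedin (proj_topology PV10) (peskine \<sigma>)"
proof (rule closedin_PV10I)
  fix l assume l: "l \<in> points PV10" "l \<notin> peskine \<sigma>"
  then obtain x where x: "x \<in> l" "\<not> rank (gram x) \<le> 6"
    by (auto simp: peskine_def rank_2form_gram)
  then obtain I c where I: "card I = Suc 6" "det (\<chi> i. if i \<in> I then gram x $ i else c i) \<noteq> 0"
    unfolding rank_le_iff_minors by blast
  define F where "F y = det (\<chi> i. if i \<in> I then gram y $ i else c i)" for y
  have "F \<in> polynomials vec_coords"
    unfolding F_def
  proof (rule polynomials_det)
    fix i j
    show "(\<lambda>x. (\<chi> i. if i \<in> I then gram x $ i else c i) $ i $ j) \<in> polynomials vec_coords"
      by (cases "i \<in> I") (simp_all add: gram_polynomials polynomials.const)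
  qed
  moreover have F_scale: "F (t *s y) = t ^ 7 * F y" for t y
  proof -
    have "(\<chi> i. if i \<in> I then gram (t *s y) $ i else c i) =
        (\<chi> i. (if i \<in> I then t else 1) *s (if i \<in> I then gram y $ i else c i))"
      by (simp add: vec_eq_iff gram_scale)
    then have "F (t *s y) = (\<Prod>i\<in>UNIV. if i \<in> I then t else 1) * F y"
      unfolding F_def by (simp only: det_rows_mul)
    also have "(\<Prod>i\<in>UNIV. if i \<in> I then t else 1) = t ^ card I"
      by (simp add: prod.If_cases)
    finally show ?thesis using I by simp
  qed
  ultimately have "F \<in> forms PV10 7" by (simp add: forms_PV10)
  moreover have "F x \<noteq> 0" using I by (simp add: F_def)
  moreover have "x \<noteq> 0"
  proof
    assume "x = 0"
    then have "F x = 0" using F_scale[of 0 0] by simp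
    then show False using \<open>F x \<noteq> 0\<close> by simp
  qed
  moreover have "F y = 0" if "l' \<in> peskine \<sigma>" "y \<in> l'" for l' y
  proof -
    have "rank (gram y) \<le> 6" using that by (auto simp: peskine_def rank_2form_gram)
    then show ?thesis unfolding rank_le_iff_minors F_def using I by blast
  qed
  ultimately show "\<exists>F d x. F \<in> forms PV10 d \<and> x \<in> l \<and> x \<noteq> 0 \<and> F x \<noteq> 0 \<and> (\<forall>l'\<in>peskine \<sigma>. \<forall>y\<in>l'. F y = 0)"
    using x by blast
qed (auto simp: peskine_def)

lemma rank_2form_scale: "rank_2form (\<sigma> (t *s x)) \<le> rank_2form (\<sigma> x)"
proof -
  have "gram (t *s x) = mat t ** gram x"
    by (simp add: gram_scale vec_eq_iff matrix_matrix_mult_def mat_def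
        if_distrib[of "\<lambda>c. c * _"] sum.delta cong: if_cong)
  then show ?thesis by (simp add: rank_2form_gram rank_mult_le_right)
qed

lemma span_in_peskine:
  assumes "y \<noteq> 0" "rank_2form (\<sigma> y) \<le> 6"
  shows "vec.span {y} \<in> peskine \<sigma>"
proof -
  have "rank_2form (\<sigma> z) \<le> 6" if "z \<in> vec.span {y}" for z
    using that rank_2form_scale assms(2) by (auto simp: vec.span_singleton intro: order_trans)
  moreover have "subspace_of_dim 1 (vec.span {y})"
    using subspace_insert_span[OF subspace_zero_dim, of y] assms(1) by (simp add: insert_commute)
  ultimately show ?thesis by (simp add: peskine_def points_PV10)
qed

text \<open>A neighbourhood of a point of the locus contains the nonvanishing set of one form
  \<open>F\<close> around it. If the point lies over \<open>V\<close>,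
  \<open>rank_le_6_outside_subspace\<close> with this \<open>F\<close> yields a point of the locus
  in the neighbourhood and outside \<open>V\<close>.\<close>

theorem peskine_dense:
  assumes V: "subspace_of_dim 6 V"
  shows "dense_open_in (var_topology PV10 (peskine \<sigma>)) (peskine \<sigma> - lines_in V)"
proof -
  have pts: "peskine \<sigma> \<subseteq> points PV10" by (auto simp: peskine_def)
  have "openin (var_topology PV10 (peskine \<sigma>)) (peskine \<sigma> - lines_in V)"
    unfolding var_topology_def using pts V
    by (intro openin_subtopology_diff_closed closedin_lines_in) (auto simp: subspace_of_dim_def)
  moreover have "peskine \<sigma> \<subseteq> proj_topology PV10 closure_of (peskine \<sigma> - lines_in V)"
  proof
    fix l assume l: "l \<in> peskine \<sigma>"
    show "l \<in> proj_topology PV10 closure_of (peskine \<sigma> - lines_in V)"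
      unfolding in_closure_of
    proof (intro conjI allI impI)
      show "l \<in> topspace (proj_topology PV10)" using l pts by auto
      fix T assume T: "l \<in> T \<and> openin (proj_topology PV10) T"
      show "\<exists>y. y \<in> peskine \<sigma> - lines_in V \<and> y \<in> T"
      proof (cases "l \<in> lines_in V")
        case False
        then show ?thesis using l T by blast
      next
        case True
        have "\<exists>d F. F \<in> forms PV10 d \<and> l \<in> nonvanishing PV10 F \<and> nonvanishing PV10 F \<subseteq> T"
        proof (rule nonvanishing_basis)
          fix d e F G assume "F \<in> forms PV10 d" "G \<in> forms PV10 e"
          then have "(\<lambda>c. F c * G c) \<in> forms PV10 (d + e)"
            by (auto simp: forms_PV10 power_add intro: polynomials.mult)
          then show "\<exists>k. (\<lambda>c. F c * G c) \<in> forms PV10 k" by blast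
        qed (use T in auto)
        then obtain d F where F: "F \<in> forms PV10 d" "l \<in> nonvanishing PV10 F" "nonvanishing PV10 F \<subseteq> T"
          by blast
        obtain x0 where x0: "x0 \<in> l" "x0 \<noteq> 0"
          using l pts line_nonzero[of l] points_PV10 by (metis subsetD)
        have "x0 \<in> V" using True x0 by (auto simp: lines_in_def)
        moreover have "rank_2form (\<sigma> x0) \<le> 6" using l x0 by (auto simp: peskine_def)
        moreover have "F x0 \<noteq> 0" using F(2) x0 by (auto simp: nonvanishing_def coords_PV10)
        moreover have "F \<in> polynomials vec_coords" using F(1) by (simp add: forms_PV10)
        ultimately obtain y where y: "y \<notin> V" "F y \<noteq> 0" "rank_2form (\<sigma> y) \<le> 6"
          using rank_le_6_outside_subspace[OF V] x0 by blast
        have "y \<noteq> 0" using y(1) subspace_of_dim_zero[OF V] by auto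
        then have span: "vec.span {y} \<in> peskine \<sigma>" using span_in_peskine y by blast
        moreover have "y \<in> vec.span {y}" by (simp add: vec.span_base)
        ultimately have "vec.span {y} \<notin> lines_in V" "vec.span {y} \<in> nonvanishing PV10 F"
          using y pts in_nonvanishing_PV10[OF F(1) _ _ \<open>y \<noteq> 0\<close>] by (auto simp: lines_in_def)
        then show ?thesis using span F(3) by blast
      qed
    qed
  qed
  ultimately show ?thesis
    using pts unfolding dense_open_in_def var_topology_def
    by (auto simp: closure_of_subtopology inf_absorb2 Diff_subset)
qed

end

section \<open>The tower\<close>

locale flag =
  fixes V1 V6 :: "V10 set"
  assumes V1: "subspace_of_dim 1 V1" and V6: "subspace_of_dim 6 V6" and V1_V6: "V1 \<subseteq> V6"
begin

lemma points_PV2: "(l, U2, U7) \<in> points (PV2 V1 V6) \<longleftrightarrow>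
    subspace_of_dim 1 l \<and> subspace_of_dim 2 U2 \<and> subspace_of_dim 7 U7 \<and> l \<subseteq> U2 \<and> V1 \<subseteq> U2 \<and> U2 \<subseteq> U7 \<and> V6 \<subseteq> U7"
  by (auto simp: PV2_def P_V7_V1_def P_V10_V6_def)

lemma coords_PV2: "coords (PV2 V1 V6) (l, U2, U7) = (l - {0}) \<times> (U2 - V1) \<times> (U7 - V6)"
  by (simp add: PV2_def)

definition tower_coords :: "(V10 \<times> V10 \<times> V10 \<Rightarrow> complex) set" where
  "tower_coords = {(\<lambda>(x, y, z). x $ i) | i. True} \<union> {(\<lambda>(x, y, z). y $ i) | i. True}
    \<union> {(\<lambda>(x, y, z). z $ i) | i. True}"

lemma forms_PV2: "F \<in> forms (PV2 V1 V6) (d1, d2, d3) \<longleftrightarrow> F \<in> polynomials tower_coords \<and>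
    (\<forall>r s t x y z. \<forall>v\<in>V1. \<forall>w\<in>V6. F (r *s x, s *s y + v, t *s z + w) = r ^ d1 * s ^ d2 * t ^ d3 * F (x, y, z))"
  by (simp add: PV2_def tower_coords_def)

lemma one_in_forms: "(\<lambda>_. 1) \<in> forms (PV2 V1 V6) (0, 0, 0)"
  by (simp add: forms_PV2 polynomials.const)

lemma nonempty_coords_PV2:
  assumes "p \<in> points (PV2 V1 V6)"
  shows "coords (PV2 V1 V6) p \<noteq> {}"
proof -
  obtain l U2 U7 where p: "p = (l, U2, U7)" by (cases p)
  have "\<not> U2 \<subseteq> V1"
    using assms V1 vec.dim_subset[of U2 V1] by (auto simp: p points_PV2 subspace_of_dim_def)
  moreover have "\<not> U7 \<subseteq> V6"
    using assms V6 vec.dim_subset[of U7 V6] by (auto simp: p points_PV2 subspace_of_dim_def)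
  moreover obtain x where "x \<in> l" "x \<noteq> 0" using assms line_nonzero by (auto simp: p points_PV2)
  ultimately show ?thesis by (auto simp: p coords_PV2)
qed

lemma welldef_PV2:
  assumes F: "F \<in> forms (PV2 V1 V6) d" and p: "p \<in> points (PV2 V1 V6)"
    and c: "c \<in> coords (PV2 V1 V6) p" "c' \<in> coords (PV2 V1 V6) p" and "F c \<noteq> 0"
  shows "F c' \<noteq> 0"
proof -
  obtain l U2 U7 where p': "p = (l, U2, U7)" by (cases p)
  obtain x y z where xyz: "c = (x, y, z)" by (cases c)
  obtain x' y' z' where xyz': "c' = (x', y', z')" by (cases c')
  obtain d1 d2 d3 where d: "d = (d1, d2, d3)" by (cases d)
  have sub: "subspace_of_dim (Suc 0) l" "subspace_of_dim (Suc 1) U2" "subspace_of_dim (Suc 6) U7"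
    "V1 \<subseteq> U2" "V6 \<subseteq> U7" "{0} \<subseteq> l"
    using p subspace_of_dim_zero[of 1 l] by (simp_all add: p' points_PV2 eval_nat_numeral)
  obtain r u where r: "x' = r *s x + u" "u \<in> {0}" "r \<noteq> 0"
    using quotient_line_coord[OF subspace_zero_dim sub(1,6), of x x'] c by (auto simp: p' xyz xyz' coords_PV2)
  obtain s v where s: "y' = s *s y + v" "v \<in> V1" "s \<noteq> 0"
    using quotient_line_coord[OF V1 sub(2,4), of y y'] c by (auto simp: p' xyz xyz' coords_PV2)
  obtain t w where t: "z' = t *s z + w" "w \<in> V6" "t \<noteq> 0"
    using quotient_line_coord[OF V6 sub(3,5), of z z'] c by (auto simp: p' xyz xyz' coords_PV2)
  have "F c' = r ^ d1 * s ^ d2 * t ^ d3 * F c"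
    using F r(1,2) s(1,2) t(1,2) by (simp add: d xyz xyz' forms_PV2)
  then show ?thesis using \<open>F c \<noteq> 0\<close> r s t by simp
qed

lemma pr_line_morphism:
  assumes "Y \<subseteq> points (PV2 V1 V6)" "Z \<subseteq> points PV10" "pr_line ` Y \<subseteq> Z"
  shows "morphism (PV2 V1 V6) Y PV10 Z pr_line"
proof (rule morphism_by_coords[where h = fst and e = "\<lambda>d. (d, 0, 0)"])
  show "fst c \<in> coords PV10 (pr_line p)" if "p \<in> Y" "c \<in> coords (PV2 V1 V6) p" for p c
    using that by (cases p; cases c) (auto simp: coords_PV2 coords_PV10 pr_line_def)
  show "(\<lambda>c. F (fst c)) \<in> forms (PV2 V1 V6) (d, 0, 0)" if "F \<in> forms PV10 d" for d F
  proof -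
    have "(\<lambda>c. F (fst c)) \<in> polynomials tower_coords"
    proof (rule polynomials_compose[where f = F and h = fst])
      fix c :: "V10 \<Rightarrow> complex" assume "c \<in> vec_coords"
      then obtain i where "c = (\<lambda>x. x $ i)" by (auto simp: vec_coords_def)
      then have "(\<lambda>x. c (fst x)) = (\<lambda>(x, y, z). x $ i)" by auto
      then show "(\<lambda>x. c (fst x)) \<in> polynomials tower_coords"
        by (auto simp: tower_coords_def intro: polynomials.coordinate)
    qed (use that in \<open>simp add: forms_PV10\<close>)
    then show ?thesis using that by (simp add: forms_PV2 forms_PV10)
  qed
  show "\<exists>d F. F \<in> forms PV10 d \<and> q \<in> nonvanishing PV10 F" if "q \<in> Z" for q
    using that assms(2) by (intro exI[of _ 0] exI[of _ "\<lambda>_. 1"])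
      (auto simp: forms_PV10 nonvanishing_def polynomials.const)
  show "F c' \<noteq> 0" if "F \<in> forms PV10 d" "q \<in> points PV10" "c \<in> coords PV10 q" "c' \<in> coords PV10 q" "F c \<noteq> 0" for d F q c c'
    using that welldef_PV10[of F d q c c'] by (auto simp: coords_PV10)
  show "coords (PV2 V1 V6) p \<noteq> {}" if "p \<in> Y" for p
    using that assms(1) by (intro nonempty_coords_PV2) blast
qed (use assms in auto)

section \<open>The inverse of the projection\<close>

definition lift :: "V10 set \<Rightarrow> V10 set \<times> V10 set \<times> V10 set" where
  "lift l = (l, vec.span (l \<union> V1), vec.span (l \<union> V6))"

lemma span_Un_line:
  assumes "subspace_of_dim 1 l" "x \<in> l" "x \<noteq> 0"
  shows "vec.span (l \<union> V) = vec.span (insert x V)"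
proof
  have "l = vec.span {x}" using assms by (rule line_eq_span)
  then have "l \<subseteq> vec.span (insert x V)" using vec.span_mono[of "{x}" "insert x V"] by simp
  then show "vec.span (l \<union> V) \<subseteq> vec.span (insert x V)"
    by (intro vec.span_minimal) (auto intro: vec.span_base)
  show "vec.span (insert x V) \<subseteq> vec.span (l \<union> V)"
    using assms(2) by (intro vec.span_mono) auto
qed

lemma line_meets_trivially:
  assumes "subspace_of_dim 1 l" "\<not> l \<subseteq> V6" "x \<in> l" "x \<noteq> 0"
  shows "x \<notin> V6"
proof
  assume "x \<in> V6"
  then have "vec.span {x} \<subseteq> V6"
    using V6 by (intro vec.span_minimal) (auto simp: subspace_of_dim_def)
  then show False using assms line_eq_span by blast
qed

lemma lift_in_points:
  assumes "subspace_of_dim 1 l" "\<not> l \<subseteq> V6"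
  shows "lift l \<in> points (PV2 V1 V6)"
proof -
  obtain x where x: "x \<in> l" "x \<noteq> 0" using line_nonzero assms by blast
  have "x \<notin> V6" using line_meets_trivially assms x by blast
  then have "x \<notin> V1" using V1_V6 by auto
  have "subspace_of_dim (Suc 1) (vec.span (l \<union> V1))" "subspace_of_dim (Suc 6) (vec.span (l \<union> V6))"
    unfolding span_Un_line[OF assms(1) x]
    using subspace_insert_span V1 V6 \<open>x \<notin> V1\<close> \<open>x \<notin> V6\<close> by blast+
  moreover have "vec.span (l \<union> V1) \<subseteq> vec.span (l \<union> V6)" using V1_V6 by (intro vec.span_mono) auto
  ultimately show ?thesis
    using assms(1) by (auto simp: lift_def points_PV2 eval_nat_numeral intro: vec.span_base)
qed

text \<open>A generator of \<open>l\<close> lies outside \<open>V6\<close>, hence outside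
  \<open>V1\<close>; by dimension it spans \<open>U2\<close> together with \<open>V1\<close> and
  \<open>U7\<close> together with \<open>V6\<close>.\<close>

lemma lift_pr_line:
  assumes "p \<in> points (PV2 V1 V6)" "\<not> pr_line p \<subseteq> V6"
  shows "lift (pr_line p) = p"
proof -
  obtain l U2 U7 where p: "p = (l, U2, U7)" by (cases p)
  have sub: "subspace_of_dim 1 l" "subspace_of_dim (Suc 1) U2" "subspace_of_dim (Suc 6) U7"
    "l \<subseteq> U2" "V1 \<subseteq> U2" "U2 \<subseteq> U7" "V6 \<subseteq> U7"
    using assms by (simp_all add: p points_PV2 eval_nat_numeral)
  obtain x where x: "x \<in> l" "x \<noteq> 0" using line_nonzero sub(1) by blast
  have "x \<notin> V6" using line_meets_trivially assms sub x by (auto simp: p pr_line_def)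
  then have "x \<notin> V1" using V1_V6 by auto
  have "U2 = vec.span (insert x V1)" "U7 = vec.span (insert x V6)"
    using subspace_insert_eq[OF V1 sub(2,5)] subspace_insert_eq[OF V6 sub(3,7)] x sub \<open>x \<notin> V1\<close> \<open>x \<notin> V6\<close>
    by blast+
  then show ?thesis by (simp add: p lift_def pr_line_def span_Un_line[OF sub(1) x])
qed

text \<open>A generator of a line outside \<open>V6\<close> is a coordinate vector in all three
  factors, so forms pull back along the diagonal and their degrees add up.\<close>

lemma lift_morphism:
  assumes "Y \<subseteq> points PV10 - lines_in V6" "lift ` Y \<subseteq> Z" "Z \<subseteq> points (PV2 V1 V6)"
  shows "morphism PV10 Y (PV2 V1 V6) Z lift"
proof (rule morphism_by_coords[where h = "\<lambda>x. (x, x, x)" and e = "\<lambda>(d1, d2, d3). d1 + d2 + d3"])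
  show "(x, x, x) \<in> coords (PV2 V1 V6) (lift l)" if "l \<in> Y" "x \<in> coords PV10 l" for l x
  proof -
    have l: "subspace_of_dim 1 l" "\<not> l \<subseteq> V6"
      using that assms(1) by (auto simp: lines_in_def points_PV10)
    then have "x \<notin> V6" using line_meets_trivially that by (auto simp: coords_PV10)
    then show ?thesis
      using that V1_V6 by (auto simp: coords_PV10 coords_PV2 lift_def intro: vec.span_base)
  qed
  show "coords PV10 p \<noteq> {}" if "p \<in> Y" for p
  proof -
    have "subspace_of_dim 1 p" using that assms(1) points_PV10 by blast
    then obtain x where "x \<in> p" "x \<noteq> 0" by (rule line_nonzero)
    then show ?thesis by (auto simp: coords_PV10)
  qed
  show "(\<lambda>x. F (x, x, x)) \<in> forms PV10 (case d of (d1, d2, d3) \<Rightarrow> d1 + d2 + d3)"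
    if F: "F \<in> forms (PV2 V1 V6) d" for d F
  proof -
    obtain d1 d2 d3 where d: "d = (d1, d2, d3)" by (cases d)
    have "(\<lambda>x. F (x, x, x)) \<in> polynomials vec_coords"
    proof (rule polynomials_compose[where f = F and h = "\<lambda>x. (x, x, x)"])
      show "F \<in> polynomials tower_coords" using F by (simp add: d forms_PV2)
      show "(\<lambda>x. c (x, x, x)) \<in> polynomials vec_coords" if "c \<in> tower_coords" for c
        using that by (auto simp: tower_coords_def vec_coord_polynomials)
    qed
    moreover have "F (t *s x, t *s x, t *s x) = t ^ (d1 + d2 + d3) * F (x, x, x)" for t x
    proof -
      have "F (t *s x, t *s x + 0, t *s x + 0) = t ^ d1 * t ^ d2 * t ^ d3 * F (x, x, x)"
        using F subspace_of_dim_zero[OF V1] subspace_of_dim_zero[OF V6] unfolding d forms_PV2 by blast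
      then show ?thesis by (simp add: power_add)
    qed
    ultimately show ?thesis by (simp add: d forms_PV10)
  qed
  show "\<exists>d F. F \<in> forms (PV2 V1 V6) d \<and> q \<in> nonvanishing (PV2 V1 V6) F" if "q \<in> Z" for q
    using that assms(3) one_in_forms by (intro exI[of _ "(0, 0, 0)"] exI[of _ "\<lambda>_. 1"])
      (auto simp: nonvanishing_def)
  show "F c' \<noteq> 0" if "F \<in> forms (PV2 V1 V6) d" "q \<in> points (PV2 V1 V6)" "c \<in> coords (PV2 V1 V6) q"
      "c' \<in> coords (PV2 V1 V6) q" "F c \<noteq> 0" for d F q c c'
    using that by (rule welldef_PV2)
qed (use assms in auto)

theorem pr_line_birational:
  assumes "\<sigma> \<in> alternating3"
  shows "birational_morphism (PV2 V1 V6) (X_1_1 \<sigma> V1 V6) PV10 (peskine \<sigma>) pr_line"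
proof -
  interpret trivector \<sigma> by standard fact
  let ?T = "proj_topology (PV2 V1 V6)"
  define W where "W = peskine \<sigma> - lines_in V6"
  define U where "U = {p \<in> points (PV2 V1 V6). pr_line p \<in> W}"
  have X: "X_1_1 \<sigma> V1 V6 = ?T closure_of U" by (simp add: X_1_1_def U_def W_def)
  have pts: "peskine \<sigma> \<subseteq> points PV10" by (auto simp: peskine_def)
  have X_points: "X_1_1 \<sigma> V1 V6 \<subseteq> points (PV2 V1 V6)"
    using closure_of_subset_topspace[of ?T U] by (simp add: X)
  have UX: "U \<subseteq> X_1_1 \<sigma> V1 V6"
    unfolding X by (rule closure_of_subset) (auto simp: U_def)
  have pr_points: "pr_line ` points (PV2 V1 V6) \<subseteq> points PV10"
    by (auto simp: pr_line_def points_PV2 points_PV10)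
  have "morphism (PV2 V1 V6) (points (PV2 V1 V6)) PV10 (points PV10) pr_line"
    by (intro pr_line_morphism pr_points) auto
  then have cont: "continuous_map ?T (proj_topology PV10) pr_line"
    unfolding morphism_def var_topology_def
    using subtopology_topspace[of ?T] subtopology_topspace[of "proj_topology PV10"] by simp
  \<comment> \<open>The preimage of the Peskine variety is closed, so the closure defining
    \<open>X_1_1\<close> stays over it.\<close>
  have "closedin ?T {p \<in> points (PV2 V1 V6). pr_line p \<in> peskine \<sigma>}"
    using closedin_continuous_map_preimage[OF cont closedin_peskine] by simp
  then have "?T closure_of U \<subseteq> {p \<in> points (PV2 V1 V6). pr_line p \<in> peskine \<sigma>}"
    by (intro closure_of_minimal) (auto simp: U_def W_def)
  then have pr_X: "pr_line ` X_1_1 \<sigma> V1 V6 \<subseteq> peskine \<sigma>" by (auto simp: X)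
  have "openin ?T {p \<in> topspace ?T. pr_line p \<in> points PV10 - lines_in V6}"
    using openin_continuous_map_preimage[OF cont, of "points PV10 - lines_in V6"]
      closedin_lines_in[of V6] V6 by (simp add: closedin_def subspace_of_dim_def)
  \<comment> \<open>As \<open>X_1_1\<close> lies over the Peskine variety, its points outside the
    preimage of \<open>lines_in V6\<close> are exactly those of \<open>U\<close>. Hence
    \<open>U\<close> is open in it; density is built into the closure.\<close>
  moreover have "U = {p \<in> topspace ?T. pr_line p \<in> points PV10 - lines_in V6} \<inter> X_1_1 \<sigma> V1 V6"
    using UX pr_X pts by (auto simp: U_def W_def)
  ultimately have "openin (var_topology (PV2 V1 V6) (X_1_1 \<sigma> V1 V6)) U"
    unfolding var_topology_def openin_subtopology by blast
  then have U_dense: "dense_open_in (var_topology (PV2 V1 V6) (X_1_1 \<sigma> V1 V6)) U"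
    unfolding dense_open_in_def using UX X_points X
    by (auto simp: var_topology_def closure_of_subtopology inf_absorb2)
  have W_dense: "dense_open_in (var_topology PV10 (peskine \<sigma>)) W"
    unfolding W_def by (rule peskine_dense[OF V6])
  have not_sub: "\<not> l \<subseteq> V6" if "l \<in> W" for l
    using that pts by (auto simp: W_def lines_in_def)
  have lift_W: "lift ` W \<subseteq> U"
  proof
    fix p assume "p \<in> lift ` W"
    then obtain l where l: "l \<in> W" "p = lift l" by blast
    then have "subspace_of_dim 1 l" using pts by (auto simp: W_def points_PV10)
    then show "p \<in> U"
      using l not_sub lift_in_points by (auto simp: U_def lift_def pr_line_def)
  qed
  have "isomorphism (PV2 V1 V6) U PV10 W pr_line"
    unfolding isomorphism_def
  proof (intro conjI exI[of _ lift] ballI)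
    show "morphism (PV2 V1 V6) U PV10 W pr_line"
      using pts by (intro pr_line_morphism) (auto simp: U_def W_def)
    show "morphism PV10 W (PV2 V1 V6) U lift"
      using pts lift_W by (intro lift_morphism) (auto simp: U_def W_def)
    show "lift (pr_line p) = p" if "p \<in> U" for p
      using that not_sub by (intro lift_pr_line) (auto simp: U_def)
    show "pr_line (lift l) = l" for l by (simp add: lift_def pr_line_def)
  qed
  moreover have "morphism (PV2 V1 V6) (X_1_1 \<sigma> V1 V6) PV10 (peskine \<sigma>) pr_line"
    by (intro pr_line_morphism X_points pts pr_X)
  ultimately show ?thesis
    unfolding birational_morphism_def using U_dense W_dense by blast
qed

end

theorem proposition3p10:
  shows "holds_for_general_in form3_zariski D_1_6_10
    (\<lambda>\<sigma>. \<forall>V\<^sub>1 V\<^sub>6. adapted_flag \<sigma> V\<^sub>1 V\<^sub>6 \<longrightarrow>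
      birational_morphism (PV2 V\<^sub>1 V\<^sub>6) (X_1_1 \<sigma> V\<^sub>1 V\<^sub>6) PV10 (peskine \<sigma>) pr_line)"
  unfolding holds_for_general_in_def
proof (intro exI conjI ballI allI impI)
  \<comment> \<open>The dense open subset is the whole of \<open>D_1_6_10\<close>.\<close>
  have "topspace (subtopology form3_zariski D_1_6_10) = D_1_6_10"
    by (simp add: form3_zariski_def)
  then show "dense_open_in (subtopology form3_zariski D_1_6_10) D_1_6_10"
    unfolding dense_open_in_def by (metis closure_of_topspace openin_topspace)
  fix \<sigma> V1 V6 assume "\<sigma> \<in> D_1_6_10" "adapted_flag \<sigma> V1 V6"
  then interpret flag V1 V6 by unfold_locales (auto simp: adapted_flag_def)
  show "birational_morphism (PV2 V1 V6) (X_1_1 \<sigma> V1 V6) PV10 (peskine \<sigma>) pr_line"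
    using \<open>\<sigma> \<in> D_1_6_10\<close> by (intro pr_line_birational) (simp add: D_1_6_10_def)
qed

end
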